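(* Let $N\ge1$, $Z>0$, let $V$ be the atomic Coulomb potential on $\mathbb{R}^{3N}$ and $H=-\Delta+V$ the corresponding $N$-electron Hamilton operator, and let $\psi\in L^2(\mathbb{R}^{3N})$ be a real-valued normalised eigenfunction of $H$: $(H-E)\psi=0$ for some $E\in\mathbb{R}$, $\|\psi\|_{L^2(\mathbb{R}^{3N})}=1$. Let $$F(\mathbf{x})=F(x_1,\ldots,x_N)=-\sum_{j=1}^N\frac{Z}{2}|x_j|+\sum_{1\le j<k\le N}\frac14|x_j-x_k|.$$ Then $\psi$ can be represented as $$\psi=e^{F}\phi\qquad\text{with }\ \phi\in C^{1,\alpha}_{\mathrm{loc}}(\mathbb{R}^{3N})\ \text{ for all }\alpha\in(0,1).$$
   Context: Write $\mathbf{x}=(x_1,\ldots,x_N)\in\mathbb{R}^{3N}$ with $x_j\in\mathbb{R}^3$. The atomic Coulomb potential is $$V(\mathbf{x})=-\sum_{j=1}^N\frac{Z}{|x_j|}+\sum_{1\le j<k\le N}\frac{1}{|x_j-x_k|}.$$ $\Delta=\sum_{j=1}^N\Delta_j$ is the Laplacian on $\mathbb{R}^{3N}$, and $H=-\Delta+V$ is the self-adjoint operator on $L^2(\mathbb{R}^{3N})$ with quadratic form domain $W^{1,2}(\mathbb{R}^{3N})$. It is known that $\psi$ is continuous (its continuous representative is used). For $\alpha\in(0,1]$, $u\in C^{k,\alpha}_{\mathrm{loc}}(\mathbb{R}^n)$ means $u\in C^k(\mathbb{R}^n)$ and, for every multi-index $\beta$ with $|\beta|=k$ and every open ball $B(x_0,r)\subset\mathbb{R}^n$,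 $\sup_{x,y\in B(x_0,r),\,x\ne y}\frac{|D^\beta u(x)-D^\beta u(y)|}{|x-y|^\alpha}\le C(x_0,r)<\infty$. *)

theory Defs
  imports "HOL-Analysis.Analysis"
begin

section \<open>Classical derivatives and local Hoelder spaces\<close>

definition partial_deriv ::
    "'a::euclidean_space \<Rightarrow> ('a \<Rightarrow> 'b::real_normed_vector) \<Rightarrow> 'a \<Rightarrow> 'b" where
  "partial_deriv b u x = frechet_derivative u (at x) b"

text \<open>A multi-index of order \<open>k\<close> is represented by a list of \<open>k\<close> basis vectors; for functions of
  class \<open>C\<^sup>k\<close> the order of the entries is irrelevant.\<close>

definition iter_partial_deriv ::
    "'a::euclidean_space list \<Rightarrow> ('a \<Rightarrow> 'b::real_normed_vector) \<Rightarrow> 'a \<Rightarrow> 'b" where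
  "iter_partial_deriv bs u = foldr partial_deriv bs u"

primrec Ck :: "nat \<Rightarrow> ('a::euclidean_space \<Rightarrow> 'b::real_normed_vector) \<Rightarrow> bool" where
  "Ck 0 u \<longleftrightarrow> continuous_on UNIV u"
| "Ck (Suc k) u \<longleftrightarrow> (\<forall>x. u differentiable (at x)) \<and> (\<forall>b\<in>Basis. Ck k (partial_deriv b u))"

definition Ck_Hoelder_loc ::
    "nat \<Rightarrow> real \<Rightarrow> ('a::euclidean_space \<Rightarrow> 'b::real_normed_vector) \<Rightarrow> bool" where
  "Ck_Hoelder_loc k \<alpha> u \<longleftrightarrow>
     Ck k u \<and>
     (\<forall>bs. set bs \<subseteq> Basis \<and> length bs = k \<longrightarrow>
       (\<forall>x0 r. r > 0 \<longrightarrow>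
         (\<exists>C. \<forall>x\<in>ball x0 r. \<forall>y\<in>ball x0 r. x \<noteq> y \<longrightarrow>
            norm (iter_partial_deriv bs u x - iter_partial_deriv bs u y) / dist x y powr \<alpha> \<le> C)))"

section \<open>The spaces $L^2$ and $W^{1,2}$\<close>

text \<open>Elements of these spaces are represented by Borel measurable functions; almost everywhere
  equal functions are not identified.\<close>

definition L2 :: "('a::euclidean_space \<Rightarrow> 'b::real_normed_vector) set" where
  "L2 = {u \<in> borel_measurable lborel. integrable lborel (\<lambda>x. (norm (u x))\<^sup>2)}"

definition L2_norm :: "('a::euclidean_space \<Rightarrow> 'b::real_normed_vector) \<Rightarrow> real" where
  "L2_norm u = sqrt (LINT x|lborel. (norm (u x))\<^sup>2)"

definition L2_inner ::
    "('a::euclidean_space \<Rightarrow> complex) \<Rightarrow> ('a \<Rightarrow> complex) \<Rightarrow> complex" where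
  "L2_inner u v = (LINT x|lborel. cnj (u x) * v x)"

definition test_function :: "('a::euclidean_space \<Rightarrow> real) \<Rightarrow> bool" where
  "test_function \<eta> \<longleftrightarrow> (\<forall>k. Ck k \<eta>) \<and> compact (closure {x. \<eta> x \<noteq> 0})"

definition has_weak_partial_deriv ::
    "'a::euclidean_space \<Rightarrow> ('a \<Rightarrow> complex) \<Rightarrow> ('a \<Rightarrow> complex) \<Rightarrow> bool" where
  "has_weak_partial_deriv b u g \<longleftrightarrow>
     (\<forall>\<eta>. test_function \<eta> \<longrightarrow>
        (LINT x|lborel. partial_deriv b \<eta> x *\<^sub>R u x) = - (LINT x|lborel. \<eta> x *\<^sub>R g x))"

definition W12 :: "('a::euclidean_space \<Rightarrow> complex) set" where
  "W12 = {u \<in> L2. \<forall>b\<in>Basis. \<exists>g\<in>L2. has_weak_partial_deriv b u g}"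

text \<open>For \<open>u\<close> in \<^const>\<open>W12\<close> the choice is unique up to a null set.\<close>

definition weak_partial_deriv ::
    "'a::euclidean_space \<Rightarrow> ('a \<Rightarrow> complex) \<Rightarrow> 'a \<Rightarrow> complex" where
  "weak_partial_deriv b u = (SOME g. g \<in> L2 \<and> has_weak_partial_deriv b u g)"

section \<open>The operator $-\Delta + V$ with form domain $W^{1,2}$\<close>

definition schroedinger_form ::
    "('a::euclidean_space \<Rightarrow> real) \<Rightarrow> ('a \<Rightarrow> complex) \<Rightarrow> ('a \<Rightarrow> complex) \<Rightarrow> complex" where
  "schroedinger_form V u v =
     (\<Sum>b\<in>Basis. L2_inner (weak_partial_deriv b u) (weak_partial_deriv b v)) +
     (LINT x|lborel. of_real (V x) * (cnj (u x) * v x))"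

text \<open>\<open>schroedinger_op V u f\<close> means that \<open>u\<close> lies in the domain of the operator on the complex
  Hilbert space \<^const>\<open>L2\<close> associated with the form \<^const>\<open>schroedinger_form\<close> on \<^const>\<open>W12\<close>
  (first representation theorem), and that \<open>f\<close> is its image. For the Coulomb
  potential the form is symmetric, closed and bounded below, and \<open>V (cnj v) u\<close> is integrable for
  all \<open>u\<close>, \<open>v\<close> in \<^const>\<open>W12\<close>, both by Hardy's inequality.\<close>

definition schroedinger_op ::
    "('a::euclidean_space \<Rightarrow> real) \<Rightarrow> ('a \<Rightarrow> complex) \<Rightarrow> ('a \<Rightarrow> complex) \<Rightarrow> bool" where
  "schroedinger_op V u f \<longleftrightarrow>
     u \<in> W12 \<and> f \<in> L2 \<and> (\<forall>v\<in>W12. schroedinger_form V v u = L2_inner v f)"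

section \<open>Atoms\<close>

text \<open>The electrons are indexed by a finite linearly ordered type \<open>'n\<close>, so \<open>N = CARD('n)\<close>. Division by
  zero only affects the potential on the null set of its singularities.\<close>

definition coulomb_potential ::
    "real \<Rightarrow> (real^3)^'n::{finite,linorder} \<Rightarrow> real" where
  "coulomb_potential Z x =
     - (\<Sum>j\<in>UNIV. Z / norm (x $ j)) +
     (\<Sum>(j, k)\<in>{(j, k). j < k}. 1 / norm (x $ j - x $ k))"

definition atomic_F :: "real \<Rightarrow> (real^3)^'n::{finite,linorder} \<Rightarrow> real" where
  "atomic_F Z x =
     - (\<Sum>j\<in>UNIV. Z / 2 * norm (x $ j)) +
     (\<Sum>(j, k)\<in>{(j, k). j < k}. 1 / 4 * norm (x $ j - x $ k))"

abbreviation atomic_hamiltonian ::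
    "real \<Rightarrow> ((real^3)^'n::{finite,linorder} \<Rightarrow> complex) \<Rightarrow> ((real^3)^'n::{finite,linorder} \<Rightarrow> complex) \<Rightarrow> bool" where
  "atomic_hamiltonian Z \<equiv> schroedinger_op (coulomb_potential Z)"

end

(*
The Laplacian of F equals V almost everywhere, so phi = exp(-F) psi solves
Delta phi = -2 grad F . grad phi - (|grad F|^2 + E) phi, where the singular potential has
disappeared and all coefficients are bounded. The equation is obtained by testing with
exp(-F_d) zeta and exp(-F_d) zeta d_b F_d for the smooth regularisations
|y| -> sqrt(|y|^2 + d^2) and letting d tend to 0; the dominated convergence needs 1/|y|^2 locally
integrable, which follows by integrating divergences by parts.

After a cutoff, phi and grad phi are potentials with kernels |x|^(2-n) and |x|^(1-n) of a density
bounded by |phi| + |grad phi|. Iterating this integral inequality improves the integrability by half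
a power of the kernel per step, hence phi and grad phi are locally bounded. Then phi is locally the Newton
potential of a bounded density, and elementary estimates of the kernel give C^{1,alpha} for all alpha < 1.
*)

theory Submission
  imports Defs
begin

section \<open>Smooth functions and cutoffs\<close>

text \<open>Where e^F comes from: if L maps onto R^3 and L L^* is kappa times the identity, the
  Laplacian of c |L x| is 2 kappa c / |L x|. Nuclear terms have kappa = 1 and pair terms kappa = 2,
  so the charges -Z and 1 force the coefficients -Z/2 and 1/4. The two families of test functions
  have different tasks. The first, inserted into the eigenvalue equation, gives an identity that
  still contains V psi. The second, inserted into the definition of the weak gradient of psi, puts
  the pure second derivatives of F against psi; their sum over the coordinates is the Laplacian, and
  so V psi cancels. The right-hand side that remains contains grad phi and is treated as merely
  locally integrable, so the representation by potentials has to be proved for L^1 densities. It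
  results from testing with the regularised Newton kernel, which is smooth everywhere and whose
  Laplacian is, up to a constant factor, an approximate identity. The restriction alpha < 1 appears
  at the end as the condition that |x|^(1-n-alpha) be locally integrable.\<close>

definition smooth :: "('a::euclidean_space \<Rightarrow> real) \<Rightarrow> bool" where
  "smooth u \<longleftrightarrow> (\<forall>k. Ck k u)"

lemma partial_deriv_eq:
  assumes "(u has_derivative D) (at x)"
  shows "partial_deriv b u x = D b"
  using frechet_derivative_at[OF assms] by (simp add: partial_deriv_def)

lemma Ck_continuous: "Ck k u \<Longrightarrow> continuous_on UNIV u"
  by (cases k) (auto intro: continuous_at_imp_continuous_on differentiable_imp_continuous_within)

lemma Ck_const: "Ck k (\<lambda>x. c)"
proof (induction k arbitrary: c)
  case (Suc k)
  have "partial_deriv b (\<lambda>x::'a. c) = (\<lambda>x. 0)" for b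
    by (rule ext, subst partial_deriv_eq) (auto intro!: derivative_eq_intros)
  with Suc show ?case by simp
qed simp

lemma Ck_SucD: "Ck (Suc k) u \<Longrightarrow> Ck k u"
proof (induction k arbitrary: u)
  case 0
  then show ?case using Ck_continuous[of "Suc 0" u] by simp
qed auto

text \<open>\<open>partial_deriv h u x\<close> makes sense for every vector h and not only for basis
  vectors; as a function of h it is the full derivative. The rules below use it in this
  form.\<close>

lemma has_derivative_frechet:
  "u differentiable (at x) \<Longrightarrow> (u has_derivative (\<lambda>h. partial_deriv h u x)) (at x)"
  unfolding partial_deriv_def by (simp add: frechet_derivative_works flip: frechet_derivative_works)

lemma partial_deriv_add:
  assumes "u differentiable (at x)" "v differentiable (at x)"
  shows "partial_deriv b (\<lambda>x. u x + v x) x = partial_deriv b u x + partial_deriv b v x"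
  by (subst partial_deriv_eq[OF has_derivative_add[OF assms[THEN has_derivative_frechet]]]) simp

lemma partial_deriv_mult:
  fixes u v :: "'a::euclidean_space \<Rightarrow> real"
  assumes "u differentiable (at x)" "v differentiable (at x)"
  shows "partial_deriv b (\<lambda>x. u x * v x) x = partial_deriv b u x * v x + u x * partial_deriv b v x"
  by (subst partial_deriv_eq[OF has_derivative_mult[OF assms[THEN has_derivative_frechet]]]) simp

lemma partial_deriv_chain:
  fixes u :: "'a::euclidean_space \<Rightarrow> real"
  assumes "u differentiable (at x)" "(g has_real_derivative g') (at (u x))"
  shows "partial_deriv b (\<lambda>x. g (u x)) x = g' * partial_deriv b u x"
proof -
  have "((\<lambda>x. g (u x)) has_derivative (\<lambda>h. g' * partial_deriv h u x)) (at x)"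
    using has_derivative_compose[OF has_derivative_frechet[OF assms(1)] assms(2)[unfolded has_field_derivative_def]]
    by (simp add: mult.commute)
  then show ?thesis by (rule partial_deriv_eq)
qed

lemma Ck_add:
  fixes u v :: "'a::euclidean_space \<Rightarrow> real"
  shows "Ck k u \<Longrightarrow> Ck k v \<Longrightarrow> Ck k (\<lambda>x. u x + v x)"
proof (induction k arbitrary: u v)
  case (Suc k)
  then have "partial_deriv b (\<lambda>x. u x + v x) = (\<lambda>x. partial_deriv b u x + partial_deriv b v x)" for b
    by (intro ext partial_deriv_add) auto
  with Suc show ?case by auto
qed (auto intro: continuous_intros)

lemma Ck_mult:
  fixes u v :: "'a::euclidean_space \<Rightarrow> real"
  shows "Ck k u \<Longrightarrow> Ck k v \<Longrightarrow> Ck k (\<lambda>x. u x * v x)"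
proof (induction k arbitrary: u v)
  case (Suc k)
  then have "partial_deriv b (\<lambda>x. u x * v x) =
      (\<lambda>x. partial_deriv b u x * v x + u x * partial_deriv b v x)" for b
    by (intro ext partial_deriv_mult) auto
  moreover have "Ck k u" "Ck k v" using Suc.prems Ck_SucD by blast+
  ultimately show ?case using Suc by (auto intro!: Ck_add)
qed (auto intro: continuous_intros)

lemma
  assumes "smooth u"
  shows smooth_differentiable: "u differentiable (at x)" and smooth_cont: "continuous_on UNIV u"
    and smooth_Ck: "Ck k u"
  using assms Ck.simps(2)[of 0 u] Ck.simps(1)[of u] unfolding smooth_def by blast+

lemma smooth_pd: "smooth u \<Longrightarrow> b \<in> Basis \<Longrightarrow> smooth (partial_deriv b u)"
  unfolding smooth_def by (metis Ck.simps(2))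

lemma smooth_const: "smooth (\<lambda>x. c)"
  and smooth_add: "smooth u \<Longrightarrow> smooth v \<Longrightarrow> smooth (\<lambda>x. u x + v x)"
  and smooth_mult: "smooth u \<Longrightarrow> smooth v \<Longrightarrow> smooth (\<lambda>x. u x * v x)"
  by (auto simp: smooth_def intro: Ck_const Ck_add Ck_mult)

lemma smooth_minus: "smooth u \<Longrightarrow> smooth (\<lambda>x. - u x)"
  using smooth_mult[OF smooth_const[of "-1"]] by fastforce

lemma smooth_diff: "smooth u \<Longrightarrow> smooth v \<Longrightarrow> smooth (\<lambda>x. u x - v x)"
  using smooth_add[OF _ smooth_minus] by fastforce

lemma smooth_sum: "(\<And>i. i \<in> A \<Longrightarrow> smooth (u i)) \<Longrightarrow> smooth (\<lambda>x. \<Sum>i\<in>A. u i x)"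
  by (induction A rule: infinite_finite_induct) (auto intro: smooth_const smooth_add)

lemma smooth_prod: "(\<And>i. i \<in> A \<Longrightarrow> smooth (u i)) \<Longrightarrow> smooth (\<lambda>x. \<Prod>i\<in>A. u i x)"
  by (induction A rule: infinite_finite_induct) (auto intro: smooth_const smooth_mult)

lemma smooth_linear: "bounded_linear (u :: 'a::euclidean_space \<Rightarrow> real) \<Longrightarrow> smooth u"
  unfolding smooth_def
proof (intro allI)
  fix k assume u: "bounded_linear u"
  have "partial_deriv b u = (\<lambda>x. u b)" for b
    using partial_deriv_eq[OF bounded_linear_imp_has_derivative[OF u]] by auto
  moreover have "u differentiable at x" for x
    using bounded_linear_imp_has_derivative[OF u] unfolding differentiable_def by blast
  moreover have "continuous_on UNIV u" using u linear_continuous_on by blast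
  ultimately show "Ck k u" by (cases k) (auto simp: Ck_const)
qed

text \<open>A derivative that raises the index by one or two covers exponentials, powers and the
  standard bump \<open>exp (- 1 / x)\<close> at once.\<close>

lemma smooth_compose_family:
  fixes G :: "nat \<Rightarrow> real \<Rightarrow> real"
  assumes "\<And>n x. x \<in> S \<Longrightarrow>
    (G n has_real_derivative \<alpha> n * G (Suc n) x + \<beta> n * G (Suc (Suc n)) x) (at x)"
    and u: "smooth u" "\<And>x. u x \<in> S"
  shows "smooth (\<lambda>x. G n (u x))"
proof -
  have D: "(G n has_real_derivative \<alpha> n * G (Suc n) (u x) + \<beta> n * G (Suc (Suc n)) (u x)) (at (u x))" for n x
    using assms by blast
  have d: "(\<lambda>x. G n (u x)) differentiable (at x)" for n x
    using has_derivative_compose[OF has_derivative_frechet[OF smooth_differentiable[OF u(1)]] D[unfolded has_field_derivative_def]]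
    unfolding differentiable_def by blast
  have "Ck k (\<lambda>x. G n (u x))" for k
  proof (induction k arbitrary: n)
    case 0
    show ?case using differentiable_imp_continuous_within[OF d] by (auto intro: continuous_at_imp_continuous_on)
  next
    case (Suc k)
    have "partial_deriv b (\<lambda>x. G n (u x)) =
      (\<lambda>x. (\<alpha> n * G (Suc n) (u x) + \<beta> n * G (Suc (Suc n)) (u x)) * partial_deriv b u x)" for b
      using partial_deriv_chain[OF smooth_differentiable[OF u(1)] D] by auto
    moreover have "Ck k (partial_deriv b u)" if "b \<in> Basis" for b
      using u(1) that smooth_Ck smooth_pd by blast
    ultimately show ?case using Suc d
      by (auto intro!: Ck_mult Ck_add Ck_const)
  qed
  then show ?thesis by (simp add: smooth_def)
qed

lemma smooth_exp: "smooth u \<Longrightarrow> smooth (\<lambda>x. exp (u x))"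
  by (rule smooth_compose_family[where G="\<lambda>n. exp" and \<alpha>="\<lambda>n. 1" and \<beta>="\<lambda>n. 0" and S=UNIV])
    (auto intro!: derivative_eq_intros)

lemma smooth_powr:
  assumes "smooth u" "\<And>x. u x > 0"
  shows "smooth (\<lambda>x. u x powr s)"
proof -
  \<comment> \<open>This is the member of index 0 of the family x powr (s - n), in which each
    derivative raises n by one.\<close>
  have "smooth (\<lambda>x. u x powr (s - real 0))"
  proof (rule smooth_compose_family[where G="\<lambda>n x. x powr (s - real n)" and \<alpha>="\<lambda>n. s - real n" and \<beta>="\<lambda>n. 0" and S="{0<..}"])
    fix n and x :: real assume "x \<in> {0<..}"
    then have "((\<lambda>x. x powr (s - real n)) has_real_derivative (s - real n) * x powr (s - real n - 1)) (at x)"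
      by (auto intro!: has_real_derivative_powr)
    moreover have "s - real n - 1 = s - real (Suc n)" by simp
    ultimately show "((\<lambda>x. x powr (s - real n)) has_real_derivative
        (s - real n) * x powr (s - real (Suc n)) + 0 * x powr (s - real (Suc (Suc n)))) (at x)"
      by (metis add.right_neutral mult_zero_left)
  qed (use assms in auto)
  then show ?thesis by simp
qed

text \<open>\<open>bump 0\<close> is the classical flat function exp (-1/x). The negative powers of
  x close the family under differentiation, since the derivative of exp (-1/x) is exp (-1/x) /
  x^2.\<close>

definition bump :: "nat \<Rightarrow> real \<Rightarrow> real" where
  "bump n x = (if x > 0 then exp (- (1 / x)) / x ^ n else 0)"

lemma bump_tendsto_0: "(bump n \<longlongrightarrow> 0) (at_right 0)"
proof -
  have "((\<lambda>x::real. x ^ n / exp x) \<longlongrightarrow> 0) at_top" by (rule tendsto_power_div_exp_0)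
  then have "((\<lambda>x::real. inverse x ^ n / exp (inverse x)) \<longlongrightarrow> 0) (at_right 0)"
    by (rule filterlim_compose[OF _ filterlim_inverse_at_top_right])
  moreover have "\<forall>\<^sub>F x in at_right 0. inverse x ^ n / exp (inverse x) = bump n x"
    by (auto simp: eventually_at_filter bump_def field_simps exp_minus power_inverse)
  ultimately show ?thesis by (rule Lim_transform_eventually)
qed

lemma bump_deriv:
  "(bump n has_real_derivative - real n * bump (Suc n) x + 1 * bump (Suc (Suc n)) x) (at x)"
proof -
  consider "x > 0" | "x < 0" | "x = 0" by linarith
  then show ?thesis
  proof cases
    case 1
    have "((\<lambda>x. exp (- (1 / x)) / x ^ n) has_real_derivative
        - real n * bump (Suc n) x + 1 * bump (Suc (Suc n)) x) (at x)"
      using 1 by (auto intro!: derivative_eq_intros simp: bump_def field_simps)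
        (cases n; simp add: field_simps power2_eq_square)
    then show ?thesis
      by (rule has_field_derivative_transform_within_open[where S="{0<..}"]) (use 1 in \<open>auto simp: bump_def\<close>)
  next
    case 2
    have "((\<lambda>x. 0) has_real_derivative 0) (at x)" by auto
    then have "(bump n has_real_derivative 0) (at x)"
      by (rule has_field_derivative_transform_within_open[where S="{..<0}"]) (use 2 in \<open>auto simp: bump_def\<close>)
    then show ?thesis using 2 by (simp add: bump_def)
  next
    case 3
    \<comment> \<open>To the right of 0 the difference quotient of \<open>bump n\<close> at 0 is
      \<open>bump (Suc n)\<close>, so the limit already known for all indices settles
      differentiability there.\<close>
    have "((\<lambda>y. (bump n y - bump n 0) / (y - 0)) \<longlongrightarrow> 0) (at_right 0)"
      by (rule Lim_transform_eventually[OF bump_tendsto_0[of "Suc n"]])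
        (auto simp: eventually_at_filter bump_def)
    moreover have "((\<lambda>y. (bump n y - bump n 0) / (y - 0)) \<longlongrightarrow> 0) (at_left 0)"
      by (rule Lim_transform_eventually[OF tendsto_const])
        (auto simp: eventually_at_filter bump_def)
    ultimately show ?thesis using 3
      by (auto simp: has_field_derivative_iff filterlim_split_at bump_def)
  qed
qed

lemma smooth_bump: "smooth u \<Longrightarrow> smooth (\<lambda>x. bump n (u x))"
  by (rule smooth_compose_family[where \<alpha>="\<lambda>n. - real n" and \<beta>="\<lambda>n. 1" and S=UNIV])
    (use bump_deriv in auto)

lemma bump_pos: "x > 0 \<Longrightarrow> bump n x > 0" and bump_nonneg: "bump n x \<ge> 0"
  and bump_zero: "x \<le> 0 \<Longrightarrow> bump n x = 0" and bump_le_1: "bump 0 x \<le> 1"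
  by (auto simp: bump_def)

lemma smooth_norm_sq: "smooth (\<lambda>x::'a::euclidean_space. (norm x)\<^sup>2)"
proof -
  have "smooth (\<lambda>x::'a. \<Sum>b\<in>Basis. (x \<bullet> b) * (x \<bullet> b))"
    by (intro smooth_sum smooth_mult smooth_linear bounded_linear_inner_left)
  then show ?thesis by (simp add: power2_norm_eq_inner flip: euclidean_inner)
qed

lemma test_functionI:
  assumes "smooth u" "\<And>x. norm x \<ge> R \<Longrightarrow> u x = 0"
  shows "test_function u"
proof -
  have "{x. u x \<noteq> 0} \<subseteq> cball 0 R" using assms(2) by (force simp: not_le[symmetric])
  then have "compact (closure {x. u x \<noteq> 0})" using bounded_cball bounded_subset compact_closure by blast
  then show ?thesis using assms(1) by (auto simp: test_function_def smooth_def)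
qed

lemma test_functionE:
  assumes "test_function u"
  obtains R where "R > 0" "\<And>x. norm x \<ge> R \<Longrightarrow> u x = 0" "smooth u"
proof -
  have "bounded (closure {x. u x \<noteq> 0})" using assms by (auto simp: test_function_def compact_imp_bounded)
  then obtain B where "B > 0" "\<forall>x\<in>closure {x. u x \<noteq> 0}. norm x \<le> B" using bounded_pos by blast
  then have "u x = 0" if "norm x \<ge> B + 1" for x
    using that closure_subset[of "{x. u x \<noteq> 0}"] by force
  moreover have "smooth u" using assms by (auto simp: test_function_def smooth_def)
  ultimately show ?thesis using that[of "B + 1"] \<open>B > 0\<close> by auto
qed

lemma test_smooth: "test_function u \<Longrightarrow> smooth u" by (auto simp: test_function_def smooth_def)

lemma test_mult: "test_function u \<Longrightarrow> smooth v \<Longrightarrow> test_function (\<lambda>x. u x * v x)"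
  by (erule test_functionE, rule test_functionI) (auto intro: smooth_mult)

lemma partial_deriv_outside:
  assumes "\<And>x. norm x \<ge> R \<Longrightarrow> u x = 0" "norm x > R"
  shows "partial_deriv b u x = 0"
proof -
  have "((\<lambda>x. 0) has_derivative (\<lambda>h. 0)) (at x)" by simp
  moreover have "open {x::'a. norm x > R}" by (auto intro!: open_Collect_less continuous_intros)
  ultimately have "(u has_derivative (\<lambda>h. 0)) (at x)"
    by (rule has_derivative_transform_within_open) (use assms in auto)
  then show ?thesis by (rule partial_deriv_eq)
qed

lemma test_pd: "test_function u \<Longrightarrow> b \<in> Basis \<Longrightarrow> test_function (partial_deriv b u)"
proof (erule test_functionE)
  fix R assume "b \<in> Basis" "\<And>x. norm x \<ge> R \<Longrightarrow> u x = 0" "smooth u"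
  then show ?thesis
    by (intro test_functionI[where R="R + 1"] smooth_pd partial_deriv_outside[of R]) auto
qed

text \<open>The quotient a / (a + c), with a positive exactly inside radius R + 1 and c positive
  exactly outside radius R; the two regions overlap, so the denominator never vanishes. Squared
  norms are used because the norm is not smooth at the origin.\<close>

lemma smooth_cutoff_exists:
  assumes "R \<ge> 0"
  obtains \<eta> :: "'a::euclidean_space \<Rightarrow> real" where "test_function \<eta>" "smooth \<eta>"
    "\<And>x. norm x \<le> R \<Longrightarrow> \<eta> x = 1" "\<And>x. norm x \<ge> R + 1 \<Longrightarrow> \<eta> x = 0" "\<And>x. 0 \<le> \<eta> x" "\<And>x. \<eta> x \<le> 1"
proof -
  define a where "a x = bump 0 ((R+1)\<^sup>2 - (norm x)\<^sup>2)" for x :: 'a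
  define c where "c x = bump 0 ((norm x)\<^sup>2 - R\<^sup>2)" for x :: 'a
  define \<eta> where "\<eta> x = a x * (a x + c x) powr (-1)" for x
  have s: "smooth a" "smooth c"
    unfolding a_def c_def by (intro smooth_bump smooth_diff smooth_const smooth_norm_sq)+
  have nn: "a x \<ge> 0" "c x \<ge> 0" for x unfolding a_def c_def by (auto intro: bump_nonneg)
  have a0: "a x > 0" if "norm x < R + 1" for x
    unfolding a_def using that by (intro bump_pos) (simp add: power_strict_mono)
  have c0: "c x > 0" if "norm x > R" for x
    unfolding c_def using that assms by (intro bump_pos) (simp add: power_strict_mono)
  have pos: "a x + c x > 0" for x
    using nn[of x] a0[of x] c0[of x] by (cases "norm x < R + 1") force+
  have sm: "smooth \<eta>" unfolding \<eta>_def by (intro smooth_mult smooth_powr smooth_add s pos)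
  have out: "\<eta> x = 0" if "norm x \<ge> R + 1" for x
    using that assms unfolding \<eta>_def a_def by (simp add: bump_zero power_mono)
  have one: "\<eta> x = 1" if "norm x \<le> R" for x
  proof -
    have "c x = 0" using that unfolding c_def by (simp add: bump_zero power_mono)
    then show ?thesis using pos[of x] by (simp add: \<eta>_def powr_minus)
  qed
  have "0 \<le> \<eta> x" "\<eta> x \<le> 1" for x
    using nn[of x] pos[of x] unfolding \<eta>_def by (auto simp: powr_minus divide_simps)
  then show ?thesis using that[OF test_functionI[OF sm out] sm one out] by blast
qed

section \<open>Local integrability and test functions\<close>

lemma measurable_balls [measurable]: "ball a r \<in> sets borel" "cball a r \<in> sets borel"
  by simp_all

definition loc_int :: "('a::euclidean_space \<Rightarrow> real) \<Rightarrow> bool" where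
  "loc_int w \<longleftrightarrow> w \<in> borel_measurable borel \<and>
     (\<forall>R. integrable lborel (\<lambda>x. indicator (ball 0 R) x * w x))"

lemma loc_int_borel [measurable_dest]: "loc_int w \<Longrightarrow> w \<in> borel_measurable borel"
  by (simp add: loc_int_def)

lemma loc_intD: "loc_int w \<Longrightarrow> integrable lborel (\<lambda>x. indicator (ball 0 R) x * w x)"
  by (simp add: loc_int_def)

lemma loc_int_mult:
  assumes w: "loc_int w" and f: "f \<in> borel_measurable borel"
    and b: "\<And>R. \<exists>C. \<forall>x\<in>ball 0 R. \<bar>f x\<bar> \<le> C"
  shows "loc_int (\<lambda>x. f x * w x)"
  unfolding loc_int_def
proof safe
  have [measurable]: "w \<in> borel_measurable borel" "f \<in> borel_measurable borel" using w f by (auto simp: loc_int_def)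
  show "(\<lambda>x. f x * w x) \<in> borel_measurable borel" by measurable
  fix R
  obtain C where C: "\<And>x. x \<in> ball 0 R \<Longrightarrow> \<bar>f x\<bar> \<le> C" using b by blast
  show "integrable lborel (\<lambda>x. indicator (ball 0 R) x * (f x * w x))"
  proof (rule Bochner_Integration.integrable_bound)
    show "integrable lborel (\<lambda>x. C * (indicator (ball 0 R) x * w x))"
      using loc_intD[OF w] by simp
    show "AE x in lborel. norm (indicator (ball 0 R) x * (f x * w x)) \<le> norm (C * (indicator (ball 0 R) x * w x))"
      using C by (intro AE_I2) (auto simp: indicator_def abs_mult intro!: mult_right_mono order_trans[OF C abs_ge_self])
  qed measurable
qed

lemma continuous_bounded_on_ball:
  fixes f :: "'a::euclidean_space \<Rightarrow> real"
  assumes "continuous_on UNIV f"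
  shows "\<exists>C. \<forall>x\<in>ball 0 R. \<bar>f x\<bar> \<le> C"
proof -
  have "bounded (f ` cball 0 R)"
    using assms by (intro compact_imp_bounded compact_continuous_image) (auto intro: continuous_on_subset)
  then obtain C where "\<forall>y\<in>f ` cball 0 R. norm y \<le> C" by (auto simp: bounded_iff)
  then show ?thesis by (intro exI[of _ C]) auto
qed

lemma loc_int_mult_cont: "loc_int w \<Longrightarrow> continuous_on UNIV f \<Longrightarrow> loc_int (\<lambda>x. f x * w x)"
  by (intro loc_int_mult continuous_bounded_on_ball) (auto intro: borel_measurable_continuous_onI)

lemma loc_int_const: "loc_int (\<lambda>x. c)"
proof -
  have "integrable lborel (indicator (ball (0::'a) R) :: 'a \<Rightarrow> real)" for R
    by (rule integrable_real_indicator) (use emeasure_lborel_ball_finite[of 0 R] in auto)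
  then show ?thesis by (auto simp: loc_int_def)
qed

lemma loc_int_smooth: "smooth u \<Longrightarrow> loc_int u"
  using loc_int_mult_cont[OF loc_int_const[of 1] smooth_cont] by simp

lemma loc_int_add: "loc_int u \<Longrightarrow> loc_int v \<Longrightarrow> loc_int (\<lambda>x. u x + v x)"
  by (auto simp: loc_int_def algebra_simps)

lemma loc_int_cmult: "loc_int u \<Longrightarrow> loc_int (\<lambda>x. c * u x)"
  by (auto simp: loc_int_def mult.left_commute)

lemma loc_int_minus: "loc_int u \<Longrightarrow> loc_int (\<lambda>x. - u x)"
  using loc_int_cmult[of u "-1"] by simp

lemma loc_int_diff: "loc_int u \<Longrightarrow> loc_int v \<Longrightarrow> loc_int (\<lambda>x. u x - v x)"
  using loc_int_add[OF _ loc_int_minus] by fastforce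

lemma loc_int_abs: "loc_int u \<Longrightarrow> loc_int (\<lambda>x. \<bar>u x\<bar>)"
  unfolding loc_int_def
proof safe
  fix R assume "u \<in> borel_measurable borel" "\<forall>R. integrable lborel (\<lambda>x. indicator (ball 0 R) x * u x)"
  then have "integrable lborel (\<lambda>x. \<bar>indicator (ball 0 R) x * u x\<bar>)" by (intro integrable_abs) auto
  then show "integrable lborel (\<lambda>x. indicator (ball 0 R) x * \<bar>u x\<bar>)" by (simp add: abs_mult)
qed auto

lemma loc_int_sum: "(\<And>i. i \<in> A \<Longrightarrow> loc_int (u i)) \<Longrightarrow> loc_int (\<lambda>x. \<Sum>i\<in>A. u i x)"
  by (induction A rule: infinite_finite_induct) (auto intro: loc_int_const loc_int_add)

lemma loc_int_bound:
  assumes "loc_int w" "f \<in> borel_measurable borel" "\<And>x. \<bar>f x\<bar> \<le> \<bar>w x\<bar>"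
  shows "loc_int f"
  unfolding loc_int_def
proof safe
  note [measurable] = assms(2) loc_int_borel[OF assms(1)]
  show "f \<in> borel_measurable borel" by fact
  fix R
  show "integrable lborel (\<lambda>x. indicator (ball 0 R) x * f x)"
    by (rule Bochner_Integration.integrable_bound[OF loc_intD[OF assms(1), of R]])
      (use assms(3) in \<open>auto simp: indicator_def\<close>)
qed

text \<open>By 2 |f g| \<le> f^2 + g^2. Applied to f = 1 / |L x| and g = \<psi>, this is what makes
  the Coulomb potential times \<psi> locally integrable.\<close>

lemma loc_int_prod:
  assumes "loc_int (\<lambda>x. (f x)\<^sup>2)" "loc_int (\<lambda>x. (g x)\<^sup>2)" and [measurable]: "f \<in> borel_measurable borel" "g \<in> borel_measurable borel"
  shows "loc_int (\<lambda>x. f x * g x)"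
proof (rule loc_int_bound[OF loc_int_add[OF assms(1,2)]])
  fix x
  have "0 \<le> (\<bar>f x\<bar> - \<bar>g x\<bar>)\<^sup>2" by simp
  then have "2 * (\<bar>f x\<bar> * \<bar>g x\<bar>) \<le> (f x)\<^sup>2 + (g x)\<^sup>2" by (simp add: power2_diff mult.assoc)
  moreover have "0 \<le> \<bar>f x\<bar> * \<bar>g x\<bar>" by simp
  ultimately show "\<bar>f x * g x\<bar> \<le> \<bar>(f x)\<^sup>2 + (g x)\<^sup>2\<bar>" unfolding abs_mult by linarith
qed measurable

lemma loc_int_of_sq:
  assumes "loc_int (\<lambda>x. (f x)\<^sup>2)" "f \<in> borel_measurable borel"
  shows "loc_int f"
  using loc_int_prod[OF assms(1) loc_int_const[of "1\<^sup>2"] assms(2)] by simp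

lemma loc_int_of_integrable: "integrable lborel u \<Longrightarrow> loc_int u"
  unfolding loc_int_def
proof safe
  fix R assume u: "integrable lborel u"
  from borel_measurable_integrable[OF u] have [measurable]: "u \<in> borel_measurable borel" by simp
  show "u \<in> borel_measurable borel" by fact
  show "integrable lborel (\<lambda>x. indicator (ball 0 R) x * u x)"
    by (rule Bochner_Integration.integrable_bound[OF u]) (auto simp: indicator_def)
qed

lemma loc_int_integrable:
  assumes "loc_int w" "\<And>x. norm x \<ge> R \<Longrightarrow> w x = 0"
  shows "integrable lborel w"
proof -
  have "w = (\<lambda>x. indicator (ball 0 R) x * w x)" using assms(2) by (force simp: indicator_def)
  with loc_intD[OF assms(1), of R] show ?thesis by simp
qed

lemma integrable_test_mult:
  assumes "test_function \<eta>" "loc_int w"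
  shows "integrable lborel (\<lambda>x. \<eta> x * w x)"
  using assms(1)
proof (rule test_functionE)
  fix R assume "\<And>x. norm x \<ge> R \<Longrightarrow> \<eta> x = 0" "smooth \<eta>"
  then show ?thesis
    by (intro loc_int_integrable[where R=R] loc_int_mult_cont assms) (auto simp: smooth_cont)
qed

lemma integrable_test: "test_function \<eta> \<Longrightarrow> integrable lborel \<eta>"
  using integrable_test_mult[OF _ loc_int_const[of 1]] by simp

lemma test_bounded:
  assumes "test_function \<eta>"
  obtains C where "\<And>x. \<bar>\<eta> x\<bar> \<le> C" "C > 0"
proof -
  obtain R where R: "R > 0" "\<And>x. norm x \<ge> R \<Longrightarrow> \<eta> x = 0" "smooth \<eta>" using assms test_functionE by metis
  obtain C where C: "\<forall>x\<in>ball 0 R. \<bar>\<eta> x\<bar> \<le> C" using continuous_bounded_on_ball[OF smooth_cont[OF R(3)]] by blast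
  have "\<bar>\<eta> x\<bar> \<le> max C 1" for x
    using C R(2)[of x] by (cases "norm x < R") (auto simp: le_max_iff_disj)
  then show ?thesis by (intro that[of "max C 1"]) auto
qed

section \<open>Translation invariance and integration by parts\<close>

lemma lborel_affine_sign:
  fixes a :: "'a::euclidean_space"
  assumes "\<bar>c\<bar> = 1"
  shows "distr lborel borel (\<lambda>x. a + c *\<^sub>R x) = lborel"
  using lborel_affine[of c a] assms by (auto simp: density_1)

lemma integral_shift:
  fixes f :: "'a::euclidean_space \<Rightarrow> real"
  shows "integrable lborel f \<Longrightarrow> integrable lborel (\<lambda>x. f (a + x))"
    and "f \<in> borel_measurable borel \<Longrightarrow> (LINT x|lborel. f (a + x)) = (LINT x|lborel. f x)"
proof -
  have *: "distr lborel borel (\<lambda>x. a + 1 *\<^sub>R x) = lborel" by (rule lborel_affine_sign) simp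
  show "integrable lborel (\<lambda>x. f (a + x))" if "integrable lborel f"
    using that by (subst (asm) *[symmetric], subst (asm) integrable_distr_eq) auto
  show "(LINT x|lborel. f (a + x)) = (LINT x|lborel. f x)" if "f \<in> borel_measurable borel"
    using that by (subst (2) *[symmetric], subst integral_distr) auto
qed

text \<open>Difference quotients of f have integral 0 by translation invariance of Lebesgue measure.
  They converge to the derivative and are bounded by the Lipschitz constant on a fixed ball, so
  dominated convergence applies and no iterated integral is involved.\<close>

lemma integral_partial_deriv_zero:
  fixes f :: "'a::euclidean_space \<Rightarrow> real"
  assumes f: "test_function f" and b: "b \<in> Basis"
  shows "(LINT x|lborel. partial_deriv b f x) = 0"
proof -
  obtain R where R: "R > 0" "\<And>x. norm x \<ge> R \<Longrightarrow> f x = 0" and sm: "smooth f" using f test_functionE by metis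
  obtain C where C: "\<And>x. \<bar>partial_deriv b f x\<bar> \<le> C" "C > 0" using test_bounded[OF test_pd[OF f b]] by metis
  define t where "t k = inverse (real (Suc k))" for k
  have t: "0 < t k" "t k \<le> 1" for k by (auto simp: t_def divide_simps)
  have [measurable]: "f \<in> borel_measurable borel" using smooth_cont[OF sm] by (rule borel_measurable_continuous_onI)
  have [measurable]: "partial_deriv b f \<in> borel_measurable borel"
    using smooth_cont[OF smooth_pd[OF sm b]] by (rule borel_measurable_continuous_onI)
  have line: "((\<lambda>s. f (x + s *\<^sub>R b)) has_real_derivative partial_deriv b f (x + s *\<^sub>R b)) (at s)" for x s
  proof -
    have "((\<lambda>s. f (x + s *\<^sub>R b)) has_derivative (\<lambda>h. partial_deriv (h *\<^sub>R b) f (x + s *\<^sub>R b))) (at s)"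
      by (rule has_derivative_compose[OF _ has_derivative_frechet[OF smooth_differentiable[OF sm]]])
        (auto intro!: derivative_eq_intros)
    moreover have "partial_deriv (h *\<^sub>R b) f y = partial_deriv b f y * h" for h y
      using linear_scale[OF has_derivative_linear[OF has_derivative_frechet[OF smooth_differentiable[OF sm]]], of h b y]
      by (simp add: mult.commute)
    ultimately show ?thesis by (simp add: has_field_derivative_def)
  qed
  have lip: "\<bar>f (x + s *\<^sub>R b) - f x\<bar> \<le> C * s" if "s > 0" for x s
  proof -
    from MVT2[OF that, of "\<lambda>s. f (x + s *\<^sub>R b)" "\<lambda>s. partial_deriv b f (x + s *\<^sub>R b)"] line
    obtain z where "f (x + s *\<^sub>R b) - f x = s * partial_deriv b f (x + z *\<^sub>R b)" by auto
    then show ?thesis using C(1)[of "x + z *\<^sub>R b"] that by (simp add: abs_mult mult.commute)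
  qed
  have ind: "integrable lborel (indicator (ball (0::'a) r) :: 'a \<Rightarrow> real)" for r
    by (rule integrable_real_indicator) (use emeasure_lborel_ball_finite[of 0 r] in auto)
  have "(\<lambda>k. LINT x|lborel. (f (x + t k *\<^sub>R b) - f x) / t k) \<longlonglongrightarrow> (LINT x|lborel. partial_deriv b f x)"
  proof (rule integral_dominated_convergence[where w="\<lambda>x. C * indicator (ball 0 (R + 1)) x"])
    show "integrable lborel (\<lambda>x. C * indicator (ball (0::'a) (R + 1)) x)" using ind by simp
    show "AE x in lborel. (\<lambda>k. (f (x + t k *\<^sub>R b) - f x) / t k) \<longlonglongrightarrow> partial_deriv b f x"
    proof (rule AE_I2)
      fix x
      have t0: "filterlim t (at 0) sequentially"
      proof -
        have "t = (\<lambda>k. inverse (real (Suc k)))" by (rule ext) (simp add: t_def)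
        then have "t \<longlonglongrightarrow> 0" using LIMSEQ_inverse_real_of_nat by simp
        then show ?thesis unfolding filterlim_at using t(1)
          by (auto intro!: always_eventually simp: less_imp_neq[symmetric])
      qed
      have "((\<lambda>s. (f (x + s *\<^sub>R b) - f x) / s) \<longlongrightarrow> partial_deriv b f x) (at 0)"
        using line[of x 0] by (simp add: has_field_derivative_iff)
      from filterlim_compose[OF this t0]
      show "(\<lambda>k. (f (x + t k *\<^sub>R b) - f x) / t k) \<longlonglongrightarrow> partial_deriv b f x" .
    qed
    show "AE x in lborel. norm ((f (x + t k *\<^sub>R b) - f x) / t k) \<le> C * indicator (ball 0 (R + 1)) x" for k
    proof (rule AE_I2)
      fix x
      \<comment> \<open>A step of length at most 1 cannot lead from outside the ball of radius R + 1
        into the ball of radius R that carries f.\<close>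
      have "f (x + t k *\<^sub>R b) = 0" if "norm x \<ge> R + 1"
      proof (rule R)
        have "norm (x + t k *\<^sub>R b) \<ge> norm x - norm (t k *\<^sub>R b)" using norm_diff_ineq by blast
        moreover have "norm (t k *\<^sub>R b) \<le> 1" using t[of k] b by simp
        ultimately show "R \<le> norm (x + t k *\<^sub>R b)" using that by linarith
      qed
      then show "norm ((f (x + t k *\<^sub>R b) - f x) / t k) \<le> C * indicator (ball 0 (R + 1)) x"
        using lip[OF t(1), of x k] t[of k] R(2)[of x]
        by (cases "norm x < R + 1") (auto simp: indicator_def divide_simps)
    qed
  qed measurable
  moreover have "(LINT x|lborel. (f (x + t k *\<^sub>R b) - f x) / t k) = 0" for k
  proof -
    have "integrable lborel (\<lambda>x. f (x + t k *\<^sub>R b))"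
      using integral_shift(1)[OF integrable_test[OF f], of "t k *\<^sub>R b"] by (simp add: add.commute)
    moreover have "(LINT x|lborel. f (x + t k *\<^sub>R b)) = (LINT x|lborel. f x)"
      using integral_shift(2)[of f "t k *\<^sub>R b"] by (simp add: add.commute)
    ultimately show ?thesis using integrable_test[OF f] by simp
  qed
  ultimately have "(\<lambda>k. 0) \<longlonglongrightarrow> (LINT x|lborel. partial_deriv b f x)" by (simp only:)
  then show ?thesis using LIMSEQ_unique[OF _ tendsto_const] by blast
qed

lemma integration_by_parts:
  assumes "test_function \<eta>" "smooth v" "b \<in> Basis"
  shows "(LINT x|lborel. partial_deriv b \<eta> x * v x) = - (LINT x|lborel. \<eta> x * partial_deriv b v x)"
proof -
  have li: "loc_int v" "loc_int (partial_deriv b v)"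
    using loc_int_mult_cont[OF loc_int_const[of 1]] smooth_cont[OF assms(2)] smooth_cont[OF smooth_pd[OF assms(2,3)]] by fastforce+
  have "partial_deriv b (\<lambda>x. \<eta> x * v x) = (\<lambda>x. partial_deriv b \<eta> x * v x + \<eta> x * partial_deriv b v x)"
    using assms by (intro ext partial_deriv_mult) (auto simp: smooth_differentiable test_smooth)
  then have "(LINT x|lborel. partial_deriv b \<eta> x * v x + \<eta> x * partial_deriv b v x) = 0"
    using integral_partial_deriv_zero[OF test_mult[OF assms(1,2)] assms(3)] by simp
  then show ?thesis
    using integrable_test_mult[OF assms(1) li(2)] integrable_test_mult[OF test_pd[OF assms(1,3)] li(1)] by simp
qed

section \<open>The fundamental lemma of the calculus of variations\<close>

lemma bump_scaled_tendsto: "(\<lambda>k. bump 0 (real (Suc k) * s)) \<longlonglongrightarrow> (if s > 0 then 1 else 0)"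
proof (cases "s > 0")
  case True
  have "(\<lambda>k. exp (- (1 / s * inverse (real (Suc k))))) \<longlonglongrightarrow> exp (- (1 / s * 0))"
    by (intro tendsto_intros LIMSEQ_inverse_real_of_nat)
  moreover have "exp (- (1 / s * inverse (real (Suc k)))) = bump 0 (real (Suc k) * s)" for k
    using True by (simp add: bump_def divide_simps mult.commute del: of_nat_Suc)
  ultimately show ?thesis using True by simp
next
  case False
  then have "bump 0 (real (Suc k) * s) = 0" for k
    by (intro bump_zero) (simp add: mult_nonneg_nonpos)
  then show ?thesis using False by simp
qed

text \<open>A product over the coordinates of scaled bumps vanishes exactly off the open box, stays
  between 0 and 1, and tends to 1 inside. Thus w on a ball around the box dominates, and the
  indicator of the box is reached as a limit of test functions.\<close>

lemma box_integral_zero: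
  fixes w :: "'a::euclidean_space \<Rightarrow> real"
  assumes w: "loc_int w" and z: "\<And>\<eta>. test_function \<eta> \<Longrightarrow> (LINT x|lborel. \<eta> x * w x) = 0"
  shows "(LINT x|lborel. indicator (box l u) x * w x) = 0"
proof -
  define \<zeta> where "\<zeta> k x = (\<Prod>i\<in>Basis. bump 0 (real (Suc k) * (x \<bullet> i - l \<bullet> i)) * bump 0 (real (Suc k) * (u \<bullet> i - x \<bullet> i)))"
    for k and x :: 'a
  have [measurable]: "w \<in> borel_measurable borel" using w by (rule loc_int_borel)
  have lin: "smooth (\<lambda>x. x \<bullet> i)" for i :: 'a by (intro smooth_linear bounded_linear_inner_left)
  have sm: "smooth (\<zeta> k)" for k
    unfolding \<zeta>_def by (intro smooth_prod smooth_mult smooth_bump smooth_const smooth_diff lin)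
  then have [measurable]: "\<zeta> k \<in> borel_measurable borel" for k
    using smooth_cont borel_measurable_continuous_onI by blast
  have \<zeta>01: "0 \<le> \<zeta> k x" "\<zeta> k x \<le> 1" for k x
    unfolding \<zeta>_def by (auto intro!: prod_nonneg prod_le_1 mult_le_one simp: bump_nonneg bump_le_1)
  have out: "\<zeta> k x = 0" if "x \<notin> box l u" for k x
  proof -
    from that obtain i where i: "i \<in> Basis" "x \<bullet> i \<le> l \<bullet> i \<or> u \<bullet> i \<le> x \<bullet> i" by (auto simp: box_def not_less)
    then have "bump 0 (real (Suc k) * (x \<bullet> i - l \<bullet> i)) * bump 0 (real (Suc k) * (u \<bullet> i - x \<bullet> i)) = 0"
      by (auto intro!: bump_zero mult_nonneg_nonpos simp del: of_nat_Suc)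
    then show ?thesis unfolding \<zeta>_def using i(1) by (meson finite_Basis prod_zero)
  qed
  obtain R where R: "box l u \<subseteq> ball 0 R" using bounded_box bounded_subset_ballD by blast
  have "test_function (\<zeta> k)" for k
    by (rule test_functionI[where R=R, OF sm]) (use out R in force)
  then have "(LINT x|lborel. \<zeta> k x * w x) = 0" for k using z by blast
  moreover have "(\<lambda>k. LINT x|lborel. \<zeta> k x * w x) \<longlonglongrightarrow> (LINT x|lborel. indicator (box l u) x * w x)"
  proof (rule integral_dominated_convergence[where w="\<lambda>x. \<bar>indicator (ball 0 R) x * w x\<bar>"])
    show "integrable lborel (\<lambda>x. \<bar>indicator (ball 0 R) x * w x\<bar>)" using loc_intD[OF w] by (rule integrable_abs)
    show "AE x in lborel. norm (\<zeta> k x * w x) \<le> \<bar>indicator (ball 0 R) x * w x\<bar>" for k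
    proof (rule AE_I2)
      fix x show "norm (\<zeta> k x * w x) \<le> \<bar>indicator (ball 0 R) x * w x\<bar>"
        using \<zeta>01[where k=k and x=x] out[of x k] R by (cases "x \<in> box l u") (auto simp: abs_mult mult_left_le_one_le)
    qed
    show "AE x in lborel. (\<lambda>k. \<zeta> k x * w x) \<longlonglongrightarrow> indicator (box l u) x * w x"
    proof (intro AE_I2 tendsto_mult tendsto_const)
      fix x
      show "(\<lambda>k. \<zeta> k x) \<longlonglongrightarrow> indicator (box l u) x"
      proof (cases "x \<in> box l u")
        case True
        have "(\<lambda>k. \<zeta> k x) \<longlonglongrightarrow> (\<Prod>i\<in>Basis. (if x \<bullet> i - l \<bullet> i > 0 then 1 else 0) * (if u \<bullet> i - x \<bullet> i > 0 then 1 else 0))"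
          unfolding \<zeta>_def by (intro tendsto_prod tendsto_mult bump_scaled_tendsto)
        also have "(\<Prod>i\<in>Basis. (if x \<bullet> i - l \<bullet> i > 0 then 1 else 0) * (if u \<bullet> i - x \<bullet> i > 0 then 1 else 0)) = (1::real)"
          using True by (intro prod.neutral) (auto simp: box_def)
        finally show ?thesis using True by simp
      qed (simp add: out)
    qed
  qed measurable
  ultimately show ?thesis by (simp add: LIMSEQ_const_iff)
qed

text \<open>The measures with densities w^+ and w^- agree on open boxes, which form an
  intersection-stable generator of finite measure. Hence they are equal, so w^+ = w^- almost
  everywhere, and since one of the two always vanishes, w = 0.\<close>

lemma fundamental_lemma:
  fixes w :: "'a::euclidean_space \<Rightarrow> real"
  assumes w: "loc_int w" and z: "\<And>\<eta>. test_function \<eta> \<Longrightarrow> (LINT x|lborel. \<eta> x * w x) = 0"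
  shows "AE x in lborel. w x = 0"
proof -
  \<comment> \<open>\<open>ennreal\<close> sends negative reals to 0, so s = 1 and s = -1 give the
    densities w^+ and w^-.\<close>
  define M where "M s = density lborel (\<lambda>x. ennreal (s * w x))" for s
  have [measurable]: "w \<in> borel_measurable borel" using w by (rule loc_int_borel)
  have box: "emeasure (M s) (box l u) = ennreal (LINT x|lborel. indicator (box l u) x * max 0 (s * w x))"
    and box_int: "integrable lborel (\<lambda>x. indicator (box l u) x * max 0 (s * w x))" for s l u
  proof -
    obtain R where R: "box l u \<subseteq> ball 0 R" using bounded_box bounded_subset_ballD by blast
    show *: "integrable lborel (\<lambda>x. indicator (box l u) x * max 0 (s * w x))"
      by (rule Bochner_Integration.integrable_bound[OF integrable_mult_right[OF loc_intD[OF w, of R], of s]])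
        (use R in \<open>auto simp: indicator_def subset_eq\<close>)
    have "emeasure (M s) (box l u) = (\<integral>\<^sup>+x. ennreal (s * w x) * indicator (box l u) x \<partial>lborel)"
      unfolding M_def by (subst emeasure_density) auto
    also have "\<dots> = (\<integral>\<^sup>+x. ennreal (indicator (box l u) x * max 0 (s * w x)) \<partial>lborel)"
      by (intro nn_integral_cong) (auto simp: indicator_def ennreal_neg max_def)
    also have "\<dots> = ennreal (LINT x|lborel. indicator (box l u) x * max 0 (s * w x))"
      by (rule nn_integral_eq_integral[OF *]) auto
    finally show "emeasure (M s) (box l u) = \<dots>" .
  qed
  have eq: "emeasure (M 1) (box l u) = emeasure (M (-1)) (box l u)" for l u
  proof -
    have "(LINT x|lborel. indicator (box l u) x * max 0 (1 * w x)) - (LINT x|lborel. indicator (box l u) x * max 0 (-1 * w x))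
       = (LINT x|lborel. indicator (box l u) x * max 0 (1 * w x) - indicator (box l u) x * max 0 (-1 * w x))"
      by (rule Bochner_Integration.integral_diff[symmetric]) (rule box_int)+
    also have "\<dots> = (LINT x|lborel. indicator (box l u) x * w x)"
      by (intro Bochner_Integration.integral_cong) (auto simp: indicator_def max_def)
    also have "\<dots> = 0" by (rule box_integral_zero[OF w z])
    finally show ?thesis unfolding box by simp
  qed
  have "M 1 = M (-1)"
  proof (rule measure_eqI_generator_eq)
    let ?E = "range (\<lambda>(a, b). box a b::'a set)"
    show "Int_stable ?E" by (auto simp: Int_stable_def box_Int_box)
    show "?E \<subseteq> Pow UNIV" "sets (M 1) = sigma_sets UNIV ?E" "sets (M (-1)) = sigma_sets UNIV ?E"
      by (simp_all add: borel_eq_box M_def)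
    let ?A = "\<lambda>n::nat. box (- (real n *\<^sub>R One)) (real n *\<^sub>R One) :: 'a set"
    show "range ?A \<subseteq> ?E" "(\<Union>i. ?A i) = UNIV" unfolding UN_box_eq_UNIV by auto
    show "emeasure (M 1) (?A i) \<noteq> \<infinity>" for i unfolding box by simp
    show "emeasure (M 1) X = emeasure (M (-1)) X" if "X \<in> ?E" for X using that eq by auto
  qed
  then have "AE x in lborel. ennreal (1 * w x) = ennreal (-1 * w x)"
    unfolding M_def by (subst (asm) sigma_finite_measure.density_unique_iff[OF sigma_finite_lborel]) auto
  then show ?thesis
  proof eventually_elim
    case (elim x)
    then show ?case
      by (cases "w x \<ge> 0") (auto simp: ennreal_neg ennreal_eq_0_iff not_le zero_less_iff_neq_zero dest!: sym[of 0])
  qed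
qed

section \<open>The weak form of the eigenvalue equation\<close>

lemma test_in_L2:
  assumes "test_function \<eta>"
  shows "(\<lambda>x. complex_of_real (\<eta> x)) \<in> L2"
proof -
  have [measurable]: "\<eta> \<in> borel_measurable borel"
    using smooth_cont[OF test_smooth[OF assms]] by (rule borel_measurable_continuous_onI)
  have "integrable lborel (\<lambda>x. \<eta> x * \<eta> x)"
    by (rule integrable_test[OF test_mult[OF assms test_smooth[OF assms]]])
  then show ?thesis by (auto simp: L2_def power2_eq_square)
qed

lemma weak_deriv_test:
  assumes "test_function \<zeta>" "b \<in> Basis"
  shows "has_weak_partial_deriv b (\<lambda>x. complex_of_real (\<zeta> x)) (\<lambda>x. complex_of_real (partial_deriv b \<zeta> x))"
  unfolding has_weak_partial_deriv_def
proof safe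
  fix \<eta> :: "'a \<Rightarrow> real" assume "test_function \<eta>"
  from integration_by_parts[OF this test_smooth[OF assms(1)] assms(2)]
  show "(LINT x|lborel. partial_deriv b \<eta> x *\<^sub>R complex_of_real (\<zeta> x)) =
      - (LINT x|lborel. \<eta> x *\<^sub>R complex_of_real (partial_deriv b \<zeta> x))"
    by (simp add: scaleR_conv_of_real integral_complex_of_real flip: of_real_mult of_real_minus)
qed

lemma test_in_W12: "test_function \<zeta> \<Longrightarrow> (\<lambda>x. complex_of_real (\<zeta> x)) \<in> W12"
  unfolding W12_def using test_in_L2 weak_deriv_test test_pd by blast

lemma L2_loc_int:
  fixes g :: "'a::euclidean_space \<Rightarrow> complex"
  assumes g: "g \<in> L2"
  shows "loc_int (\<lambda>x. (Re (g x))\<^sup>2)" "loc_int (\<lambda>x. (Im (g x))\<^sup>2)" "loc_int (\<lambda>x. norm (g x))"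
    "(\<lambda>x. Re (g x)) \<in> borel_measurable borel" "(\<lambda>x. Im (g x)) \<in> borel_measurable borel" "g \<in> borel_measurable borel"
proof -
  show [measurable]: "g \<in> borel_measurable borel" using g by (auto simp: L2_def)
  show "(\<lambda>x. Re (g x)) \<in> borel_measurable borel" "(\<lambda>x. Im (g x)) \<in> borel_measurable borel" by measurable
  have n: "loc_int (\<lambda>x. (norm (g x))\<^sup>2)"
    using g by (auto simp: L2_def intro: loc_int_of_integrable)
  show "loc_int (\<lambda>x. (Re (g x))\<^sup>2)" "loc_int (\<lambda>x. (Im (g x))\<^sup>2)"
    by (rule loc_int_bound[OF n]; simp add: cmod_def)+
  show "loc_int (\<lambda>x. norm (g x))" by (rule loc_int_of_sq[OF n]) measurable
qed

lemma L2_test_integrable: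
  fixes g :: "'a::euclidean_space \<Rightarrow> complex"
  assumes "g \<in> L2" "test_function \<eta>"
  shows "integrable lborel (\<lambda>x. \<eta> x *\<^sub>R g x)"
    "Re (LINT x|lborel. \<eta> x *\<^sub>R g x) = (LINT x|lborel. \<eta> x * Re (g x))"
    "Im (LINT x|lborel. \<eta> x *\<^sub>R g x) = (LINT x|lborel. \<eta> x * Im (g x))"
proof -
  have [measurable]: "\<eta> \<in> borel_measurable borel" "g \<in> borel_measurable borel"
    using smooth_cont[OF test_smooth[OF assms(2)]] L2_loc_int[OF assms(1)]
    by (auto intro: borel_measurable_continuous_onI)
  show *: "integrable lborel (\<lambda>x. \<eta> x *\<^sub>R g x)"
    by (rule Bochner_Integration.integrable_bound[OF integrable_test_mult[OF assms(2) L2_loc_int(3)[OF assms(1)]]])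
      (auto simp: abs_mult)
  show "Re (LINT x|lborel. \<eta> x *\<^sub>R g x) = (LINT x|lborel. \<eta> x * Re (g x))"
    "Im (LINT x|lborel. \<eta> x *\<^sub>R g x) = (LINT x|lborel. \<eta> x * Im (g x))"
    using integral_bounded_linear[OF bounded_linear_Re *] integral_bounded_linear[OF bounded_linear_Im *] by auto
qed

text \<open>\<open>weak_partial_deriv\<close> is an arbitrary choice. Uniqueness up to null sets is
  what allows it to be replaced by the classical derivative when the form is evaluated at a test
  function.\<close>

lemma weak_deriv_unique:
  assumes "g \<in> L2" "g' \<in> L2" "has_weak_partial_deriv b u g" "has_weak_partial_deriv b u g'"
  shows "AE x in lborel. g x = g' x"
proof -
  have eq: "(LINT x|lborel. \<eta> x *\<^sub>R g x) = (LINT x|lborel. \<eta> x *\<^sub>R g' x)" if "test_function \<eta>" for \<eta>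
    using assms(3,4) that unfolding has_weak_partial_deriv_def by (metis minus_minus)
  note li = loc_int_of_sq[OF L2_loc_int(1,4)] loc_int_of_sq[OF L2_loc_int(2,5)]
  have "AE x in lborel. Re (g x) - Re (g' x) = 0"
  proof (rule fundamental_lemma)
    show "loc_int (\<lambda>x. Re (g x) - Re (g' x))" using li assms by (intro loc_int_diff)
    fix \<eta> :: "'a \<Rightarrow> real" assume \<eta>: "test_function \<eta>"
    show "(LINT x|lborel. \<eta> x * (Re (g x) - Re (g' x))) = 0"
      using arg_cong[OF eq[OF \<eta>], of Re] L2_test_integrable(2)[OF _ \<eta>] assms
        integrable_test_mult[OF \<eta> li(1)] by (simp add: right_diff_distrib)
  qed
  moreover have "AE x in lborel. Im (g x) - Im (g' x) = 0"
  proof (rule fundamental_lemma)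
    show "loc_int (\<lambda>x. Im (g x) - Im (g' x))" using li assms by (intro loc_int_diff)
    fix \<eta> :: "'a \<Rightarrow> real" assume \<eta>: "test_function \<eta>"
    show "(LINT x|lborel. \<eta> x * (Im (g x) - Im (g' x))) = 0"
      using arg_cong[OF eq[OF \<eta>], of Im] L2_test_integrable(3)[OF _ \<eta>] assms
        integrable_test_mult[OF \<eta> li(2)] by (simp add: right_diff_distrib)
  qed
  ultimately show ?thesis by eventually_elim (auto simp: complex_eq_iff)
qed

lemma weak_partial_deriv_W12:
  assumes "u \<in> W12" "b \<in> Basis"
  shows "weak_partial_deriv b u \<in> L2" "has_weak_partial_deriv b u (weak_partial_deriv b u)"
proof -
  have "\<exists>g. g \<in> L2 \<and> has_weak_partial_deriv b u g" using assms by (auto simp: W12_def)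
  from someI_ex[OF this] show "weak_partial_deriv b u \<in> L2" "has_weak_partial_deriv b u (weak_partial_deriv b u)"
    by (auto simp: weak_partial_deriv_def)
qed

lemma L2_real_loc_int:
  fixes \<psi> :: "'a::euclidean_space \<Rightarrow> real"
  assumes "\<psi> \<in> L2"
  shows "loc_int (\<lambda>x. (\<psi> x)\<^sup>2)" "\<psi> \<in> borel_measurable borel"
  using assms by (auto simp: L2_def intro: loc_int_of_integrable)

text \<open>Test functions are real and \<psi> is real, so taking real parts of the form identity
  gives a real equation; p is the real part of the chosen weak gradient. This is the only place
  where the operator itself is unfolded.\<close>

lemma eigenfunction_weak_equation:
  fixes \<psi> :: "'a::euclidean_space \<Rightarrow> real"
  assumes op: "schroedinger_op V (\<lambda>x. complex_of_real (\<psi> x)) (\<lambda>x. complex_of_real E * complex_of_real (\<psi> x))"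
    and \<psi>: "\<psi> \<in> L2"
  obtains p where
    "\<And>b. b \<in> Basis \<Longrightarrow> p b \<in> borel_measurable borel"
    "\<And>b. b \<in> Basis \<Longrightarrow> loc_int (\<lambda>x. (p b x)\<^sup>2)"
    "\<And>b \<zeta>. b \<in> Basis \<Longrightarrow> test_function \<zeta> \<Longrightarrow>
      (LINT x|lborel. partial_deriv b \<zeta> x * \<psi> x) = - (LINT x|lborel. \<zeta> x * p b x)"
    "\<And>\<zeta>. test_function \<zeta> \<Longrightarrow>
      (\<Sum>b\<in>Basis. LINT x|lborel. partial_deriv b \<zeta> x * p b x) + (LINT x|lborel. \<zeta> x * (V x * \<psi> x)) =
      E * (LINT x|lborel. \<zeta> x * \<psi> x)"
proof -
  define u where "u x = complex_of_real (\<psi> x)" for x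
  have uW: "u \<in> W12" and form: "\<And>v. v \<in> W12 \<Longrightarrow> schroedinger_form V v u = L2_inner v (\<lambda>x. complex_of_real E * u x)"
    using op unfolding schroedinger_op_def u_def by auto
  define P where "P b = weak_partial_deriv b u" for b
  have P: "P b \<in> L2" "has_weak_partial_deriv b u (P b)" if "b \<in> Basis" for b
    using weak_partial_deriv_W12[OF uW that] by (auto simp: P_def)
  have uL: "u \<in> L2" using uW by (simp add: W12_def)
  show ?thesis
  proof (rule that[of "\<lambda>b x. Re (P b x)"])
    fix b :: 'a assume b: "b \<in> Basis"
    show "(\<lambda>x. Re (P b x)) \<in> borel_measurable borel" "loc_int (\<lambda>x. (Re (P b x))\<^sup>2)"
      using L2_loc_int[OF P(1)[OF b]] by auto
    fix \<zeta> :: "'a \<Rightarrow> real" assume \<zeta>: "test_function \<zeta>"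
    have "(LINT x|lborel. partial_deriv b \<zeta> x *\<^sub>R u x) = - (LINT x|lborel. \<zeta> x *\<^sub>R P b x)"
      using P(2)[OF b] \<zeta> by (auto simp: has_weak_partial_deriv_def)
    then have "Re (LINT x|lborel. partial_deriv b \<zeta> x *\<^sub>R u x) = - Re (LINT x|lborel. \<zeta> x *\<^sub>R P b x)" by simp
    then show "(LINT x|lborel. partial_deriv b \<zeta> x * \<psi> x) = - (LINT x|lborel. \<zeta> x * Re (P b x))"
      using L2_test_integrable(2)[OF uL test_pd[OF \<zeta> b]] L2_test_integrable(2)[OF P(1)[OF b] \<zeta>] by (simp add: u_def)
  next
    fix \<zeta> :: "'a \<Rightarrow> real" assume \<zeta>: "test_function \<zeta>"
    define v where "v x = complex_of_real (\<zeta> x)" for x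
    have vW: "v \<in> W12" using test_in_W12[OF \<zeta>] by (simp add: v_def[abs_def])
    have D: "Re (L2_inner (weak_partial_deriv b v) (P b)) = (LINT x|lborel. partial_deriv b \<zeta> x * Re (P b x))"
      if b: "b \<in> Basis" for b
    proof -
      have "AE x in lborel. weak_partial_deriv b v x = complex_of_real (partial_deriv b \<zeta> x)"
        by (rule weak_deriv_unique[OF weak_partial_deriv_W12(1)[OF vW b] test_in_L2[OF test_pd[OF \<zeta> b]]
              weak_partial_deriv_W12(2)[OF vW b]])
          (use weak_deriv_test[OF \<zeta> b] in \<open>simp add: v_def[abs_def]\<close>)
      moreover have [measurable]: "weak_partial_deriv b v \<in> borel_measurable borel" "P b \<in> borel_measurable borel"
        "partial_deriv b \<zeta> \<in> borel_measurable borel"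
        using L2_loc_int(6)[OF weak_partial_deriv_W12(1)[OF vW b]] L2_loc_int(6)[OF P(1)[OF b]]
          smooth_cont[OF test_smooth[OF test_pd[OF \<zeta> b]]] by (auto intro: borel_measurable_continuous_onI)
      moreover have [measurable]: "cnj \<in> borel_measurable borel"
        by (intro borel_measurable_continuous_onI continuous_intros)
      ultimately have "L2_inner (weak_partial_deriv b v) (P b) = (LINT x|lborel. partial_deriv b \<zeta> x *\<^sub>R P b x)"
        unfolding L2_inner_def by (intro integral_cong_AE) (auto simp: scaleR_conv_of_real)
      then show ?thesis using L2_test_integrable(2)[OF P(1)[OF b] test_pd[OF \<zeta> b]] by simp
    qed
    \<comment> \<open>The integrand is a real function embedded into the complex numbers, and the
      embedding commutes with the integral unconditionally, both sides being 0 by convention in the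
      non-integrable case.\<close>
    have "(\<lambda>x. of_real (V x) * (cnj (v x) * u x)) = (\<lambda>x. complex_of_real (\<zeta> x * (V x * \<psi> x)))"
      by (auto simp: v_def u_def)
    then have V: "(LINT x|lborel. of_real (V x) * (cnj (v x) * u x)) = complex_of_real (LINT x|lborel. \<zeta> x * (V x * \<psi> x))"
      by (simp only: integral_complex_of_real)
    have "(\<lambda>x. cnj (v x) * (complex_of_real E * u x)) = (\<lambda>x. complex_of_real (E * (\<zeta> x * \<psi> x)))"
      by (auto simp: v_def u_def)
    then have R: "L2_inner v (\<lambda>x. complex_of_real E * u x) = complex_of_real (E * (LINT x|lborel. \<zeta> x * \<psi> x))"
      unfolding L2_inner_def by (simp only: integral_complex_of_real integral_mult_right_zero)
    from arg_cong[OF form[OF vW], of Re]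
    show "(\<Sum>b\<in>Basis. LINT x|lborel. partial_deriv b \<zeta> x * Re (P b x)) + (LINT x|lborel. \<zeta> x * (V x * \<psi> x)) =
      E * (LINT x|lborel. \<zeta> x * \<psi> x)"
      unfolding schroedinger_form_def R V by (simp add: D flip: P_def)
  qed
qed

section \<open>Coisometries and local integrability of the singular weights\<close>

lemma partial_deriv_powr:
  fixes u :: "'a::euclidean_space \<Rightarrow> real"
  assumes "u differentiable (at x)" "u x > 0"
  shows "partial_deriv b (\<lambda>x. u x powr s) x = s * u x powr (s - 1) * partial_deriv b u x"
  by (rule partial_deriv_chain[OF assms(1)]) (use has_real_derivative_powr[OF assms(2)] in simp)

lemma loc_integral_tendsto:
  assumes w: "loc_int w" and [measurable]: "g \<in> borel_measurable borel" "\<And>k. h k \<in> borel_measurable borel"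
    and b: "\<And>k. AE x in lborel. \<bar>h k x\<bar> \<le> C * indicator (ball 0 R) x * \<bar>w x\<bar>"
    and lim: "AE x in lborel. (\<lambda>k::nat. h k x) \<longlonglongrightarrow> g x"
  shows "(\<lambda>k. LINT x|lborel. h k x) \<longlonglongrightarrow> (LINT x|lborel. g x)" "integrable lborel g"
proof -
  have i: "integrable lborel (\<lambda>x. C * indicator (ball 0 R) x * \<bar>w x\<bar>)"
    using loc_intD[OF loc_int_abs[OF w]] by (simp add: mult.assoc)
  show "(\<lambda>k. LINT x|lborel. h k x) \<longlonglongrightarrow> (LINT x|lborel. g x)"
    by (rule integral_dominated_convergence[OF _ _ i lim]) (use b in auto)
  show "integrable lborel g"
    by (rule integrable_dominated_convergence[OF _ _ i lim]) (use b in auto)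
qed

text \<open>\<open>reg L d x powr (s / 2)\<close> is the smooth substitute for |L x|^s; d enters
  squared so that it has the dimension of a length.\<close>

definition reg :: "('a::euclidean_space \<Rightarrow> 'c::euclidean_space) \<Rightarrow> real \<Rightarrow> 'a \<Rightarrow> real" where
  "reg L d x = (norm (L x))\<^sup>2 + d\<^sup>2"

lemma reg_pos: "d > 0 \<Longrightarrow> reg L d x > 0"
  by (simp add: reg_def add_nonneg_pos)

text \<open>The last assumption says that \<open>L\<close> composed with its adjoint is \<open>\<kappa>\<close> times the identity.
  Up to the factor \<open>\<kappa>\<close>, functions of \<open>L x\<close> then have the gradients and Laplacians of functions on
  the target; the identity map serves for the Newton kernel, \<open>x $ j - x $ k\<close> for the Coulomb terms.\<close>

locale coisometry =
  fixes L :: "'a::euclidean_space \<Rightarrow> 'c::euclidean_space" and \<kappa> :: real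
  assumes lin: "bounded_linear L" and kpos: "\<kappa> > 0"
    and coiso: "(\<Sum>b\<in>Basis. (y \<bullet> L b)\<^sup>2) = \<kappa> * (norm y)\<^sup>2"
begin

lemma smooth_inner: "smooth (\<lambda>x. L x \<bullet> y)"
  by (intro smooth_linear bounded_linear_compose[OF bounded_linear_inner_left lin])

lemma pd_inner: "partial_deriv b (\<lambda>x. L x \<bullet> y) x = L b \<bullet> y"
  using partial_deriv_eq[OF bounded_linear_imp_has_derivative[OF
    bounded_linear_compose[OF bounded_linear_inner_left lin]]] by simp

lemma smooth_reg: "smooth (reg L d)"
proof -
  have "smooth (\<lambda>x. (\<Sum>i\<in>Basis. (L x \<bullet> i) * (L x \<bullet> i)) + d\<^sup>2)"
    by (intro smooth_sum smooth_mult smooth_add smooth_const smooth_inner)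
  moreover have "(\<lambda>x. (\<Sum>i\<in>Basis. (L x \<bullet> i) * (L x \<bullet> i)) + d\<^sup>2) = reg L d"
    by (simp add: reg_def fun_eq_iff power2_norm_eq_inner euclidean_inner[of "L _" "L _"])
  ultimately show ?thesis by simp
qed

lemma pd_reg: "partial_deriv b (reg L d) x = 2 * (L x \<bullet> L b)"
proof -
  have "((\<lambda>x. L x \<bullet> L x + d\<^sup>2) has_derivative (\<lambda>h. L x \<bullet> L h + L h \<bullet> L x + 0)) (at x)"
    by (intro has_derivative_add has_derivative_inner has_derivative_const bounded_linear_imp_has_derivative lin)
  then have "(reg L d has_derivative (\<lambda>h. L x \<bullet> L h + L h \<bullet> L x + 0)) (at x)"
    by (simp add: reg_def[abs_def] power2_norm_eq_inner)
  from partial_deriv_eq[OF this] show ?thesis by (simp add: inner_commute)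
qed

lemma smooth_reg_powr: "d > 0 \<Longrightarrow> smooth (\<lambda>x. reg L d x powr s)"
  by (intro smooth_powr smooth_reg reg_pos)

lemma pd_reg_powr:
  assumes "d > 0"
  shows "partial_deriv b (\<lambda>x. reg L d x powr s) x = 2 * s * reg L d x powr (s - 1) * (L x \<bullet> L b)"
  using partial_deriv_powr[OF smooth_differentiable[OF smooth_reg] reg_pos[OF assms]] by (simp add: pd_reg)

lemma pd_field:
  assumes "d > 0"
  shows "partial_deriv b (\<lambda>x. (L x \<bullet> L b) * reg L d x powr s) x =
    (L b \<bullet> L b) * reg L d x powr s + 2 * s * reg L d x powr (s - 1) * (L x \<bullet> L b)\<^sup>2"
  using assms by (subst partial_deriv_mult)
    (auto simp: smooth_differentiable smooth_inner smooth_reg_powr pd_inner pd_reg_powr power2_eq_square algebra_simps)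

text \<open>The left side is the squared Hilbert-Schmidt norm of L, that is, the trace of L composed
  with its adjoint. Expanding in a basis of the target and exchanging the sums reduces it to the
  coisometry identity.\<close>

lemma sum_norm_sq: "(\<Sum>b\<in>Basis. L b \<bullet> L b) = real DIM('c) * \<kappa>"
proof -
  have "(\<Sum>b\<in>Basis. L b \<bullet> L b) = (\<Sum>b\<in>Basis. \<Sum>i\<in>Basis. (i \<bullet> L b)\<^sup>2)"
    by (subst euclidean_inner) (simp add: power2_eq_square inner_commute)
  also have "\<dots> = (\<Sum>i\<in>(Basis::'c set). \<kappa>)"
    by (subst sum.swap) (simp add: coiso)
  finally show ?thesis by simp
qed

lemma div_field:
  assumes "d > 0"
  shows "(\<Sum>b\<in>Basis. partial_deriv b (\<lambda>x. (L x \<bullet> L b) * reg L d x powr s) x) =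
    \<kappa> * (real DIM('c) * reg L d x powr s + 2 * s * reg L d x powr (s - 1) * (norm (L x))\<^sup>2)"
  unfolding pd_field[OF assms] sum.distrib sum_distrib_left[symmetric] sum_distrib_right[symmetric] sum_norm_sq coiso
  by (simp add: algebra_simps)

lemma norm_le_reg: "norm (L x) \<le> reg L d x powr (1/2)"
  by (simp add: reg_def powr_half_sqrt real_le_rsqrt)

lemma field_bound:
  assumes "d > 0"
  shows "\<bar>(L x \<bullet> L b) * reg L d x powr s\<bar> \<le> norm (L b) * reg L d x powr (s + 1/2)"
proof -
  have "\<bar>L x \<bullet> L b\<bar> \<le> norm (L b) * reg L d x powr (1/2)"
    using Cauchy_Schwarz_ineq2[of "L x" "L b"] mult_left_mono[OF norm_le_reg[of x d] norm_ge_zero[of "L b"]]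
    by (simp add: mult.commute)
  then have "\<bar>L x \<bullet> L b\<bar> * reg L d x powr s \<le> norm (L b) * reg L d x powr (1/2) * reg L d x powr s"
    by (intro mult_right_mono) auto
  then show ?thesis by (simp add: abs_mult powr_add algebra_simps)
qed

text \<open>Integrating the divergence of the field \<open>L x / reg powr s\<close> against a cutoff trades
  the weight \<open>reg powr (- s)\<close> for \<open>reg powr (1/2 - s)\<close>.\<close>

lemma reg_integral_step:
  assumes s: "0 \<le> s" "2 * s < real DIM('c)"
    and prev: "\<And>R. \<exists>M. \<forall>d>0. (LINT x|lborel. indicator (ball 0 R) x * reg L d x powr (1/2 - s)) \<le> M"
  shows "\<exists>M. \<forall>d>0. (LINT x|lborel. indicator (ball 0 R) x * reg L d x powr (- s)) \<le> M"
proof -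
  define R' where "R' = max R 0"
  obtain \<zeta> :: "'a \<Rightarrow> real" where z: "test_function \<zeta>" "smooth \<zeta>" "\<And>x. norm x \<le> R' \<Longrightarrow> \<zeta> x = 1"
    "\<And>x. norm x \<ge> R' + 1 \<Longrightarrow> \<zeta> x = 0" "\<And>x. 0 \<le> \<zeta> x" "\<And>x. \<zeta> x \<le> 1"
    using smooth_cutoff_exists[of R'] unfolding R'_def by auto
  have "\<exists>C>0. \<forall>x. \<bar>partial_deriv b \<zeta> x\<bar> \<le> C" if "b \<in> Basis" for b
    using test_bounded[OF test_pd[OF z(1) that]] by metis
  then obtain C where C: "\<And>b x. b \<in> Basis \<Longrightarrow> C b > 0 \<and> \<bar>partial_deriv b \<zeta> x\<bar> \<le> C b" by metis
  \<comment> \<open>The derivatives of the cutoff are known to vanish strictly beyond radius R' + 1;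
    the open ball of radius R' + 2 safely contains the set where they live.\<close>
  obtain M where M: "\<And>d. d > 0 \<Longrightarrow> (LINT x|lborel. indicator (ball 0 (R' + 2)) x * reg L d x powr (1/2 - s)) \<le> M"
    using prev by blast
  have k: "\<kappa> * (real DIM('c) - 2 * s) > 0" using kpos s by simp
  show ?thesis
  proof (intro exI allI impI)
    fix d :: real assume d: "d > 0"
    let ?r = "\<lambda>s x. reg L d x powr s"
    have sm: "smooth (?r s)" for s by (rule smooth_reg_powr[OF d])
    have smX: "smooth (\<lambda>x. (L x \<bullet> L b) * ?r (-s) x)" for b by (intro smooth_mult smooth_inner sm)
    have li: "loc_int (?r s)" for s by (rule loc_int_smooth[OF sm])
    have "\<kappa> * (real DIM('c) - 2 * s) * (LINT x|lborel. \<zeta> x * ?r (-s) x)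
      = (LINT x|lborel. \<zeta> x * (\<kappa> * (real DIM('c) - 2 * s) * ?r (-s) x))"
      by (subst integral_mult_right_zero[symmetric]) (simp add: mult_ac)
    also have "\<dots> \<le> (LINT x|lborel. \<zeta> x * (\<Sum>b\<in>Basis. partial_deriv b (\<lambda>x. (L x \<bullet> L b) * ?r (-s) x) x))"
    proof (rule integral_mono)
      show "integrable lborel (\<lambda>x. \<zeta> x * (\<kappa> * (real DIM('c) - 2 * s) * ?r (-s) x))"
        by (intro integrable_test_mult z loc_int_cmult li)
      show "integrable lborel (\<lambda>x. \<zeta> x * (\<Sum>b\<in>Basis. partial_deriv b (\<lambda>x. (L x \<bullet> L b) * ?r (-s) x) x))"
        by (intro integrable_test_mult z loc_int_sum loc_int_smooth smooth_pd smX)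
      fix x
      show "\<zeta> x * (\<kappa> * (real DIM('c) - 2 * s) * ?r (-s) x) \<le> \<zeta> x * (\<Sum>b\<in>Basis. partial_deriv b (\<lambda>x. (L x \<bullet> L b) * ?r (-s) x) x)"
      proof (rule mult_left_mono[OF _ z(5)])
        \<comment> \<open>The divergence is \<kappa> times DIM('c) reg^(-s) - 2 s reg^(-s-1) |L
          x|^2. Enlarging |L x|^2 to reg leaves the factor DIM('c) - 2 s, which is positive by
          assumption.\<close>
        have e: "?r (-s-1) x * reg L d x = ?r (-s) x"
          using reg_pos[OF d, of L x] by (simp add: powr_diff)
        have "?r (-s-1) x * (norm (L x))\<^sup>2 \<le> ?r (-s-1) x * reg L d x"
          by (intro mult_left_mono) (auto simp: reg_def)
        show "\<kappa> * (real DIM('c) - 2 * s) * ?r (-s) x \<le> (\<Sum>b\<in>Basis. partial_deriv b (\<lambda>x. (L x \<bullet> L b) * ?r (-s) x) x)"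
        proof -
          have "\<kappa> * (real DIM('c) - 2 * s) * ?r (-s) x = \<kappa> * (real DIM('c) * ?r (-s) x - 2 * s * (?r (-s-1) x * reg L d x))"
            unfolding e by (simp add: algebra_simps)
          also have "\<dots> \<le> \<kappa> * (real DIM('c) * ?r (-s) x - 2 * s * (?r (-s-1) x * (norm (L x))\<^sup>2))"
          proof (rule mult_left_mono)
            have "2 * s * (?r (-s-1) x * (norm (L x))\<^sup>2) \<le> 2 * s * (?r (-s-1) x * reg L d x)"
              using s by (intro mult_left_mono \<open>?r (-s-1) x * (norm (L x))\<^sup>2 \<le> _\<close>) auto
            then show "real DIM('c) * ?r (-s) x - 2 * s * (?r (-s-1) x * reg L d x) \<le> real DIM('c) * ?r (-s) x - 2 * s * (?r (-s-1) x * (norm (L x))\<^sup>2)"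
              by linarith
          qed (use kpos in simp)
          finally show ?thesis unfolding div_field[OF d] by (simp add: algebra_simps)
        qed
      qed
    qed
    also have "\<dots> = (\<Sum>b\<in>Basis. LINT x|lborel. \<zeta> x * partial_deriv b (\<lambda>x. (L x \<bullet> L b) * ?r (-s) x) x)"
      unfolding sum_distrib_left
      by (intro Bochner_Integration.integral_sum integrable_test_mult z loc_int_smooth smooth_pd smX)
    also have "\<dots> = (\<Sum>b\<in>Basis. - (LINT x|lborel. partial_deriv b \<zeta> x * ((L x \<bullet> L b) * ?r (-s) x)))"
      by (intro sum.cong refl) (simp add: integration_by_parts[OF z(1) smX])
    also have "\<dots> \<le> (\<Sum>b\<in>Basis. C b * norm (L b) * M)"
    proof (rule sum_mono)
      fix b :: 'a assume b: "b \<in> Basis"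
      have "- (LINT x|lborel. partial_deriv b \<zeta> x * ((L x \<bullet> L b) * ?r (-s) x)) =
         (LINT x|lborel. - (partial_deriv b \<zeta> x * ((L x \<bullet> L b) * ?r (-s) x)))" by simp
      also have "\<dots> \<le> (LINT x|lborel. C b * norm (L b) * (indicator (ball 0 (R' + 2)) x * ?r (1/2 - s) x))"
      proof (rule integral_mono)
        show "integrable lborel (\<lambda>x. - (partial_deriv b \<zeta> x * ((L x \<bullet> L b) * ?r (-s) x)))"
          by (intro Bochner_Integration.integrable_minus integrable_test_mult test_pd z b loc_int_smooth smX)
        show "integrable lborel (\<lambda>x. C b * norm (L b) * (indicator (ball 0 (R' + 2)) x * ?r (1/2 - s) x))"
          using loc_intD[OF li] by simp
        fix x
        show "- (partial_deriv b \<zeta> x * ((L x \<bullet> L b) * ?r (-s) x)) \<le> C b * norm (L b) * (indicator (ball 0 (R' + 2)) x * ?r (1/2 - s) x)"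
        proof (cases "norm x < R' + 2")
          case True
          have "- (partial_deriv b \<zeta> x * ((L x \<bullet> L b) * ?r (-s) x)) \<le> \<bar>partial_deriv b \<zeta> x\<bar> * \<bar>(L x \<bullet> L b) * ?r (-s) x\<bar>"
            by (metis abs_ge_minus_self abs_mult)
          also have "\<dots> \<le> C b * (norm (L b) * ?r (-s + 1/2) x)"
            using C[OF b, of x] by (intro mult_mono field_bound d) auto
          finally show ?thesis using True by simp
        next
          case False
          have "partial_deriv b \<zeta> x = 0" by (rule partial_deriv_outside[where R="R' + 1"]) (use z False in auto)
          then show ?thesis using False by simp
        qed
      qed
      also have "\<dots> = C b * norm (L b) * (LINT x|lborel. (indicator (ball 0 (R' + 2)) x * ?r (1/2 - s) x))" by simp
      also have "\<dots> \<le> C b * norm (L b) * M" using C[OF b] by (intro mult_left_mono M d) (auto simp: less_imp_le)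
      finally show "- (LINT x|lborel. partial_deriv b \<zeta> x * ((L x \<bullet> L b) * ?r (-s) x)) \<le> C b * norm (L b) * M" .
    qed
    finally have "(LINT x|lborel. \<zeta> x * ?r (-s) x) \<le> (\<Sum>b\<in>Basis. C b * norm (L b) * M) / (\<kappa> * (real DIM('c) - 2 * s))"
      using k by (simp add: pos_le_divide_eq mult.commute)
    moreover have "(LINT x|lborel. indicator (ball 0 R) x * ?r (-s) x) \<le> (LINT x|lborel. \<zeta> x * ?r (-s) x)"
      by (rule integral_mono[OF loc_intD[OF li] integrable_test_mult[OF z(1) li]])
        (auto simp: indicator_def z(3) z(5) R'_def)
    ultimately show "(LINT x|lborel. indicator (ball 0 R) x * ?r (-s) x) \<le>
       (\<Sum>b\<in>Basis. C b * norm (L b) * M) / (\<kappa> * (real DIM('c) - 2 * s))" by linarith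
  qed
qed

text \<open>Two rounds of the step, from exponent 0 to 1/2 and from 1/2 to 1. The second requires 2
  < DIM('c).\<close>

lemma reg_integral_bound:
  assumes "DIM('c) \<ge> 3"
  shows "\<exists>M. \<forall>d>0. (LINT x|lborel. indicator (ball 0 R) x * reg L d x powr (- 1)) \<le> M"
proof (rule reg_integral_step)
  fix R
  show "\<exists>M. \<forall>d>0. (LINT x|lborel. indicator (ball 0 R) x * reg L d x powr (1/2 - 1)) \<le> M"
  proof -
    have "\<exists>M. \<forall>d>0. (LINT x|lborel. indicator (ball 0 R) x * reg L d x powr (- (1/2))) \<le> M"
    proof (rule reg_integral_step)
      fix R
      have "reg L d x powr (1/2 - 1/2) = 1" if "d > 0" for d x
        using reg_pos[OF that, of L x] by simp
      then show "\<exists>M. \<forall>d>0. (LINT x|lborel. indicator (ball 0 R) x * reg L d x powr (1/2 - 1/2)) \<le> M"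
        by (intro exI[of _ "LINT x|lborel. indicator (ball (0::'a) R) x"]) simp
    qed (use assms in auto)
    then show ?thesis by simp
  qed
qed (use assms in auto)

text \<open>Fatou's lemma along d = 1/(k+1), starting from the integral bound that is uniform in
  d.\<close>

lemma loc_int_inverse_sq:
  assumes dim: "DIM('c) \<ge> 3"
  shows "loc_int (\<lambda>x. (1 / norm (L x))\<^sup>2)"
  unfolding loc_int_def
proof (intro conjI allI)
  have [measurable]: "L \<in> borel_measurable borel"
    using lin by (intro borel_measurable_continuous_onI linear_continuous_on)
  show "(\<lambda>x. (1 / norm (L x))\<^sup>2) \<in> borel_measurable borel" by measurable
  fix R
  obtain M where M: "\<And>d. d > 0 \<Longrightarrow> (LINT x|lborel. indicator (ball 0 R) x * reg L d x powr (- 1)) \<le> M"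
    using reg_integral_bound[OF dim] by blast
  define d where "d k = inverse (real (Suc k))" for k
  have d: "d k > 0" for k by (simp add: d_def)
  have d0: "d \<longlonglongrightarrow> 0" unfolding d_def[abs_def] by (rule LIMSEQ_inverse_real_of_nat)
  have [measurable]: "reg L d \<in> borel_measurable borel" for d
    using smooth_cont[OF smooth_reg] borel_measurable_continuous_onI by blast
  have "(\<integral>\<^sup>+x. ennreal (indicator (ball 0 R) x * (1 / norm (L x))\<^sup>2) \<partial>lborel)
    \<le> (\<integral>\<^sup>+x. liminf (\<lambda>k. ennreal (indicator (ball 0 R) x * reg L (d k) x powr (- 1))) \<partial>lborel)"
  proof (rule nn_integral_mono)
    fix x
    show "ennreal (indicator (ball 0 R) x * (1 / norm (L x))\<^sup>2) \<le> liminf (\<lambda>k. ennreal (indicator (ball 0 R) x * reg L (d k) x powr (- 1)))"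
    \<comment> \<open>At the singularity 1 / 0 = 0 makes the left side vanish, so the comparison
      holds at every point.\<close>
    proof (cases "L x = 0")
      case False
      have "(\<lambda>k. ennreal (indicator (ball 0 R) x * reg L (d k) x powr (- 1))) \<longlonglongrightarrow> ennreal (indicator (ball 0 R) x * ((norm (L x))\<^sup>2 + 0\<^sup>2) powr (- 1))"
        unfolding reg_def using False by (intro tendsto_ennrealI tendsto_intros d0) auto
      moreover have "((norm (L x))\<^sup>2 + 0\<^sup>2) powr (- 1) = (1 / norm (L x))\<^sup>2"
        using False by (simp add: powr_minus power_divide divide_simps)
      ultimately have "(\<lambda>k. ennreal (indicator (ball 0 R) x * reg L (d k) x powr (- 1))) \<longlonglongrightarrow> ennreal (indicator (ball 0 R) x * (1 / norm (L x))\<^sup>2)"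
        by (simp only:)
      from lim_imp_Liminf[OF sequentially_bot this] show ?thesis by simp
    qed simp
  qed
  also have "\<dots> \<le> liminf (\<lambda>k. \<integral>\<^sup>+x. ennreal (indicator (ball 0 R) x * reg L (d k) x powr (- 1)) \<partial>lborel)"
    by (rule nn_integral_liminf) measurable
  also have "\<dots> \<le> liminf (\<lambda>k::nat. ennreal M)"
  proof (rule Liminf_mono, rule always_eventually, rule allI)
    fix k
    have "(\<integral>\<^sup>+x. ennreal (indicator (ball 0 R) x * reg L (d k) x powr (- 1)) \<partial>lborel)
      = ennreal (LINT x|lborel. indicator (ball 0 R) x * reg L (d k) x powr (- 1))"
      by (rule nn_integral_eq_integral[OF loc_intD[OF loc_int_smooth[OF smooth_reg_powr[OF d]]]]) simp
    then show "(\<integral>\<^sup>+x. ennreal (indicator (ball 0 R) x * reg L (d k) x powr (- 1)) \<partial>lborel) \<le> ennreal M"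
      using M[OF d] by (simp add: ennreal_leI)
  qed
  also have "\<dots> < \<infinity>" by (simp add: Liminf_const)
  finally show "integrable lborel (\<lambda>x. indicator (ball 0 R) x * (1 / norm (L x))\<^sup>2)"
    by (intro integrableI_nonneg) auto
qed

text \<open>If L b is nonzero, the kernel of L lies in the hyperplane orthogonal to the adjoint
  image of L b, and hyperplanes are null sets.\<close>

lemma AE_nonzero: "AE x in lborel. L x \<noteq> 0"
proof -
  have "(\<Sum>b\<in>Basis. L b \<bullet> L b) \<noteq> 0" using sum_norm_sq kpos by simp
  then obtain b where b: "b \<in> Basis" "L b \<bullet> L b \<noteq> 0" by (meson sum.neutral)
  define a where "a = adjoint L (L b)"
  have a: "x \<bullet> a = L x \<bullet> L b" for x
    unfolding a_def by (rule adjoint_works) (use lin bounded_linear.linear in blast)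
  then have "a \<noteq> 0" using b by force
  have "negligible {x. a \<bullet> x = 0}" by (rule negligible_hyperplane) (use \<open>a \<noteq> 0\<close> in simp)
  moreover have m: "{x. a \<bullet> x = 0} \<in> sets borel" by measurable
  ultimately have "{x. a \<bullet> x = 0} \<in> null_sets lborel"
    by (auto simp: negligible_iff_null_sets null_sets_completion_iff)
  then have "AE x in lborel. x \<notin> {x. a \<bullet> x = 0}" by (rule AE_not_in)
  then show ?thesis
    by eventually_elim (use a in \<open>force simp: inner_commute\<close>)
qed

end

section \<open>Regularised Coulomb terms\<close>

lemma partial_deriv_cmult:
  fixes u :: "'a::euclidean_space \<Rightarrow> real"
  assumes "u differentiable (at x)"
  shows "partial_deriv b (\<lambda>x. c * u x) x = c * partial_deriv b u x"
  by (rule partial_deriv_chain[OF assms]) (auto intro!: derivative_eq_intros)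

lemma partial_deriv_sum:
  fixes u :: "'i \<Rightarrow> 'a::euclidean_space \<Rightarrow> real"
  assumes "\<And>i. i \<in> A \<Longrightarrow> u i differentiable (at x)"
  shows "partial_deriv b (\<lambda>x. \<Sum>i\<in>A. u i x) x = (\<Sum>i\<in>A. partial_deriv b (u i) x)"
proof -
  have "((\<lambda>x. \<Sum>i\<in>A. u i x) has_derivative (\<lambda>h. \<Sum>i\<in>A. partial_deriv h (u i) x)) (at x)"
    by (intro has_derivative_sum has_derivative_frechet assms)
  from partial_deriv_eq[OF this] show ?thesis .
qed

definition dseq :: "nat \<Rightarrow> real" where "dseq k = inverse (real (Suc k))"

lemma dseq: "0 < dseq k" "dseq k \<le> 1" "dseq \<longlonglongrightarrow> 0"
  unfolding dseq_def[abs_def] by (rule LIMSEQ_inverse_real_of_nat | simp add: divide_simps)+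

text \<open>Attraction by the nucleus and repulsion of a pair are treated alike: a term is a
  coisometry onto R^3 with a coefficient, and only c and \<kappa> distinguish the two kinds.\<close>

locale coulomb_terms =
  fixes T :: "'t set" and L :: "'t \<Rightarrow> 'a::euclidean_space \<Rightarrow> real^3" and c \<kappa> :: "'t \<Rightarrow> real"
  assumes fin: "finite T" and co: "t \<in> T \<Longrightarrow> coisometry (L t) (\<kappa> t)"
begin

definition F :: "'a \<Rightarrow> real" where
  "F x = (\<Sum>t\<in>T. c t * norm (L t x))"

text \<open>Where \<open>L t x = 0\<close>, the convention \<open>0 / 0 = 0\<close> gives the limit of the regularised gradients
  \<open>DG\<close> below, so these converge everywhere.\<close>

definition DF :: "'a \<Rightarrow> 'a \<Rightarrow> real" where
  "DF b x = (\<Sum>t\<in>T. c t * ((L t x \<bullet> L t b) / norm (L t x)))"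

definition D2F :: "'a \<Rightarrow> 'a \<Rightarrow> real" where
  "D2F b x = (\<Sum>t\<in>T. c t * ((L t b \<bullet> L t b) / norm (L t x) - (L t x \<bullet> L t b)\<^sup>2 / norm (L t x) ^ 3))"

text \<open>The Laplacian of c |L x| for a coisometry onto R^3 is \<kappa> (3 - 1) c / |L x|; this
  is the origin of the 2.\<close>

definition V :: "'a \<Rightarrow> real" where
  "V x = (\<Sum>t\<in>T. 2 * \<kappa> t * c t / norm (L t x))"

definition G :: "real \<Rightarrow> 'a \<Rightarrow> real" where
  "G d x = (\<Sum>t\<in>T. c t * reg (L t) d x powr (1/2))"

definition DG :: "real \<Rightarrow> 'a \<Rightarrow> 'a \<Rightarrow> real" where
  "DG d b x = (\<Sum>t\<in>T. c t * ((L t x \<bullet> L t b) * reg (L t) d x powr (-1/2)))"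

definition D2G :: "real \<Rightarrow> 'a \<Rightarrow> 'a \<Rightarrow> real" where
  "D2G d b x = (\<Sum>t\<in>T. c t * ((L t b \<bullet> L t b) * reg (L t) d x powr (-1/2)
     - reg (L t) d x powr (-3/2) * (L t x \<bullet> L t b)\<^sup>2))"

text \<open>A bound for the second derivatives \<open>D2G d b\<close> that does not depend on d and
  has only 1 / |L x| singularities, so that it remains locally integrable after multiplication by
  \<psi>.\<close>

definition majorant :: "'a \<Rightarrow> 'a \<Rightarrow> real" where
  "majorant b x = (\<Sum>t\<in>T. 2 * \<bar>c t\<bar> * (norm (L t b))\<^sup>2 * (1 / norm (L t x)))"

lemma L_cont: "t \<in> T \<Longrightarrow> continuous_on UNIV (L t)"
  using coisometry.lin[OF co] by (intro linear_continuous_on)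

lemma L_measurable: "t \<in> T \<Longrightarrow> L t \<in> borel_measurable borel"
  by (intro borel_measurable_continuous_onI L_cont)

lemma measurable_terms [measurable]:
  "F \<in> borel_measurable borel" "DF b \<in> borel_measurable borel" "D2F b \<in> borel_measurable borel"
  "V \<in> borel_measurable borel" "G d \<in> borel_measurable borel" "DG d b \<in> borel_measurable borel"
  "D2G d b \<in> borel_measurable borel" "majorant b \<in> borel_measurable borel"
  unfolding F_def[abs_def] DF_def[abs_def] D2F_def[abs_def] V_def[abs_def] G_def[abs_def] DG_def[abs_def]
    D2G_def[abs_def] majorant_def[abs_def] reg_def
  by (intro borel_measurable_sum; use L_measurable in measurable)+

lemma F_cont: "continuous_on UNIV F"
  unfolding F_def[abs_def] by (intro continuous_intros L_cont)

lemma smooth_G: "d > 0 \<Longrightarrow> smooth (G d)"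
  unfolding G_def[abs_def] by (intro smooth_sum smooth_mult smooth_const coisometry.smooth_reg_powr[OF co])

lemma smooth_DG: "d > 0 \<Longrightarrow> smooth (DG d b)"
  unfolding DG_def[abs_def]
  by (intro smooth_sum smooth_mult smooth_const coisometry.smooth_reg_powr[OF co] coisometry.smooth_inner[OF co])

lemma pd_G:
  assumes d: "d > 0"
  shows "partial_deriv b (G d) x = DG d b x"
proof -
  have s: "smooth (\<lambda>x. reg (L t) d x powr (1/2))" if "t \<in> T" for t
    using that by (intro coisometry.smooth_reg_powr[OF co] d)
  have "partial_deriv b (G d) x = (\<Sum>t\<in>T. partial_deriv b (\<lambda>x. c t * reg (L t) d x powr (1/2)) x)"
    unfolding G_def[abs_def] by (intro partial_deriv_sum smooth_differentiable smooth_mult smooth_const s)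
  also have "\<dots> = DG d b x"
    unfolding DG_def
    by (intro sum.cong refl) (simp add: partial_deriv_cmult smooth_differentiable[OF s] coisometry.pd_reg_powr[OF co d])
  finally show ?thesis .
qed

lemma pd_DG:
  assumes d: "d > 0"
  shows "partial_deriv b (DG d b) x = D2G d b x"
proof -
  have s: "smooth (\<lambda>x. (L t x \<bullet> L t b) * reg (L t) d x powr (-1/2))" if "t \<in> T" for t
    using that by (intro smooth_mult coisometry.smooth_inner[OF co] coisometry.smooth_reg_powr[OF co] d)
  have "partial_deriv b (DG d b) x = (\<Sum>t\<in>T. partial_deriv b (\<lambda>x. c t * ((L t x \<bullet> L t b) * reg (L t) d x powr (-1/2))) x)"
    unfolding DG_def[abs_def] by (intro partial_deriv_sum smooth_differentiable smooth_mult[OF smooth_const] s)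
  also have "\<dots> = D2G d b x"
    unfolding D2G_def
    by (intro sum.cong refl)
      (simp add: partial_deriv_cmult smooth_differentiable[OF s, simplified] coisometry.pd_field[OF co d, where s="-(1/2)"])
  finally show ?thesis .
qed

lemma reg_sqrt_le: "0 < d \<Longrightarrow> d \<le> 1 \<Longrightarrow> reg (L t) d x powr (1/2) \<le> norm (L t x) + 1"
  using sqrt_sum_squares_le_sum[of "norm (L t x)" d] by (simp add: reg_def powr_half_sqrt)

lemma G_bound:
  assumes "0 < d" "d \<le> 1"
  shows "\<bar>G d x\<bar> \<le> (\<Sum>t\<in>T. \<bar>c t\<bar> * (norm (L t x) + 1))"
  unfolding G_def
  by (rule order_trans[OF sum_abs sum_mono]) (auto simp: abs_mult intro!: mult_left_mono reg_sqrt_le assms)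

lemma DG_bound:
  assumes "0 < d"
  shows "\<bar>DG d b x\<bar> \<le> (\<Sum>t\<in>T. \<bar>c t\<bar> * norm (L t b))"
  unfolding DG_def
proof (rule order_trans[OF sum_abs sum_mono])
  fix t assume t: "t \<in> T"
  have "\<bar>(L t x \<bullet> L t b) * reg (L t) d x powr (-1/2)\<bar> \<le> norm (L t b)"
    using coisometry.field_bound[OF co[OF t] assms, of x b "-1/2"] reg_pos[OF assms, of "L t" x] by simp
  then show "\<bar>c t * ((L t x \<bullet> L t b) * reg (L t) d x powr (-1/2))\<bar> \<le> \<bar>c t\<bar> * norm (L t b)"
    unfolding abs_mult[of "c t"] by (intro mult_left_mono) auto
qed

text \<open>By \<open>field_bound\<close>, (L x \<bullet> L b)^2 / reg \<le> |L b|^2. This absorbs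
  two of the three inverse half powers of reg in the second term; the half power left over is at
  most 1 / |L x|.\<close>

lemma D2G_bound:
  assumes d: "0 < d" and nz: "\<forall>t\<in>T. L t x \<noteq> 0"
  shows "\<bar>D2G d b x\<bar> \<le> majorant b x"
  unfolding D2G_def majorant_def
proof (rule order_trans[OF sum_abs sum_mono])
  fix t assume t: "t \<in> T"
  let ?r = "reg (L t) d x"
  have r: "?r > 0" by (rule reg_pos[OF d])
  have n: "norm (L t x) > 0" using nz t by simp
  have rn: "?r powr (-1/2) \<le> 1 / norm (L t x)"
    using coisometry.norm_le_reg[OF co[OF t], of x d] n r
    by (simp add: powr_minus_divide frac_le)
  have "\<bar>(L t x \<bullet> L t b) * ?r powr (-1/2)\<bar> \<le> norm (L t b)"
    using coisometry.field_bound[OF co[OF t] d, of x b "-1/2"] r by simp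
  then have "((L t x \<bullet> L t b) * ?r powr (-1/2))\<^sup>2 \<le> (norm (L t b))\<^sup>2"
    by (metis abs_ge_zero power2_abs power_mono)
  moreover have "(?r powr (-1/2))\<^sup>2 * ?r powr (-1/2) = ?r powr (-3/2)"
  proof -
    have "(?r powr a)\<^sup>2 * ?r powr a = ?r powr (a + a + a)" for a
      by (simp only: power2_eq_square powr_add mult_ac)
    from this[of "-1/2"] show ?thesis by simp
  qed
  ultimately have B: "?r powr (-3/2) * (L t x \<bullet> L t b)\<^sup>2 \<le> (norm (L t b))\<^sup>2 * ?r powr (-1/2)"
    using mult_right_mono[of "((L t x \<bullet> L t b) * ?r powr (-1/2))\<^sup>2" "(norm (L t b))\<^sup>2" "?r powr (-1/2)"]
    by (simp add: power_mult_distrib mult_ac)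
  have "0 \<le> (norm (L t b))\<^sup>2 * ?r powr (-1/2)" "0 \<le> ?r powr (-3/2) * (L t x \<bullet> L t b)\<^sup>2" by auto
  with B have "\<bar>(L t b \<bullet> L t b) * ?r powr (-1/2) - ?r powr (-3/2) * (L t x \<bullet> L t b)\<^sup>2\<bar> \<le> 2 * ((norm (L t b))\<^sup>2 * ?r powr (-1/2))"
    unfolding power2_norm_eq_inner by linarith
  also have "\<dots> \<le> 2 * ((norm (L t b))\<^sup>2 * (1 / norm (L t x)))"
    by (intro mult_left_mono rn) auto
  finally have *: "\<bar>(L t b \<bullet> L t b) * ?r powr (-1/2) - ?r powr (-3/2) * (L t x \<bullet> L t b)\<^sup>2\<bar> \<le> 2 * ((norm (L t b))\<^sup>2 * (1 / norm (L t x)))" .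
  have "\<bar>c t * ((L t b \<bullet> L t b) * ?r powr (-1/2) - ?r powr (-3/2) * (L t x \<bullet> L t b)\<^sup>2)\<bar>
      \<le> \<bar>c t\<bar> * (2 * ((norm (L t b))\<^sup>2 * (1 / norm (L t x))))"
    unfolding abs_mult[of "c t"] by (intro mult_left_mono *) auto
  then show "\<bar>c t * ((L t b \<bullet> L t b) * ?r powr (-1/2) - ?r powr (-3/2) * (L t x \<bullet> L t b)\<^sup>2)\<bar>
      \<le> 2 * \<bar>c t\<bar> * (norm (L t b))\<^sup>2 * (1 / norm (L t x))" by (simp add: mult_ac)
qed

lemma DF_bound: "\<bar>DF b x\<bar> \<le> (\<Sum>t\<in>T. \<bar>c t\<bar> * norm (L t b))"
  unfolding DF_def
proof (rule order_trans[OF sum_abs sum_mono])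
  fix t
  have "\<bar>(L t x \<bullet> L t b) / norm (L t x)\<bar> \<le> norm (L t b)"
    using Cauchy_Schwarz_ineq2[of "L t x" "L t b"] by (cases "L t x = 0") (auto simp: divide_simps mult.commute)
  then show "\<bar>c t * ((L t x \<bullet> L t b) / norm (L t x))\<bar> \<le> \<bar>c t\<bar> * norm (L t b)"
    unfolding abs_mult[of "c t"] by (intro mult_left_mono) auto
qed

lemma reg_tendsto: "(\<lambda>k. reg (L t) (dseq k) x) \<longlonglongrightarrow> (norm (L t x))\<^sup>2"
  using tendsto_add[OF tendsto_const tendsto_power[OF dseq(3), of 2], of "(norm (L t x))\<^sup>2"] by (simp add: reg_def)

lemma reg_powr_tendsto: "L t x \<noteq> 0 \<Longrightarrow> (\<lambda>k. reg (L t) (dseq k) x powr (s/2)) \<longlonglongrightarrow> norm (L t x) powr s"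
proof -
  assume n: "L t x \<noteq> 0"
  have "(\<lambda>k. reg (L t) (dseq k) x powr (s/2)) \<longlonglongrightarrow> ((norm (L t x))\<^sup>2) powr (s/2)"
    by (intro tendsto_powr reg_tendsto tendsto_const) (use n in auto)
  moreover have "((norm (L t x))\<^sup>2) powr (s/2) = norm (L t x) powr s"
    using n by (simp add: powr_powr flip: powr_numeral)
  ultimately show ?thesis by simp
qed

lemma G_tendsto: "(\<lambda>k. G (dseq k) x) \<longlonglongrightarrow> F x"
  unfolding G_def F_def
proof (intro tendsto_sum tendsto_mult tendsto_const)
  fix t
  have "(\<lambda>k. sqrt (reg (L t) (dseq k) x)) \<longlonglongrightarrow> sqrt ((norm (L t x))\<^sup>2)"
    by (intro tendsto_real_sqrt reg_tendsto)
  then show "(\<lambda>k. reg (L t) (dseq k) x powr (1/2)) \<longlonglongrightarrow> norm (L t x)"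
    using reg_pos[OF dseq(1), of "L t" _ x] by (simp add: powr_half_sqrt less_imp_le)
qed

lemma DG_tendsto: "(\<lambda>k. DG (dseq k) b x) \<longlonglongrightarrow> DF b x"
  unfolding DG_def DF_def
proof (intro tendsto_sum tendsto_mult tendsto_const)
  fix t
  show "(\<lambda>k. (L t x \<bullet> L t b) * reg (L t) (dseq k) x powr (-1/2)) \<longlonglongrightarrow> (L t x \<bullet> L t b) / norm (L t x)"
  proof (cases "L t x = 0")
    case False
    from tendsto_mult[OF tendsto_const reg_powr_tendsto[OF this, of "-1"]] show ?thesis
      using False by (simp add: powr_minus_divide)
  qed simp
qed

lemma D2G_tendsto:
  assumes "\<forall>t\<in>T. L t x \<noteq> 0"
  shows "(\<lambda>k. D2G (dseq k) b x) \<longlonglongrightarrow> D2F b x"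
  unfolding D2G_def D2F_def
proof (intro tendsto_sum tendsto_mult[OF tendsto_const])
  fix t assume "t \<in> T"
  then have n: "L t x \<noteq> 0" using assms by blast
  have "(\<lambda>k. (L t b \<bullet> L t b) * reg (L t) (dseq k) x powr (-1/2)
     - reg (L t) (dseq k) x powr (-3/2) * (L t x \<bullet> L t b)\<^sup>2) \<longlonglongrightarrow> (L t b \<bullet> L t b) * norm (L t x) powr -1
     - norm (L t x) powr -3 * (L t x \<bullet> L t b)\<^sup>2"
    by (intro tendsto_diff tendsto_mult tendsto_const reg_powr_tendsto n)
  then show "(\<lambda>k. (L t b \<bullet> L t b) * reg (L t) (dseq k) x powr (-1/2)
     - reg (L t) (dseq k) x powr (-3/2) * (L t x \<bullet> L t b)\<^sup>2) \<longlonglongrightarrow> (L t b \<bullet> L t b) / norm (L t x) - (L t x \<bullet> L t b)\<^sup>2 / norm (L t x) ^ 3"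
    using n by (simp add: powr_minus_divide powr_numeral)
qed

text \<open>The squared lengths of the L b sum to 3 \<kappa>, and the squares (L x \<bullet> L b)^2
  sum to \<kappa> |L x|^2. The difference is 2 \<kappa> / |L x| per term, which is how
  \<open>V\<close> was defined.\<close>

lemma sum_D2F:
  assumes "\<forall>t\<in>T. L t x \<noteq> 0"
  shows "(\<Sum>b\<in>Basis. D2F b x) = V x"
proof -
  have "(\<Sum>b\<in>Basis. D2F b x) = (\<Sum>t\<in>T. c t * ((\<Sum>b\<in>Basis. L t b \<bullet> L t b) / norm (L t x) - (\<Sum>b\<in>Basis. (L t x \<bullet> L t b)\<^sup>2) / norm (L t x) ^ 3))"
    unfolding D2F_def by (subst sum.swap) (simp add: sum_distrib_left sum_subtractf sum_divide_distrib right_diff_distrib)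
  also have "\<dots> = V x"
    unfolding V_def
  proof (intro sum.cong refl)
    fix t assume t: "t \<in> T"
    then have "norm (L t x) > 0" using assms by simp
    then show "c t * ((\<Sum>b\<in>Basis. L t b \<bullet> L t b) / norm (L t x) - (\<Sum>b\<in>Basis. (L t x \<bullet> L t b)\<^sup>2) / norm (L t x) ^ 3) =
        2 * \<kappa> t * c t / norm (L t x)"
      unfolding coisometry.sum_norm_sq[OF co[OF t]] coisometry.coiso[OF co[OF t]]
      by (simp add: power2_eq_square power3_eq_cube field_simps)
  qed
  finally show ?thesis .
qed

lemma AE_nz: "AE x in lborel. \<forall>t\<in>T. L t x \<noteq> 0"
  using coisometry.AE_nonzero[OF co] fin by (intro AE_finite_allI) auto

text \<open>The regularised exponents are bounded on each ball uniformly in k because d \<le> 1. The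
  factor exp (- G) therefore costs only a constant in the dominated convergence, and all that
  remains to be dominated is h.\<close>

lemma exp_tendsto_integral:
  assumes w: "loc_int w" and [measurable]: "\<And>k. h k \<in> borel_measurable borel" "g \<in> borel_measurable borel"
    and b: "\<And>k. AE x in lborel. \<bar>h k x\<bar> \<le> C * \<bar>w x\<bar>" and C: "C \<ge> 0"
    and z: "\<And>k x. norm x \<ge> R \<Longrightarrow> h k x = 0"
    and lim: "AE x in lborel. (\<lambda>k. h k x) \<longlonglongrightarrow> g x"
  shows "(\<lambda>k. LINT x|lborel. exp (- G (dseq k) x) * h k x) \<longlonglongrightarrow> (LINT x|lborel. exp (- F x) * g x)"
    "integrable lborel (\<lambda>x. exp (- F x) * g x)"
proof -
  have "continuous_on UNIV (\<lambda>x. exp (\<Sum>t\<in>T. \<bar>c t\<bar> * (norm (L t x) + 1)))"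
    by (intro continuous_intros L_cont)
  then obtain K where K: "\<And>x. x \<in> ball 0 R \<Longrightarrow> \<bar>exp (\<Sum>t\<in>T. \<bar>c t\<bar> * (norm (L t x) + 1))\<bar> \<le> K"
    using continuous_bounded_on_ball by blast
  have bb: "AE x in lborel. \<bar>exp (- G (dseq k) x) * h k x\<bar> \<le> (K * C) * indicator (ball 0 R) x * \<bar>w x\<bar>" for k
    using b[of k]
  proof eventually_elim
    case (elim x)
    show ?case
    proof (cases "norm x < R")
      case True
      have "exp (- G (dseq k) x) \<le> exp (\<Sum>t\<in>T. \<bar>c t\<bar> * (norm (L t x) + 1))"
        using G_bound[OF dseq(1,2), of k x] by simp
      also have "\<dots> \<le> K" using K[of x] True by simp
      finally have "exp (- G (dseq k) x) * \<bar>h k x\<bar> \<le> K * (C * \<bar>w x\<bar>)"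
        using elim order_trans[OF abs_ge_zero K[of x]] True by (intro mult_mono) auto
      then show ?thesis using True by (simp add: abs_mult)
    qed (use z in simp)
  qed
  have lim': "AE x in lborel. (\<lambda>k. exp (- G (dseq k) x) * h k x) \<longlonglongrightarrow> exp (- F x) * g x"
    using lim by eventually_elim (intro tendsto_mult tendsto_exp tendsto_minus G_tendsto)
  show "(\<lambda>k. LINT x|lborel. exp (- G (dseq k) x) * h k x) \<longlonglongrightarrow> (LINT x|lborel. exp (- F x) * g x)"
    "integrable lborel (\<lambda>x. exp (- F x) * g x)"
    by (rule loc_integral_tendsto[OF w _ _ bb lim'], measurable)+
qed

end

section \<open>The equation for the regular factor\<close>

context coulomb_terms
begin

context
  fixes \<psi> :: "'a \<Rightarrow> real" and p :: "'a \<Rightarrow> 'a \<Rightarrow> real" and E :: real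
  assumes psi: "\<psi> \<in> borel_measurable borel" "loc_int (\<lambda>x. (\<psi> x)\<^sup>2)"
    and p: "\<And>b. b \<in> Basis \<Longrightarrow> p b \<in> borel_measurable borel" "\<And>b. b \<in> Basis \<Longrightarrow> loc_int (\<lambda>x. (p b x)\<^sup>2)"
    and weak: "\<And>b \<zeta>. b \<in> Basis \<Longrightarrow> test_function \<zeta> \<Longrightarrow>
      (LINT x|lborel. partial_deriv b \<zeta> x * \<psi> x) = - (LINT x|lborel. \<zeta> x * p b x)"
    and eqn: "\<And>\<zeta>. test_function \<zeta> \<Longrightarrow>
      (\<Sum>b\<in>Basis. LINT x|lborel. partial_deriv b \<zeta> x * p b x) + (LINT x|lborel. \<zeta> x * (V x * \<psi> x)) =
      E * (LINT x|lborel. \<zeta> x * \<psi> x)"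
begin

lemma loc_int_psi: "loc_int \<psi>" by (rule loc_int_of_sq[OF psi(2,1)])
lemma loc_int_p: "b \<in> Basis \<Longrightarrow> loc_int (p b)" by (rule loc_int_of_sq[OF p(2) p(1)])

lemma loc_int_inverse_psi:
  assumes t: "t \<in> T"
  shows "loc_int (\<lambda>x. 1 / norm (L t x) * \<psi> x)"
proof -
  have [measurable]: "L t \<in> borel_measurable borel" by (rule L_measurable[OF t])
  show ?thesis by (intro loc_int_prod coisometry.loc_int_inverse_sq[OF co[OF t]] psi) auto
qed

lemma loc_int_V_psi: "loc_int (\<lambda>x. V x * \<psi> x)"
proof -
  have "loc_int (\<lambda>x. \<Sum>t\<in>T. 2 * \<kappa> t * c t * (1 / norm (L t x) * \<psi> x))"
    by (intro loc_int_sum loc_int_cmult loc_int_inverse_psi)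
  then show ?thesis by (simp add: V_def sum_distrib_right)
qed

lemma loc_int_majorant_psi: "loc_int (\<lambda>x. majorant b x * \<psi> x)"
proof -
  have "loc_int (\<lambda>x. \<Sum>t\<in>T. 2 * \<bar>c t\<bar> * (norm (L t b))\<^sup>2 * (1 / norm (L t x) * \<psi> x))"
    by (intro loc_int_sum loc_int_cmult loc_int_inverse_psi)
  then show ?thesis by (simp add: majorant_def sum_distrib_right)
qed

lemma DF_mult: "loc_int w \<Longrightarrow> loc_int (\<lambda>x. DF b x * w x)"
  by (rule loc_int_mult) (use DF_bound in auto)

lemma F_mult: "loc_int w \<Longrightarrow> loc_int (\<lambda>x. exp (- F x) * w x)"
  by (rule loc_int_mult_cont) (auto intro!: continuous_intros F_cont)

lemma exp_integral_tendsto_smooth: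
  assumes w: "loc_int w" and m: "\<And>k. m k \<in> borel_measurable borel" "m' \<in> borel_measurable borel"
    and b: "\<And>k x. \<bar>m k x\<bar> \<le> C" and z: "\<And>k x. norm x \<ge> R \<Longrightarrow> m k x = 0"
    and lim: "\<And>x. (\<lambda>k. m k x) \<longlonglongrightarrow> m' x"
  shows "(\<lambda>k. LINT x|lborel. exp (- G (dseq k) x) * (m k x * w x)) \<longlonglongrightarrow> (LINT x|lborel. exp (- F x) * (m' x * w x))"
proof (rule exp_tendsto_integral(1)[OF w, where R=R])
  note [measurable] = m loc_int_borel[OF w]
  show "(\<lambda>x. m k x * w x) \<in> borel_measurable borel" for k by measurable
  show "(\<lambda>x. m' x * w x) \<in> borel_measurable borel" by measurable
  show "AE x in lborel. \<bar>m k x * w x\<bar> \<le> C * \<bar>w x\<bar>" for k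
    using b by (intro AE_I2) (simp add: abs_mult mult_right_mono)
  show "0 \<le> C" using b[of 0 undefined] abs_ge_zero order_trans by blast
  show "AE x in lborel. (\<lambda>k. m k x * w x) \<longlonglongrightarrow> m' x * w x"
    by (intro AE_I2 tendsto_mult lim tendsto_const)
qed (simp add: z)

context
  fixes \<zeta> :: "'a \<Rightarrow> real"
  assumes \<zeta>: "test_function \<zeta>"
begin

lemma test_exp: "test_function (\<lambda>x. exp (- G (dseq k) x) * \<zeta> x)"
  using test_mult[OF \<zeta> smooth_exp[OF smooth_minus[OF smooth_G[OF dseq(1)]]]] by (simp add: mult.commute)

lemma partial_deriv_test_exp: "partial_deriv b (\<lambda>x. exp (- G (dseq k) x) * \<zeta> x) x =
    exp (- G (dseq k) x) * (partial_deriv b \<zeta> x - \<zeta> x * DG (dseq k) b x)"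
proof -
  have s: "smooth (G (dseq k))" "smooth \<zeta>" using smooth_G dseq(1) \<zeta> test_smooth by auto
  have "partial_deriv b (\<lambda>x. exp (- G (dseq k) x)) x = - exp (- G (dseq k) x) * DG (dseq k) b x"
    using pd_G[OF dseq(1)] by (subst partial_deriv_chain[OF smooth_differentiable[OF s(1)], where g="\<lambda>y. exp (- y)" and g'="- exp (- G (dseq k) x)"])
      (auto intro!: derivative_eq_intros)
  then show ?thesis
    by (subst partial_deriv_mult) (auto intro!: smooth_differentiable smooth_exp smooth_minus s simp: algebra_simps)
qed

lemma test_exp_DG: "test_function (\<lambda>x. exp (- G (dseq k) x) * \<zeta> x * DG (dseq k) b x)"
  by (rule test_mult[OF test_exp smooth_DG[OF dseq(1)]])

lemma partial_deriv_test_exp_DG: "partial_deriv b (\<lambda>x. exp (- G (dseq k) x) * \<zeta> x * DG (dseq k) b x) x =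
    exp (- G (dseq k) x) * (partial_deriv b \<zeta> x * DG (dseq k) b x - \<zeta> x * (DG (dseq k) b x)\<^sup>2) +
    exp (- G (dseq k) x) * (\<zeta> x * D2G (dseq k) b x)"
proof -
  have "partial_deriv b (\<lambda>x. exp (- G (dseq k) x) * \<zeta> x * DG (dseq k) b x) x =
    partial_deriv b (\<lambda>x. exp (- G (dseq k) x) * \<zeta> x) x * DG (dseq k) b x +
    exp (- G (dseq k) x) * \<zeta> x * partial_deriv b (DG (dseq k) b) x"
    by (intro partial_deriv_mult smooth_differentiable test_smooth[OF test_exp] smooth_DG dseq)
  then show ?thesis unfolding partial_deriv_test_exp pd_DG[OF dseq(1)] by (simp add: power2_eq_square algebra_simps)
qed

lemma test_bounds:
  obtains R C where "\<And>x. norm x \<ge> R \<Longrightarrow> \<zeta> x = 0" "\<And>b x. b \<in> Basis \<Longrightarrow> norm x \<ge> R \<Longrightarrow> partial_deriv b \<zeta> x = 0"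
    "\<And>x. \<bar>\<zeta> x\<bar> \<le> C" "\<And>b x. b \<in> Basis \<Longrightarrow> \<bar>partial_deriv b \<zeta> x\<bar> \<le> C" "C \<ge> 0"
proof -
  obtain R where R: "R > 0" "\<And>x. norm x \<ge> R \<Longrightarrow> \<zeta> x = 0" "smooth \<zeta>" using \<zeta> test_functionE by metis
  obtain C where C: "\<And>x. \<bar>\<zeta> x\<bar> \<le> C" "C > 0" using test_bounded[OF \<zeta>] by metis
  have "\<exists>C. \<forall>x. \<bar>partial_deriv b \<zeta> x\<bar> \<le> C" if "b \<in> Basis" for b
    using test_bounded[OF test_pd[OF \<zeta> that]] by metis
  then obtain B where B: "\<And>b x. b \<in> Basis \<Longrightarrow> \<bar>partial_deriv b \<zeta> x\<bar> \<le> B b" by metis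
  have Bn: "b \<in> Basis \<Longrightarrow> 0 \<le> B b" for b using B[of b undefined] by linarith
  have "\<bar>partial_deriv b \<zeta> x\<bar> \<le> C + (\<Sum>b\<in>Basis. B b)" if "b \<in> Basis" for b x
    using B[OF that, of x] member_le_sum[of b Basis B] that Bn C(2) by force
  moreover have "\<bar>\<zeta> x\<bar> \<le> C + (\<Sum>b\<in>Basis. B b)" for x using C(1)[of x] sum_nonneg[of Basis B] Bn by force
  ultimately show ?thesis
    using R(2) partial_deriv_outside[of R \<zeta>] C(2) sum_nonneg[of Basis B] Bn
    by (intro that[of "R + 1" "C + (\<Sum>b\<in>Basis. B b)"]) auto
qed

lemma test_measurable:
  "\<zeta> \<in> borel_measurable borel" "b \<in> Basis \<Longrightarrow> partial_deriv b \<zeta> \<in> borel_measurable borel"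
  using smooth_cont[OF test_smooth[OF \<zeta>]] smooth_cont[OF test_smooth[OF test_pd[OF \<zeta>]]]
  by (auto intro: borel_measurable_continuous_onI)

text \<open>These limits cover the first-order expressions that occur when exp (- G) \<zeta> and exp
  (- G) \<zeta> DG are inserted as test functions. In each of them the multiplier of w is bounded
  uniformly in k, so local integrability of w suffices.\<close>

lemma
  assumes w: "loc_int w" and b: "b \<in> Basis"
  shows tendsto_test_deriv: "(\<lambda>k. LINT x|lborel. exp (- G (dseq k) x) * ((partial_deriv b \<zeta> x - \<zeta> x * DG (dseq k) b x) * w x)) \<longlonglongrightarrow>
      (LINT x|lborel. exp (- F x) * ((partial_deriv b \<zeta> x - \<zeta> x * DF b x) * w x))"
    and tendsto_test_hessian: "(\<lambda>k. LINT x|lborel. exp (- G (dseq k) x) * ((partial_deriv b \<zeta> x * DG (dseq k) b x - \<zeta> x * (DG (dseq k) b x)\<^sup>2) * w x)) \<longlonglongrightarrow>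
      (LINT x|lborel. exp (- F x) * ((partial_deriv b \<zeta> x * DF b x - \<zeta> x * (DF b x)\<^sup>2) * w x))"
    and tendsto_test_grad: "(\<lambda>k. LINT x|lborel. exp (- G (dseq k) x) * (\<zeta> x * DG (dseq k) b x * w x)) \<longlonglongrightarrow>
      (LINT x|lborel. exp (- F x) * (\<zeta> x * DF b x * w x))"
    and tendsto_test: "(\<lambda>k. LINT x|lborel. exp (- G (dseq k) x) * (\<zeta> x * w x)) \<longlonglongrightarrow>
      (LINT x|lborel. exp (- F x) * (\<zeta> x * w x))"
proof -
  obtain R C where RC: "\<And>x. norm x \<ge> R \<Longrightarrow> \<zeta> x = 0" "\<And>b x. b \<in> Basis \<Longrightarrow> norm x \<ge> R \<Longrightarrow> partial_deriv b \<zeta> x = 0"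
    "\<And>x. \<bar>\<zeta> x\<bar> \<le> C" "\<And>b x. b \<in> Basis \<Longrightarrow> \<bar>partial_deriv b \<zeta> x\<bar> \<le> C" "C \<ge> 0"
    using test_bounds by metis
  note [measurable] = test_measurable(1) test_measurable(2)[OF b]
  define D where "D = (\<Sum>t\<in>T. \<bar>c t\<bar> * norm (L t b))"
  have D: "\<bar>DG (dseq k) b x\<bar> \<le> D" for k x unfolding D_def by (rule DG_bound[OF dseq(1)])
  have D0: "D \<ge> 0" unfolding D_def by (intro sum_nonneg) auto
  have DD: "\<bar>(DG (dseq k) b x)\<^sup>2\<bar> \<le> D * D" for k x
    using mult_mono[OF D D D0 abs_ge_zero, of k x k x] by (simp add: power2_eq_square abs_mult)
  have m: "\<bar>\<zeta> x * DG (dseq k) b x\<bar> \<le> C * D" "\<bar>partial_deriv b \<zeta> x * DG (dseq k) b x\<bar> \<le> C * D"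
    "\<bar>\<zeta> x * (DG (dseq k) b x)\<^sup>2\<bar> \<le> C * (D * D)" for k x
    using RC(3)[of x] RC(4)[OF b, of x] D[of k x] DD[of k x] RC(5) by (auto simp: abs_mult intro!: mult_mono)
  have t: "\<bar>u - v\<bar> \<le> a + d" if "\<bar>u\<bar> \<le> a" "\<bar>v\<bar> \<le> d" for u v a d :: real using that by linarith
  show "(\<lambda>k. LINT x|lborel. exp (- G (dseq k) x) * ((partial_deriv b \<zeta> x - \<zeta> x * DG (dseq k) b x) * w x)) \<longlonglongrightarrow>
      (LINT x|lborel. exp (- F x) * ((partial_deriv b \<zeta> x - \<zeta> x * DF b x) * w x))"
    by (rule exp_integral_tendsto_smooth[OF w, where R=R and C="C + C * D"])
      (measurable, auto intro!: t m RC(4) b tendsto_intros DG_tendsto simp: RC(1) RC(2)[OF b])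
  show "(\<lambda>k. LINT x|lborel. exp (- G (dseq k) x) * ((partial_deriv b \<zeta> x * DG (dseq k) b x - \<zeta> x * (DG (dseq k) b x)\<^sup>2) * w x)) \<longlonglongrightarrow>
      (LINT x|lborel. exp (- F x) * ((partial_deriv b \<zeta> x * DF b x - \<zeta> x * (DF b x)\<^sup>2) * w x))"
    by (rule exp_integral_tendsto_smooth[OF w, where R=R and C="C * D + C * (D * D)"])
      (measurable, auto intro!: t m tendsto_intros DG_tendsto simp: RC(1) RC(2)[OF b])
  show "(\<lambda>k. LINT x|lborel. exp (- G (dseq k) x) * (\<zeta> x * DG (dseq k) b x * w x)) \<longlonglongrightarrow>
      (LINT x|lborel. exp (- F x) * (\<zeta> x * DF b x * w x))"
    by (rule exp_integral_tendsto_smooth[OF w, where R=R and C="C * D"])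
      (measurable, auto intro!: m tendsto_intros DG_tendsto simp: RC(1))
  show "(\<lambda>k. LINT x|lborel. exp (- G (dseq k) x) * (\<zeta> x * w x)) \<longlonglongrightarrow>
      (LINT x|lborel. exp (- F x) * (\<zeta> x * w x))"
    by (rule exp_integral_tendsto_smooth[OF w, where R=R and C=C])
      (measurable, auto simp: RC(1,3))
qed

text \<open>The second derivatives are unbounded near the singular sets, so the domination comes
  from \<open>majorant\<close> times \<psi>, and both the bound and the limit hold only almost
  everywhere.\<close>

lemma
  assumes b: "b \<in> Basis"
  shows tendsto_test_second: "(\<lambda>k. LINT x|lborel. exp (- G (dseq k) x) * (\<zeta> x * D2G (dseq k) b x * \<psi> x)) \<longlonglongrightarrow>
      (LINT x|lborel. exp (- F x) * (\<zeta> x * D2F b x * \<psi> x))"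
    and integrable_test_second: "integrable lborel (\<lambda>x. exp (- F x) * (\<zeta> x * D2F b x * \<psi> x))"
proof -
  obtain R C where RC: "\<And>x. norm x \<ge> R \<Longrightarrow> \<zeta> x = 0" "\<And>x. \<bar>\<zeta> x\<bar> \<le> C" "C \<ge> 0"
    using test_bounds by metis
  note [measurable] = test_measurable(1) psi(1)
  have mm: "(\<lambda>x. \<zeta> x * D2G (dseq k) b x * \<psi> x) \<in> borel_measurable borel"
    "(\<lambda>x. \<zeta> x * D2F b x * \<psi> x) \<in> borel_measurable borel" for k by measurable
  have bd: "AE x in lborel. \<bar>\<zeta> x * D2G (dseq k) b x * \<psi> x\<bar> \<le> C * \<bar>majorant b x * \<psi> x\<bar>" for k
    using AE_nz
  proof eventually_elim
    case (elim x)
    have "\<bar>\<zeta> x\<bar> * (\<bar>D2G (dseq k) b x\<bar> * \<bar>\<psi> x\<bar>) \<le> C * (majorant b x * \<bar>\<psi> x\<bar>)"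
      using D2G_bound[OF dseq(1) elim, of k b] by (intro mult_mono RC mult_right_mono) auto
    also have "\<dots> \<le> C * \<bar>majorant b x * \<psi> x\<bar>"
      using RC(3) by (intro mult_left_mono) (auto simp: abs_mult mult_right_mono)
    finally show ?case by (simp add: abs_mult mult.assoc)
  qed
  have lm: "AE x in lborel. (\<lambda>k. \<zeta> x * D2G (dseq k) b x * \<psi> x) \<longlonglongrightarrow> \<zeta> x * D2F b x * \<psi> x"
    using AE_nz by eventually_elim (intro tendsto_intros D2G_tendsto)
  show "(\<lambda>k. LINT x|lborel. exp (- G (dseq k) x) * (\<zeta> x * D2G (dseq k) b x * \<psi> x)) \<longlonglongrightarrow>
      (LINT x|lborel. exp (- F x) * (\<zeta> x * D2F b x * \<psi> x))"
    "integrable lborel (\<lambda>x. exp (- F x) * (\<zeta> x * D2F b x * \<psi> x))"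
    by (rule exp_tendsto_integral[OF loc_int_majorant_psi mm bd RC(3) _ lm, where R=R]; simp add: RC(1))+
qed

lemma weak_limit:
  assumes b: "b \<in> Basis"
  shows "(LINT x|lborel. exp (- F x) * ((partial_deriv b \<zeta> x - \<zeta> x * DF b x) * \<psi> x)) =
    - (LINT x|lborel. exp (- F x) * (\<zeta> x * p b x))"
proof -
  have "(LINT x|lborel. exp (- G (dseq k) x) * ((partial_deriv b \<zeta> x - \<zeta> x * DG (dseq k) b x) * \<psi> x)) =
    - (LINT x|lborel. exp (- G (dseq k) x) * (\<zeta> x * p b x))" for k
    using weak[OF b test_exp, of k] by (simp add: partial_deriv_test_exp mult.assoc)
  then show ?thesis
    using tendsto_test_deriv[OF loc_int_psi b] tendsto_minus[OF tendsto_test[OF loc_int_p[OF b] b]] LIMSEQ_unique by fastforce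
qed

lemma eqn_limit:
  "(\<Sum>b\<in>Basis. LINT x|lborel. exp (- F x) * ((partial_deriv b \<zeta> x - \<zeta> x * DF b x) * p b x)) +
    (LINT x|lborel. exp (- F x) * (\<zeta> x * (V x * \<psi> x))) = E * (LINT x|lborel. exp (- F x) * (\<zeta> x * \<psi> x))"
proof -
  have "(\<Sum>b\<in>Basis. LINT x|lborel. exp (- G (dseq k) x) * ((partial_deriv b \<zeta> x - \<zeta> x * DG (dseq k) b x) * p b x)) +
    (LINT x|lborel. exp (- G (dseq k) x) * (\<zeta> x * (V x * \<psi> x))) = E * (LINT x|lborel. exp (- G (dseq k) x) * (\<zeta> x * \<psi> x))" for k
    using eqn[OF test_exp, of k] by (simp add: partial_deriv_test_exp mult.assoc)
  \<comment> \<open>A direction with which to instantiate \<open>tendsto_test\<close>, which is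
    stated jointly with the limits for a fixed basis vector.\<close>
  moreover obtain b :: 'a where b: "b \<in> Basis" using nonempty_Basis by blast
  have "(\<lambda>k. (\<Sum>b\<in>Basis. LINT x|lborel. exp (- G (dseq k) x) * ((partial_deriv b \<zeta> x - \<zeta> x * DG (dseq k) b x) * p b x)) +
    (LINT x|lborel. exp (- G (dseq k) x) * (\<zeta> x * (V x * \<psi> x)))) \<longlonglongrightarrow>
    (\<Sum>b\<in>Basis. LINT x|lborel. exp (- F x) * ((partial_deriv b \<zeta> x - \<zeta> x * DF b x) * p b x)) +
    (LINT x|lborel. exp (- F x) * (\<zeta> x * (V x * \<psi> x)))"
    by (intro tendsto_add tendsto_sum tendsto_test_deriv loc_int_p tendsto_test[OF loc_int_V_psi b])
  moreover have "(\<lambda>k. E * (LINT x|lborel. exp (- G (dseq k) x) * (\<zeta> x * \<psi> x))) \<longlonglongrightarrow> E * (LINT x|lborel. exp (- F x) * (\<zeta> x * \<psi> x))"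
    by (intro tendsto_mult tendsto_const tendsto_test[OF loc_int_psi b])
  ultimately show ?thesis using LIMSEQ_unique by fastforce
qed

text \<open>The weak gradient of \<psi> tested with exp (- G) \<zeta> DG. Differentiating DG yields
  \<open>D2F\<close> against \<psi>; summed over b this becomes V \<psi>, the term to be cancelled
  in \<open>eqn_limit\<close>.\<close>

lemma grad_limit:
  assumes b: "b \<in> Basis"
  shows "(LINT x|lborel. exp (- F x) * ((partial_deriv b \<zeta> x * DF b x - \<zeta> x * (DF b x)\<^sup>2) * \<psi> x)) +
    (LINT x|lborel. exp (- F x) * (\<zeta> x * D2F b x * \<psi> x)) = - (LINT x|lborel. exp (- F x) * (\<zeta> x * DF b x * p b x))"
proof -
  have "(LINT x|lborel. exp (- G (dseq k) x) * ((partial_deriv b \<zeta> x * DG (dseq k) b x - \<zeta> x * (DG (dseq k) b x)\<^sup>2) * \<psi> x)) +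
    (LINT x|lborel. exp (- G (dseq k) x) * (\<zeta> x * D2G (dseq k) b x * \<psi> x)) =
    - (LINT x|lborel. exp (- G (dseq k) x) * (\<zeta> x * DG (dseq k) b x * p b x))" for k
  proof -
    have "partial_deriv b (DG (dseq k) b) = D2G (dseq k) b" by (rule ext) (rule pd_DG[OF dseq(1)])
    then have sm: "smooth (G (dseq k))" "smooth (DG (dseq k) b)" "smooth (D2G (dseq k) b)" "smooth \<zeta>"
      using smooth_G smooth_DG dseq(1) \<zeta> test_smooth smooth_pd[OF smooth_DG[OF dseq(1)] b, of k b]
      by auto
    have "integrable lborel (\<lambda>x. \<zeta> x * (exp (- G (dseq k) x) * DG (dseq k) b x * DG (dseq k) b x * \<psi> x))"
      "integrable lborel (\<lambda>x. \<zeta> x * (exp (- G (dseq k) x) * D2G (dseq k) b x * \<psi> x))"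
      "integrable lborel (\<lambda>x. partial_deriv b \<zeta> x * (exp (- G (dseq k) x) * DG (dseq k) b x * \<psi> x))"
      by (intro integrable_test_mult test_pd \<zeta> b loc_int_mult_cont loc_int_psi smooth_cont smooth_mult smooth_exp smooth_minus sm)+
    then have i: "integrable lborel (\<lambda>x. exp (- G (dseq k) x) * ((partial_deriv b \<zeta> x * DG (dseq k) b x - \<zeta> x * (DG (dseq k) b x)\<^sup>2) * \<psi> x))"
      "integrable lborel (\<lambda>x. exp (- G (dseq k) x) * (\<zeta> x * D2G (dseq k) b x * \<psi> x))"
      by (simp_all add: power2_eq_square left_diff_distrib right_diff_distrib mult_ac)
    show ?thesis
      using weak[OF b test_exp_DG, of k b, unfolded partial_deriv_test_exp_DG] unfolding Bochner_Integration.integral_add[OF i, symmetric]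
      by (simp add: algebra_simps)
  qed
  moreover have "(\<lambda>k. (LINT x|lborel. exp (- G (dseq k) x) * ((partial_deriv b \<zeta> x * DG (dseq k) b x - \<zeta> x * (DG (dseq k) b x)\<^sup>2) * \<psi> x)) +
    (LINT x|lborel. exp (- G (dseq k) x) * (\<zeta> x * D2G (dseq k) b x * \<psi> x))) \<longlonglongrightarrow>
    (LINT x|lborel. exp (- F x) * ((partial_deriv b \<zeta> x * DF b x - \<zeta> x * (DF b x)\<^sup>2) * \<psi> x)) +
    (LINT x|lborel. exp (- F x) * (\<zeta> x * D2F b x * \<psi> x))"
    by (intro tendsto_add tendsto_test_hessian tendsto_test_second loc_int_psi b)
  moreover have "(\<lambda>k. - (LINT x|lborel. exp (- G (dseq k) x) * (\<zeta> x * DG (dseq k) b x * p b x))) \<longlonglongrightarrow> - (LINT x|lborel. exp (- F x) * (\<zeta> x * DF b x * p b x))"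
    by (intro tendsto_minus tendsto_test_grad loc_int_p b)
  ultimately show ?thesis using LIMSEQ_unique by fastforce
qed

lemma integral_test_deriv:
  assumes w: "loc_int w" and b: "b \<in> Basis"
  shows "(LINT x|lborel. exp (- F x) * ((partial_deriv b \<zeta> x - \<zeta> x * DF b x) * w x)) =
    (LINT x|lborel. partial_deriv b \<zeta> x * (exp (- F x) * w x)) - (LINT x|lborel. \<zeta> x * (exp (- F x) * (DF b x * w x)))"
  by (subst Bochner_Integration.integral_diff[symmetric])
    (intro integrable_test_mult test_pd \<zeta> b F_mult DF_mult w, intro integrable_test_mult test_pd \<zeta> b F_mult DF_mult w,
      simp add: algebra_simps)

text \<open>The product rule: e^(-F) (p - \<psi> DF) is the weak gradient of e^(-F) \<psi>. It is
  \<open>weak_limit\<close> rearranged, with the non-smooth factor moved from the test function to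
  \<psi>.\<close>

lemma transformed_weak:
  assumes b: "b \<in> Basis"
  shows "(LINT x|lborel. partial_deriv b \<zeta> x * (exp (- F x) * \<psi> x)) =
    - (LINT x|lborel. \<zeta> x * (exp (- F x) * (p b x - \<psi> x * DF b x)))"
proof -
  have "(LINT x|lborel. \<zeta> x * (exp (- F x) * (p b x - \<psi> x * DF b x))) =
    (LINT x|lborel. \<zeta> x * (exp (- F x) * p b x)) - (LINT x|lborel. \<zeta> x * (exp (- F x) * (DF b x * \<psi> x)))"
    by (subst Bochner_Integration.integral_diff[symmetric])
     (intro integrable_test_mult \<zeta> F_mult DF_mult loc_int_p loc_int_psi b, intro integrable_test_mult \<zeta> F_mult DF_mult loc_int_psi,
      simp add: algebra_simps)
  moreover have "(LINT x|lborel. exp (- F x) * (\<zeta> x * p b x)) = (LINT x|lborel. \<zeta> x * (exp (- F x) * p b x))"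
    by (simp add: mult_ac)
  ultimately show ?thesis using weak_limit[OF b] integral_test_deriv[OF loc_int_psi b] by linarith
qed

text \<open>With \<phi> = e^(-F) \<psi> this is the weak form of - Laplacian \<phi> = 2 grad F .
  grad \<phi> + (|grad F|^2 + E) \<phi>. The proof is linear algebra in the integrals named below:
  \<open>A\<close> is the eigenvalue equation, \<open>B\<close> is \<open>grad_limit\<close>, and
  \<open>M\<close> identifies the summed second derivatives with V.\<close>

lemma transformed_eqn:
  "(\<Sum>b\<in>Basis. LINT x|lborel. partial_deriv b \<zeta> x * (exp (- F x) * (p b x - \<psi> x * DF b x))) =
    (LINT x|lborel. \<zeta> x * (2 * (\<Sum>b\<in>Basis. DF b x * (exp (- F x) * (p b x - \<psi> x * DF b x)))
      + ((\<Sum>b\<in>Basis. (DF b x)\<^sup>2) + E) * (exp (- F x) * \<psi> x)))"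
proof -
  note li = integrable_test_mult[OF \<zeta>] integrable_test_mult[OF test_pd[OF \<zeta>]] F_mult DF_mult loc_int_p loc_int_psi
  define a where "a b = (LINT x|lborel. partial_deriv b \<zeta> x * (exp (- F x) * p b x))" for b
  define bb where "bb b = (LINT x|lborel. \<zeta> x * (exp (- F x) * (DF b x * p b x)))" for b
  define cc where "cc b = (LINT x|lborel. partial_deriv b \<zeta> x * (exp (- F x) * (DF b x * \<psi> x)))" for b
  define d where "d b = (LINT x|lborel. \<zeta> x * (exp (- F x) * (DF b x * (DF b x * \<psi> x))))" for b
  define m where "m b = (LINT x|lborel. exp (- F x) * (\<zeta> x * D2F b x * \<psi> x))" for b
  define v where "v = (LINT x|lborel. exp (- F x) * (\<zeta> x * (V x * \<psi> x)))"
  define s where "s = (LINT x|lborel. \<zeta> x * (exp (- F x) * \<psi> x))"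
  have A: "(\<Sum>b\<in>Basis. a b - bb b) + v = E * s"
    using eqn_limit integral_test_deriv[OF loc_int_p] by (simp add: a_def bb_def v_def s_def mult_ac)
  have B: "cc b - d b + m b = - bb b" if b: "b \<in> Basis" for b
  proof -
    have "(LINT x|lborel. exp (- F x) * ((partial_deriv b \<zeta> x * DF b x - \<zeta> x * (DF b x)\<^sup>2) * \<psi> x)) = cc b - d b"
      unfolding cc_def d_def
      by (subst Bochner_Integration.integral_diff[symmetric])
        (intro li b, intro li, simp add: algebra_simps power2_eq_square)
    then show ?thesis using grad_limit[OF b] by (simp add: m_def bb_def mult_ac)
  qed
  have M: "(\<Sum>b\<in>Basis. m b) = v"
  proof -
    have "(\<Sum>b\<in>Basis. m b) = (LINT x|lborel. (\<Sum>b\<in>Basis. exp (- F x) * (\<zeta> x * D2F b x * \<psi> x)))"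
      unfolding m_def by (intro Bochner_Integration.integral_sum[symmetric] integrable_test_second)
    also have "\<dots> = v"
      unfolding v_def
    proof (rule integral_cong_AE)
      note [measurable] = test_measurable(1) psi(1)
      show "(\<lambda>x. \<Sum>b\<in>Basis. exp (- F x) * (\<zeta> x * D2F b x * \<psi> x)) \<in> borel_measurable lborel"
        "(\<lambda>x. exp (- F x) * (\<zeta> x * (V x * \<psi> x))) \<in> borel_measurable lborel" by measurable
      show "AE x in lborel. (\<Sum>b\<in>Basis. exp (- F x) * (\<zeta> x * D2F b x * \<psi> x)) = exp (- F x) * (\<zeta> x * (V x * \<psi> x))"
        using AE_nz
      proof eventually_elim
        case (elim x)
        then show ?case by (simp add: sum_D2F[OF elim, symmetric] sum_distrib_left sum_distrib_right mult_ac)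
      qed
    qed
    finally show ?thesis .
  qed
  have "(\<Sum>b\<in>Basis. LINT x|lborel. partial_deriv b \<zeta> x * (exp (- F x) * (p b x - \<psi> x * DF b x))) = (\<Sum>b\<in>Basis. a b - cc b)"
  proof (rule sum.cong)
    fix b :: 'a assume b: "b \<in> Basis"
    show "(LINT x|lborel. partial_deriv b \<zeta> x * (exp (- F x) * (p b x - \<psi> x * DF b x))) = a b - cc b"
      unfolding a_def cc_def
      by (subst Bochner_Integration.integral_diff[symmetric])
        (intro li b, intro li b, simp add: algebra_simps)
  qed simp
  \<comment> \<open>Subtracting the sum of the identities \<open>B\<close> from \<open>A\<close>
    removes v, the only quantity that contains the singular potential.\<close>
  also have "\<dots> = 2 * (\<Sum>b\<in>Basis. bb b) - (\<Sum>b\<in>Basis. d b) + E * s"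
  proof -
    have "(\<Sum>b\<in>Basis. cc b - d b + m b) = (\<Sum>b\<in>Basis. - bb b)" by (rule sum.cong) (use B in auto)
    then show ?thesis using A M by (simp add: sum.distrib sum_subtractf sum_negf)
  qed
  also have "\<dots> = (LINT x|lborel. 2 * (\<Sum>b\<in>Basis. \<zeta> x * (exp (- F x) * (DF b x * p b x))) -
      (\<Sum>b\<in>Basis. \<zeta> x * (exp (- F x) * (DF b x * (DF b x * \<psi> x)))) + E * (\<zeta> x * (exp (- F x) * \<psi> x)))"
  proof -
    have i1: "integrable lborel (\<lambda>x. \<Sum>b\<in>Basis. \<zeta> x * (exp (- F x) * (DF b x * p b x)))"
      and i2: "integrable lborel (\<lambda>x. \<Sum>b\<in>Basis. \<zeta> x * (exp (- F x) * (DF b x * (DF b x * \<psi> x))))"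
      and i3: "integrable lborel (\<lambda>x. \<zeta> x * (exp (- F x) * \<psi> x))"
      by (intro Bochner_Integration.integrable_sum li | assumption)+
    have s1: "(LINT x|lborel. (\<Sum>b\<in>Basis. \<zeta> x * (exp (- F x) * (DF b x * p b x)))) = (\<Sum>b\<in>Basis. bb b)"
      and s2: "(LINT x|lborel. (\<Sum>b\<in>Basis. \<zeta> x * (exp (- F x) * (DF b x * (DF b x * \<psi> x))))) = (\<Sum>b\<in>Basis. d b)"
      unfolding bb_def d_def by (intro Bochner_Integration.integral_sum li | assumption)+
    show ?thesis using i1 i2 i3 by (simp add: s1 s2 flip: s_def)
  qed
  \<comment> \<open>Pointwise, 2 DF p - DF^2 \<psi> = 2 DF (p - \<psi> DF) + DF^2 \<psi>, which
    expresses everything through the transformed function and its gradient.\<close>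
  also have "\<dots> = (LINT x|lborel. \<zeta> x * (2 * (\<Sum>b\<in>Basis. DF b x * (exp (- F x) * (p b x - \<psi> x * DF b x)))
      + ((\<Sum>b\<in>Basis. (DF b x)\<^sup>2) + E) * (exp (- F x) * \<psi> x)))"
    by (intro Bochner_Integration.integral_cong refl)
      (simp add: power2_eq_square algebra_simps sum_distrib_left sum_distrib_right sum_subtractf)
  finally show ?thesis .
qed

end

end

end

section \<open>Weakly singular kernels\<close>

lemma nn_integral_reflect:
  fixes f :: "'a::euclidean_space \<Rightarrow> ennreal"
  assumes "f \<in> borel_measurable borel"
  shows "(\<integral>\<^sup>+y. f (x - y) \<partial>lborel) = (\<integral>\<^sup>+y. f y \<partial>lborel)"
proof -
  have *: "distr lborel borel (\<lambda>y. x + (-1) *\<^sub>R y) = lborel" by (rule lborel_affine_sign) simp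
  show ?thesis using assms by (subst (2) *[symmetric], subst nn_integral_distr) auto
qed

text \<open>Dyadic decomposition: on the shell of radius between 2^(-k-1) and 2^(-k) the integrand
  is at most 2^s 2^(s k), and the enclosing ball has volume v 2^(-n k). The resulting series is
  geometric with ratio q = 2^(s-n).\<close>

lemma powr_integral_ball:
  assumes s: "s < real DIM('a::euclidean_space)" "0 \<le> s"
  shows "(\<integral>\<^sup>+z. ennreal (indicator (ball 0 1) z * norm z powr (-s)) \<partial>(lborel :: 'a measure)) < \<infinity>"
proof -
  let ?n = "real DIM('a)"
  define v where "v = unit_ball_vol ?n"
  define q where "q = (1/2) powr (?n - s)"
  have v: "v \<ge> 0" by (simp add: v_def)
  have q: "0 < q" "q < 1" using s unfolding q_def powr_def by (auto simp: ln_div)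
  define f where "f k z = ennreal (2 powr s * (1/2) powr (- (s * real k)) * indicator (ball 0 ((1/2) ^ k)) z)" for k and z :: 'a
  have [measurable]: "f k \<in> borel_measurable borel" for k unfolding f_def[abs_def] by measurable
  have "(\<integral>\<^sup>+z. ennreal (indicator (ball 0 1) z * norm z powr (-s)) \<partial>(lborel :: 'a measure)) \<le> (\<integral>\<^sup>+z. (\<Sum>k. f k z) \<partial>lborel)"
  proof (rule nn_integral_mono)
    fix z :: 'a
    show "ennreal (indicator (ball 0 1) z * norm z powr (-s)) \<le> (\<Sum>k. f k z)"
    proof (cases "z = 0 \<or> norm z \<ge> 1")
      case False
      then have z: "0 < norm z" "norm z < 1" by auto
      obtain m where m: "(1/2::real) ^ m \<le> norm z" using real_arch_pow_inv[of "norm z" "1/2"] z by (auto intro: less_imp_le)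
      \<comment> \<open>The least l with 2^(-l) \<le> |z| is positive because |z| < 1, so z lies in
        the ball numbered k = l - 1.\<close>
      define l where "l = (LEAST m. (1/2::real) ^ m \<le> norm z)"
      have l: "(1/2::real) ^ l \<le> norm z" unfolding l_def by (rule LeastI[where P="\<lambda>m. (1/2::real) ^ m \<le> norm z", OF m])
      then obtain k where k: "l = Suc k" using z by (cases l) auto
      have k2: "norm z < (1/2) ^ k" using not_less_Least[of k "\<lambda>m. (1/2::real) ^ m \<le> norm z"] k by (auto simp: l_def)
      have "norm z powr (-s) \<le> ((1/2) ^ Suc k) powr (-s)"
        using l s(2) unfolding k by (intro powr_mono2') auto
      also have "\<dots> = 2 powr s * (1/2) powr (- (s * real k))"
        by (simp add: powr_mult powr_minus powr_powr powr_divide divide_simps mult.commute flip: powr_realpow)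
      finally have "ennreal (indicator (ball 0 1) z * norm z powr (-s)) \<le> f k z"
        using k2 z by (auto simp: f_def intro!: ennreal_leI)
      also have "\<dots> \<le> (\<Sum>k. f k z)"
        using sum_le_suminf[of "\<lambda>k. f k z" "{k}"] by auto
      finally show ?thesis .
    qed auto
  qed
  also have "\<dots> = (\<Sum>k. \<integral>\<^sup>+z. f k z \<partial>lborel)" by (rule nn_integral_suminf) simp
  also have "\<dots> = (\<Sum>k. ennreal (2 powr s * v * q ^ k))"
  proof (rule arg_cong[where f=suminf], rule ext)
    fix k
    have "(\<integral>\<^sup>+z. f k z \<partial>lborel) = ennreal (2 powr s * (1/2) powr (- (s * real k))) * emeasure lborel (ball (0::'a) ((1/2) ^ k))"
      unfolding f_def by (subst ennreal_mult') (auto simp: nn_integral_cmult ennreal_indicator)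
    also have "\<dots> = ennreal (2 powr s * (1/2) powr (- (s * real k)) * (v * ((1/2) ^ k) ^ DIM('a)))"
      using v by (subst emeasure_ball) (auto simp: v_def ennreal_mult'')
    also have "2 powr s * (1/2) powr (- (s * real k)) * (v * ((1/2) ^ k) ^ DIM('a)) = 2 powr s * v * q ^ k"
    proof -
      have "((1/2) ^ k) ^ DIM('a) = (1/2::real) powr (real k * ?n)" by (simp add: powr_realpow flip: power_mult of_nat_mult)
      moreover have "q ^ k = (1/2) powr (real k * (?n - s))"
        using q(1) unfolding q_def by (simp add: powr_powr mult.commute flip: powr_realpow)
      moreover have "(1/2) powr (- (s * real k)) * (1/2::real) powr (real k * ?n) = (1/2) powr (real k * (?n - s))"
        by (simp add: algebra_simps flip: powr_add)
      ultimately show ?thesis by (simp add: mult_ac)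
    qed
    finally show "(\<integral>\<^sup>+z. f k z \<partial>lborel) = ennreal (2 powr s * v * q ^ k)" .
  qed
  also have "\<dots> < \<infinity>"
  proof -
    have "summable (\<lambda>k. 2 powr s * v * q ^ k)" using q by (intro summable_mult summable_geometric) auto
    then have "(\<Sum>k. ennreal (2 powr s * v * q ^ k)) \<noteq> top"
      using v q by (intro ennreal_suminf_neq_top) auto
    then show ?thesis by (simp add: less_top)
  qed
  finally show ?thesis .
qed

text \<open>Norms to a negative power vanish at the origin, because \<open>0 powr s = 0\<close>.\<close>

lemma powr_kernel_bound:
  assumes s: "s < real DIM('a::euclidean_space)" "0 \<le> s"
  obtains C where "C \<ge> 0" "\<And>x :: 'a. (\<integral>\<^sup>+y. ennreal (indicator (ball 0 R) y * norm (x - y) powr (-s)) \<partial>lborel) \<le> ennreal C"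
proof -
  define J where "J = (\<integral>\<^sup>+z. ennreal (indicator (ball 0 1) z * norm z powr (-s)) \<partial>(lborel :: 'a measure)) + emeasure lborel (ball (0::'a) R)"
  have "J < \<infinity>" unfolding J_def using powr_integral_ball[OF s] emeasure_lborel_ball_finite[of "0::'a" R] by simp
  then have J: "J = ennreal (enn2real J)" by (simp add: less_top)
  have "(\<integral>\<^sup>+y. ennreal (indicator (ball 0 R) y * norm (x - y) powr (-s)) \<partial>lborel) \<le> J" for x :: 'a
  proof -
    have "(\<integral>\<^sup>+y. ennreal (indicator (ball 0 R) y * norm (x - y) powr (-s)) \<partial>lborel)
      \<le> (\<integral>\<^sup>+y. ennreal (indicator (ball 0 1) (x - y) * norm (x - y) powr (-s)) + indicator (ball 0 R) y \<partial>lborel)"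
    proof (rule nn_integral_mono)
      fix y :: 'a
      have "norm (x - y) powr (-s) \<le> 1" if "norm (x - y) \<ge> 1"
        using powr_mono2'[of "-s" 1 "norm (x - y)"] that s by simp
      then show "ennreal (indicator (ball 0 R) y * norm (x - y) powr (-s)) \<le>
          ennreal (indicator (ball 0 1) (x - y) * norm (x - y) powr (-s)) + indicator (ball 0 R) y"
        by (cases "norm (x - y) < 1") (auto simp: indicator_def)
    qed
    also have "\<dots> = (\<integral>\<^sup>+y. ennreal (indicator (ball 0 1) (x - y) * norm (x - y) powr (-s)) \<partial>lborel) + emeasure lborel (ball (0::'a) R)"
      by (subst nn_integral_add) auto
    also have "\<dots> = J" unfolding J_def
      by (subst nn_integral_reflect[where f="\<lambda>z. ennreal (indicator (ball 0 1) z * norm z powr (-s))"]) auto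
    finally show ?thesis .
  qed
  then show ?thesis using J by (intro that[of "enn2real J"]) auto
qed

section \<open>Composition of kernels and the bootstrap\<close>

lemma kernel_product_bound:
  fixes x y z :: "'a::euclidean_space"
  assumes n: "1/2 \<le> a" "a \<le> n - 1/2" and xz: "x \<noteq> z"
  shows "norm (x - y) powr (-a) * norm (y - z) powr (-(n-1)) \<le>
    2 powr (a - 1/2) * norm (x - z) powr (-(a - 1/2)) * (norm (x - y) powr (-(n-1/2)) + norm (z - y) powr (-(n-1/2)))"
proof (cases "x = y \<or> y = z")
  case False
  define A B s where "A = norm (x - y)" and "B = norm (y - z)" and "s = norm (x - z)"
  have pos: "A > 0" "B > 0" "s > 0" using False xz by (auto simp: A_def B_def s_def)
  have tri: "s \<le> A + B" unfolding A_def B_def s_def by (metis norm_triangle_ineq diff_add_cancel add_diff_eq)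
  \<comment> \<open>The larger of the two distances is at least |x - z| / 2. The power c is taken
    from it, and what is left of it is replaced by the smaller distance, whose total order becomes a
    + (n - 1) - c = n - 1/2.\<close>
  define c where "c = a - 1/2"
  have c: "c \<ge> 0" using n by (simp add: c_def)
  have half: "(s/2) powr (-c) = 2 powr c * s powr (-c)"
    using pos by (simp add: powr_divide powr_minus divide_simps)
  have "A powr (-a) * B powr (-(n-1)) \<le> (s/2) powr (-c) * (A powr (-(n-1/2)) + B powr (-(n-1/2)))"
  proof (cases "B \<le> A")
    case True
    have "A powr (-a) * B powr (-(n-1)) = A powr (-c) * (A powr (-1/2) * B powr (-(n-1)))"
      using pos by (simp add: c_def flip: powr_add)
    also have "\<dots> \<le> (s/2) powr (-c) * (B powr (-1/2) * B powr (-(n-1)))"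
      using pos True tri c by (intro mult_mono mult_right_mono powr_mono2') auto
    also have "B powr (-1/2) * B powr (-(n-1)) = B powr (-(n-1/2))"
      by (simp add: algebra_simps flip: powr_add)
    also have "(s/2) powr (-c) * B powr (-(n-1/2)) \<le> (s/2) powr (-c) * (A powr (-(n-1/2)) + B powr (-(n-1/2)))"
      by (intro mult_left_mono) auto
    finally show ?thesis .
  next
    case False
    have "A powr (-a) * B powr (-(n-1)) = B powr (-c) * (A powr (-a) * B powr (-(n-1/2-a)))"
      using pos by (simp add: c_def flip: powr_add)
    also have "\<dots> \<le> (s/2) powr (-c) * (A powr (-a) * A powr (-(n-1/2-a)))"
      using pos False tri c n by (intro mult_mono mult_left_mono powr_mono2') auto
    also have "A powr (-a) * A powr (-(n-1/2-a)) = A powr (-(n-1/2))"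
      by (simp add: algebra_simps flip: powr_add)
    also have "(s/2) powr (-c) * A powr (-(n-1/2)) \<le> (s/2) powr (-c) * (A powr (-(n-1/2)) + B powr (-(n-1/2)))"
      by (intro mult_left_mono) auto
    finally show ?thesis .
  qed
  then have "A powr (-a) * B powr (-(n-1)) \<le> 2 powr c * s powr (-c) * (A powr (-(n-1/2)) + B powr (-(n-1/2)))"
    by (simp only: half)
  then show ?thesis unfolding c_def A_def B_def s_def by (simp add: norm_minus_commute[of z y])
qed auto

text \<open>Extracting the order a - 1/2 leaves kernels of order n - 1/2, which are still
  integrable. Extracting a - 1 would leave the order n, which is not; hence the gain of only half a
  power.\<close>

lemma kernel_composition:
  assumes n: "n = real DIM('a::euclidean_space)" and a: "1/2 \<le> a" "a \<le> n - 1/2"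
  obtains C where "C \<ge> 0" "\<And>x z :: 'a. x \<noteq> z \<Longrightarrow>
    (\<integral>\<^sup>+y. ennreal (indicator (ball 0 R) y * (norm (x - y) powr (-a) * norm (y - z) powr (-(n-1)))) \<partial>lborel)
      \<le> ennreal (C * norm (x - z) powr (-(a - 1/2)))"
proof -
  obtain J where J: "J \<ge> 0" "\<And>x :: 'a. (\<integral>\<^sup>+y. ennreal (indicator (ball 0 R) y * norm (x - y) powr (-(n - 1/2))) \<partial>lborel) \<le> ennreal J"
    by (rule powr_kernel_bound[of "n - 1/2" R]) (use n a in auto)
  show ?thesis
  proof (rule that[of "2 powr (a - 1/2) * (J + J)"])
    fix x z :: 'a assume xz: "x \<noteq> z"
    let ?D = "2 powr (a - 1/2) * norm (x - z) powr (-(a - 1/2))"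
    have "(\<integral>\<^sup>+y. ennreal (indicator (ball 0 R) y * (norm (x - y) powr (-a) * norm (y - z) powr (-(n-1)))) \<partial>lborel)
      \<le> (\<integral>\<^sup>+y. ennreal ?D * (ennreal (indicator (ball 0 R) y * norm (x - y) powr (-(n - 1/2))) +
              ennreal (indicator (ball 0 R) y * norm (z - y) powr (-(n - 1/2)))) \<partial>lborel)"
    proof (rule nn_integral_mono)
      fix y :: 'a
      have "indicator (ball 0 R) y * (norm (x - y) powr (-a) * norm (y - z) powr (-(n-1))) \<le>
        ?D * (indicator (ball 0 R) y * norm (x - y) powr (-(n - 1/2)) + indicator (ball 0 R) y * norm (z - y) powr (-(n - 1/2)))"
        using kernel_product_bound[OF a xz, of y] by (simp add: indicator_def)
      then show "ennreal (indicator (ball 0 R) y * (norm (x - y) powr (-a) * norm (y - z) powr (-(n-1)))) \<le>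
        ennreal ?D * (ennreal (indicator (ball 0 R) y * norm (x - y) powr (-(n - 1/2))) +
              ennreal (indicator (ball 0 R) y * norm (z - y) powr (-(n - 1/2))))"
        by (subst ennreal_plus[symmetric], simp, simp, subst ennreal_mult'[symmetric]) (auto intro: ennreal_leI)
    qed
    also have "\<dots> = ennreal ?D * ((\<integral>\<^sup>+y. ennreal (indicator (ball 0 R) y * norm (x - y) powr (-(n - 1/2))) \<partial>lborel) +
              (\<integral>\<^sup>+y. ennreal (indicator (ball 0 R) y * norm (z - y) powr (-(n - 1/2))) \<partial>lborel))"
      by (subst nn_integral_cmult, measurable, subst nn_integral_add) auto
    also have "\<dots> \<le> ennreal ?D * (ennreal J + ennreal J)" by (intro mult_left_mono add_mono J) auto
    also have "\<dots> = ennreal (2 powr (a - 1/2) * (J + J) * norm (x - z) powr (-(a - 1/2)))"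
      using J(1) by (simp add: ennreal_mult' mult_ac flip: ennreal_plus)
    finally show "(\<integral>\<^sup>+y. ennreal (indicator (ball 0 R) y * (norm (x - y) powr (-a) * norm (y - z) powr (-(n-1)))) \<partial>lborel)
      \<le> ennreal (2 powr (a - 1/2) * (J + J) * norm (x - z) powr (-(a - 1/2)))" .
  qed (use J in auto)
qed

text \<open>Feeding the integral inequality into the potential of order \<open>a - 1/2\<close> gains half a power of
  the kernel in each round; after finitely many rounds the right-hand side of the inequality
  itself is bounded.\<close>

lemma bootstrap:
  fixes W :: "'a::euclidean_space \<Rightarrow> real"
  assumes n: "n = real DIM('a)" and W: "loc_int W" and W0: "\<And>x. W x \<ge> 0"
    and H: "\<And>R. \<exists>C\<ge>0. AE x in lborel. x \<in> ball 0 R \<longrightarrow>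
      ennreal (W x) \<le> ennreal C * (\<integral>\<^sup>+y. ennreal (indicator (ball 0 (R+2)) y * (norm (x - y) powr (-(n-1)) * W y)) \<partial>lborel)"
  shows "\<exists>C. AE x in lborel. x \<in> ball 0 R \<longrightarrow> W x \<le> C"
proof -
  have [measurable]: "W \<in> borel_measurable borel" using W by (rule loc_int_borel)
  \<comment> \<open>The order k/2 climbs in half steps from 0, where local integrability of W is
    enough, to n - 1, the order in the integral inequality. R is arbitrary in the induction because
    every use of that inequality enlarges the ball by 2.\<close>
  have P: "\<exists>C\<ge>0. \<forall>x. (\<integral>\<^sup>+y. ennreal (indicator (ball 0 R) y * (norm (x - y) powr (-(real k / 2)) * W y)) \<partial>lborel) \<le> ennreal C"
    if "k \<le> 2 * (DIM('a) - 1)" for k R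
    using that
  proof (induction k arbitrary: R)
    case 0
    have "(\<integral>\<^sup>+y. ennreal (indicator (ball 0 R) y * (norm (x - y) powr (-(real 0 / 2)) * W y)) \<partial>lborel)
      \<le> ennreal (LINT y|lborel. indicator (ball 0 R) y * W y)" for x
    proof -
      have "(\<integral>\<^sup>+y. ennreal (indicator (ball 0 R) y * (norm (x - y) powr (-(real 0 / 2)) * W y)) \<partial>lborel)
        \<le> (\<integral>\<^sup>+y. ennreal (indicator (ball 0 R) y * W y) \<partial>lborel)"
        using W0 by (intro nn_integral_mono ennreal_leI mult_left_mono mult_left_le_one_le) auto
      also have "\<dots> = ennreal (LINT y|lborel. indicator (ball 0 R) y * W y)"
        by (rule nn_integral_eq_integral[OF loc_intD[OF W]]) (simp add: W0)
      finally show ?thesis .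
    qed
    moreover have "(LINT y|lborel. indicator (ball 0 R) y * W y) \<ge> 0" using W0 by (intro integral_nonneg_AE) auto
    ultimately show ?case by blast
  next
    case (Suc k)
    define a where "a = real (Suc k) / 2"
    have "Suc k + 2 \<le> 2 * DIM('a)" using Suc.prems DIM_positive[where 'a='a] by linarith
    then have "real (Suc k + 2) \<le> real (2 * DIM('a))" by (rule of_nat_mono)
    then have "real (Suc k) \<le> 2 * (n - 1)" unfolding n by simp
    then have a: "1/2 \<le> a" "a \<le> n - 1/2" "a - 1/2 = real k / 2" by (auto simp: a_def field_simps)
    obtain C1 where C1: "C1 \<ge> 0" "AE x in lborel. x \<in> ball 0 R \<longrightarrow>
      ennreal (W x) \<le> ennreal C1 * (\<integral>\<^sup>+y. ennreal (indicator (ball 0 (R+2)) y * (norm (x - y) powr (-(n-1)) * W y)) \<partial>lborel)"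
      using H[of R] by (elim exE conjE)
    obtain C2 where C2: "C2 \<ge> 0" "\<And>x z :: 'a. x \<noteq> z \<Longrightarrow>
      (\<integral>\<^sup>+y. ennreal (indicator (ball 0 R) y * (norm (x - y) powr (-a) * norm (y - z) powr (-(n-1)))) \<partial>lborel)
        \<le> ennreal (C2 * norm (x - z) powr (-(a - 1/2)))"
      by (rule kernel_composition[OF n a(1,2), of R], rule that, assumption, assumption)
    obtain C3 where C3: "C3 \<ge> 0" "\<And>x. (\<integral>\<^sup>+y. ennreal (indicator (ball 0 (R+2)) y * (norm (x - y) powr (-(real k / 2)) * W y)) \<partial>lborel) \<le> ennreal C3"
    proof -
      have "k \<le> 2 * (DIM('a) - 1)" using Suc.prems by simp
      from Suc.IH[OF this, of "R+2"] show ?thesis using that by (elim exE conjE) (rule that, assumption, erule spec)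
    qed
    have "(\<integral>\<^sup>+y. ennreal (indicator (ball 0 R) y * (norm (x - y) powr (-a) * W y)) \<partial>lborel) \<le> ennreal (C1 * (C2 * C3))" for x
    proof -
      let ?k = "\<lambda>y z. ennreal (indicator (ball 0 R) y * norm (x - y) powr (-a)) * ennreal (indicator (ball 0 (R+2)) z * (norm (y - z) powr (-(n-1)) * W z))"
      have "(\<integral>\<^sup>+y. ennreal (indicator (ball 0 R) y * (norm (x - y) powr (-a) * W y)) \<partial>lborel)
        \<le> (\<integral>\<^sup>+y. ennreal C1 * (\<integral>\<^sup>+z. ?k y z \<partial>lborel) \<partial>lborel)"
      proof (rule nn_integral_mono_AE)
        show "AE y in lborel. ennreal (indicator (ball 0 R) y * (norm (x - y) powr (-a) * W y)) \<le> ennreal C1 * (\<integral>\<^sup>+z. ?k y z \<partial>lborel)"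
          using C1(2)
        proof eventually_elim
          case (elim y)
          show ?case
          proof (cases "y \<in> ball 0 R")
            case True
            have "ennreal (indicator (ball 0 R) y * (norm (x - y) powr (-a) * W y)) = ennreal (indicator (ball 0 R) y * norm (x - y) powr (-a)) * ennreal (W y)"
              by (subst ennreal_mult'[symmetric]) (auto simp: mult.assoc)
            also have "\<dots> \<le> ennreal (indicator (ball 0 R) y * norm (x - y) powr (-a)) *
                (ennreal C1 * (\<integral>\<^sup>+z. ennreal (indicator (ball 0 (R+2)) z * (norm (y - z) powr (-(n-1)) * W z)) \<partial>lborel))"
              using elim True by (intro mult_left_mono) auto
            also have "\<dots> = ennreal C1 * (\<integral>\<^sup>+z. ?k y z \<partial>lborel)"
              by (subst nn_integral_cmult) (auto simp: mult_ac)
            finally show ?thesis .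
          qed simp
        qed
      qed
      also have "\<dots> = ennreal C1 * (\<integral>\<^sup>+y. (\<integral>\<^sup>+z. ?k y z \<partial>lborel) \<partial>lborel)"
        by (intro nn_integral_cmult) measurable
      also have "(\<integral>\<^sup>+y. (\<integral>\<^sup>+z. ?k y z \<partial>lborel) \<partial>lborel) = (\<integral>\<^sup>+z. (\<integral>\<^sup>+y. ?k y z \<partial>lborel) \<partial>lborel)"
        by (rule lborel_pair.Fubini') measurable
      also have "\<dots> \<le> (\<integral>\<^sup>+z. ennreal C2 * ennreal (indicator (ball 0 (R+2)) z * (norm (x - z) powr (-(real k / 2)) * W z)) \<partial>lborel)"
      proof (rule nn_integral_mono_AE)
        \<comment> \<open>After the exchange of integrals the two kernels compose. The composition
          bound is restricted to z different from x, which excludes a null set only.\<close>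
        show "AE z in lborel. (\<integral>\<^sup>+y. ?k y z \<partial>lborel) \<le> ennreal C2 * ennreal (indicator (ball 0 (R+2)) z * (norm (x - z) powr (-(real k / 2)) * W z))"
          using AE_lborel_singleton[of x]
        proof eventually_elim
          case (elim z)
          have "(\<integral>\<^sup>+y. ?k y z \<partial>lborel) = (\<integral>\<^sup>+y. ennreal (indicator (ball 0 (R+2)) z * W z) *
              ennreal (indicator (ball 0 R) y * (norm (x - y) powr (-a) * norm (y - z) powr (-(n-1)))) \<partial>lborel)"
            by (intro nn_integral_cong) (simp add: W0 mult_ac flip: ennreal_mult')
          also have "\<dots> = ennreal (indicator (ball 0 (R+2)) z * W z) * (\<integral>\<^sup>+y. 
              ennreal (indicator (ball 0 R) y * (norm (x - y) powr (-a) * norm (y - z) powr (-(n-1)))) \<partial>lborel)"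
            by (rule nn_integral_cmult) measurable
          also have "\<dots> \<le> ennreal (indicator (ball 0 (R+2)) z * W z) * ennreal (C2 * norm (x - z) powr (-(a - 1/2)))"
            using elim by (intro mult_left_mono C2(2)) auto
          also have "\<dots> = ennreal C2 * ennreal (indicator (ball 0 (R+2)) z * (norm (x - z) powr (-(real k / 2)) * W z))"
            unfolding a(3) using C2(1) by (simp add: W0 mult_ac flip: ennreal_mult')
          finally show ?case .
        qed
      qed
      also have "\<dots> = ennreal C2 * (\<integral>\<^sup>+z. ennreal (indicator (ball 0 (R+2)) z * (norm (x - z) powr (-(real k / 2)) * W z)) \<partial>lborel)"
        by (rule nn_integral_cmult) measurable
      also have "\<dots> \<le> ennreal C2 * ennreal C3" by (intro mult_left_mono C3(2)) auto
      finally have "(\<integral>\<^sup>+y. ennreal (indicator (ball 0 R) y * (norm (x - y) powr (-a) * W y)) \<partial>lborel) \<le> ennreal C1 * (ennreal C2 * ennreal C3)"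
        by (simp add: mult_left_mono)
      then show ?thesis using C1(1) C2(1) C3(1) by (simp add: ennreal_mult')
    qed
    moreover have "0 \<le> C1 * (C2 * C3)" using C1(1) C2(1) C3(1) by simp
    ultimately show ?case unfolding a_def by (intro exI[of _ "C1 * (C2 * C3)"] conjI allI)
  qed
  obtain C1 where C1: "C1 \<ge> 0" "AE x in lborel. x \<in> ball 0 R \<longrightarrow>
      ennreal (W x) \<le> ennreal C1 * (\<integral>\<^sup>+y. ennreal (indicator (ball 0 (R+2)) y * (norm (x - y) powr (-(n-1)) * W y)) \<partial>lborel)"
    using H[of R] by (elim exE conjE)
  have e: "real (2 * (DIM('a) - 1)) / 2 = n - 1" using DIM_positive[where 'a='a] unfolding n by (simp add: of_nat_diff Suc_leI)
  obtain C2 where C2: "C2 \<ge> 0" "\<And>x. (\<integral>\<^sup>+y. ennreal (indicator (ball 0 (R+2)) y * (norm (x - y) powr (-(n-1)) * W y)) \<partial>lborel) \<le> ennreal C2"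
    using P[OF order_refl, of "R+2"] unfolding e by (elim exE conjE) (rule that, assumption, erule spec)
  have "AE x in lborel. x \<in> ball 0 R \<longrightarrow> W x \<le> C1 * C2"
    using C1(2)
  proof eventually_elim
    case (elim x)
    show ?case
    proof
      assume "x \<in> ball 0 R"
      then have "ennreal (W x) \<le> ennreal C1 * ennreal C2"
        using elim order_trans[OF _ mult_left_mono[OF C2(2)[of x], of "ennreal C1"]] by simp
      then show "W x \<le> C1 * C2" using C1(1) C2(1) by (simp flip: ennreal_mult')
    qed
  qed
  then show ?thesis by blast
qed

section \<open>Poisson equations with compact support and the regularised Newton kernel\<close>

lemma pd_reflect:
  fixes u :: "'a::euclidean_space \<Rightarrow> real"
  assumes "u differentiable (at (x - y))"
  shows "partial_deriv b (\<lambda>y. u (x - y)) y = - partial_deriv b u (x - y)"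
    and "(\<lambda>y. u (x - y)) differentiable (at y)"
proof -
  have D: "((\<lambda>y. u (x - y)) has_derivative (\<lambda>h. partial_deriv (- h) u (x - y))) (at y)"
    by (rule has_derivative_compose[where f="\<lambda>y. x - y" and f'="\<lambda>h. - h", OF _ has_derivative_frechet[OF assms]])
      (auto intro!: derivative_eq_intros)
  then show "(\<lambda>y. u (x - y)) differentiable (at y)" by (auto simp: differentiable_def)
  have "partial_deriv (- b) u (x - y) = - partial_deriv b u (x - y)"
    using linear_neg[OF has_derivative_linear[OF has_derivative_frechet[OF assms]]] .
  with partial_deriv_eq[OF D] show "partial_deriv b (\<lambda>y. u (x - y)) y = - partial_deriv b u (x - y)" by simp
qed

lemma smooth_reflect:
  assumes "smooth u"
  shows "smooth (\<lambda>y. u (x - y))"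
proof -
  have "Ck k u \<Longrightarrow> Ck k (\<lambda>y. u (x - y))" for k
  proof (induction k arbitrary: u)
    case 0
    then show ?case by (auto intro!: continuous_on_compose2[of UNIV u] continuous_intros)
  next
    case (Suc k)
    then have "partial_deriv b (\<lambda>y. u (x - y)) = (\<lambda>y. (-1) * partial_deriv b u (x - y))" for b
      by (auto simp: pd_reflect)
    moreover have "Ck k (\<lambda>y. (-1) * partial_deriv b u (x - y))" if "b \<in> Basis" for b
      using Suc that by (intro Ck_mult Ck_const Suc.IH) auto
    ultimately show ?case using Suc.prems by (simp add: pd_reflect(2))
  qed
  with assms show ?thesis by (simp add: smooth_def)
qed

lemma smooth_lap: "smooth \<zeta> \<Longrightarrow> smooth (\<lambda>x. \<Sum>c\<in>Basis. partial_deriv c (partial_deriv c \<zeta>) x)"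
  by (intro smooth_sum smooth_pd)

text \<open>The equation Laplacian u = h with weak gradient ub, where all three are supported in one
  ball. Because of the supports, \<zeta> may be any smooth function, so kernels without compact
  support can be inserted directly.\<close>

locale compact_poisson =
  fixes u h :: "'a::euclidean_space \<Rightarrow> real" and ub :: "'a \<Rightarrow> 'a \<Rightarrow> real" and R :: real
  assumes li: "loc_int u" "loc_int h" "\<And>b. b \<in> Basis \<Longrightarrow> loc_int (ub b)"
    and out: "\<And>x. norm x \<ge> R \<Longrightarrow> u x = 0" "\<And>x. norm x \<ge> R \<Longrightarrow> h x = 0" "\<And>b x. b \<in> Basis \<Longrightarrow> norm x \<ge> R \<Longrightarrow> ub b x = 0"
    and weak: "\<And>\<zeta> b. smooth \<zeta> \<Longrightarrow> b \<in> Basis \<Longrightarrow>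
      (LINT x|lborel. partial_deriv b \<zeta> x * u x) = - (LINT x|lborel. \<zeta> x * ub b x)"
    and eqn: "\<And>\<zeta>. smooth \<zeta> \<Longrightarrow>
      (\<Sum>b\<in>Basis. LINT x|lborel. partial_deriv b \<zeta> x * ub b x) = - (LINT x|lborel. \<zeta> x * h x)"
begin

lemma integrable_smooth_mult:
  "smooth \<zeta> \<Longrightarrow> integrable lborel (\<lambda>x. \<zeta> x * u x)"
  "smooth \<zeta> \<Longrightarrow> integrable lborel (\<lambda>x. \<zeta> x * h x)"
  "smooth \<zeta> \<Longrightarrow> b \<in> Basis \<Longrightarrow> integrable lborel (\<lambda>x. \<zeta> x * ub b x)"
  by (rule loc_int_integrable[where R=R]; simp add: out loc_int_mult_cont li smooth_cont)+

lemma lap_u: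
  assumes "smooth \<zeta>"
  shows "(LINT x|lborel. (\<Sum>c\<in>Basis. partial_deriv c (partial_deriv c \<zeta>) x) * u x) = (LINT x|lborel. \<zeta> x * h x)"
proof -
  have "(LINT x|lborel. (\<Sum>c\<in>Basis. partial_deriv c (partial_deriv c \<zeta>) x) * u x) =
    (\<Sum>c\<in>Basis. LINT x|lborel. partial_deriv c (partial_deriv c \<zeta>) x * u x)"
    unfolding sum_distrib_right
    by (intro Bochner_Integration.integral_sum integrable_smooth_mult smooth_pd assms)
  also have "\<dots> = (\<Sum>c\<in>Basis. - (LINT x|lborel. partial_deriv c \<zeta> x * ub c x))"
    by (intro sum.cong refl weak smooth_pd assms)
  also have "\<dots> = (LINT x|lborel. \<zeta> x * h x)" using eqn[OF assms] by (simp add: sum_negf)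
  finally show ?thesis .
qed

text \<open>Testing the weak gradient with the Laplacian of \<zeta> produces a derivative of that
  Laplacian, which has to be rewritten as the Laplacian of a derivative. The commutation is a
  hypothesis and is verified by computation for the kernel that is inserted.\<close>

lemma lap_ub:
  assumes s: "smooth \<zeta>" and b: "b \<in> Basis"
    and comm: "\<And>x. (\<Sum>c\<in>Basis. partial_deriv c (partial_deriv c (partial_deriv b \<zeta>)) x) =
      partial_deriv b (\<lambda>x. \<Sum>c\<in>Basis. partial_deriv c (partial_deriv c \<zeta>) x) x"
  shows "(LINT x|lborel. (\<Sum>c\<in>Basis. partial_deriv c (partial_deriv c \<zeta>) x) * ub b x) = - (LINT x|lborel. partial_deriv b \<zeta> x * h x)"
  using weak[OF smooth_lap[OF s] b] lap_u[OF smooth_pd[OF s b]] by (simp add: comm)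

end

section \<open>The regularised Newton kernel and its derivatives\<close>

lemma coisometry_id: "coisometry (\<lambda>x::'a::euclidean_space. x) 1"
proof (rule coisometry.intro)
  show "bounded_linear (\<lambda>x::'a. x)" by (rule bounded_linear_ident)
  show "(\<Sum>b\<in>Basis. (y \<bullet> b)\<^sup>2) = 1 * (norm y)\<^sup>2" for y :: 'a
    unfolding power2_norm_eq_inner by (subst euclidean_inner[of y y]) (simp add: power2_eq_square)
qed simp

abbreviation "rg \<equiv> reg (\<lambda>x::'a::euclidean_space. x)"

definition newton :: "real \<Rightarrow> 'a::euclidean_space \<Rightarrow> real" where
  "newton d x = rg d x powr ((2 - real DIM('a)) / 2)"

definition newton_grad :: "real \<Rightarrow> 'a::euclidean_space \<Rightarrow> 'a \<Rightarrow> real" where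
  "newton_grad d b x = (2 - real DIM('a)) * ((x \<bullet> b) * rg d x powr (- real DIM('a) / 2))"

text \<open>The Laplacian of \<open>newton d\<close>. Its integral does not change with d and its
  mass concentrates at the origin, so up to a constant it is an approximate identity.\<close>

definition newton_lap :: "real \<Rightarrow> 'a::euclidean_space \<Rightarrow> real" where
  "newton_lap d x = (2 - real DIM('a)) * real DIM('a) * d\<^sup>2 * rg d x powr (- real DIM('a) / 2 - 1)"

lemma smooth_newton: "d > 0 \<Longrightarrow> smooth (newton d)" "d > 0 \<Longrightarrow> smooth (newton_grad d b)" "d > 0 \<Longrightarrow> smooth (newton_lap d)"
  unfolding newton_def[abs_def] newton_grad_def[abs_def] newton_lap_def[abs_def]
  by (intro smooth_mult smooth_const coisometry.smooth_reg_powr[OF coisometry_id] coisometry.smooth_inner[OF coisometry_id]; assumption)+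

lemma pd_newton: "d > 0 \<Longrightarrow> partial_deriv b (newton d) = newton_grad d b"
  unfolding newton_def[abs_def] newton_grad_def[abs_def]
  by (rule ext, subst coisometry.pd_reg_powr[OF coisometry_id]) (auto simp: diff_divide_distrib)

lemma rg_powr_step: "d > 0 \<Longrightarrow> rg d x powr (s - 1) * ((norm x)\<^sup>2 + d\<^sup>2) = rg d x powr s"
  using reg_pos[of d "\<lambda>x. x" x] by (simp add: powr_diff reg_def)

text \<open>Writing reg^(-n/2) as reg^(-n/2-1) (|x|^2 + d^2), the |x|^2 terms of the divergence
  cancel and only the d^2 term survives; this reflects the harmonicity of |x|^(2-n) away from
  0.\<close>

lemma lap_newton:
  fixes x :: "'a::euclidean_space"
  assumes d: "d > 0"
  shows "(\<Sum>c\<in>Basis. partial_deriv c (newton_grad d c) x) = newton_lap d x"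
proof -
  have s: "smooth (\<lambda>x. (x \<bullet> b) * rg d x powr (- real DIM('a) / 2))" for b :: 'a
    by (intro smooth_mult coisometry.smooth_reg_powr[OF coisometry_id] coisometry.smooth_inner[OF coisometry_id] d)
  have "(\<Sum>c\<in>Basis. partial_deriv c (newton_grad d c) x) =
    (2 - real DIM('a)) * (\<Sum>c\<in>Basis. partial_deriv c (\<lambda>x. (x \<bullet> c) * rg d x powr (- real DIM('a) / 2)) x)"
    unfolding newton_grad_def[abs_def] by (simp only: partial_deriv_cmult[OF smooth_differentiable[OF s]] sum_distrib_left)
  also have "(\<Sum>c\<in>Basis. partial_deriv c (\<lambda>x. (x \<bullet> c) * rg d x powr (- real DIM('a) / 2)) x) =
     real DIM('a) * rg d x powr (- real DIM('a) / 2) - real DIM('a) * rg d x powr (- real DIM('a) / 2 - 1) * (norm x)\<^sup>2"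
    by (subst coisometry.div_field[OF coisometry_id d]) simp
  also have "rg d x powr (- real DIM('a) / 2) = rg d x powr (- real DIM('a) / 2 - 1) * ((norm x)\<^sup>2 + d\<^sup>2)"
    by (rule rg_powr_step[OF d, symmetric])
  finally show ?thesis by (simp add: newton_lap_def algebra_simps)
qed

text \<open>The explicit verification of the commutation demanded by \<open>lap_ub\<close>, for the
  kernel \<open>newton d\<close>.\<close>

lemma lap_newton_grad:
  fixes x :: "'a::euclidean_space"
  assumes d: "d > 0"
  shows "(\<Sum>c\<in>Basis. partial_deriv c (partial_deriv c (newton_grad d b)) x) = partial_deriv b (newton_lap d) x"
proof -
  let ?r = "\<lambda>s x. rg d x powr s"
  have sr: "smooth (?r s :: 'a \<Rightarrow> real)" for s by (rule coisometry.smooth_reg_powr[OF coisometry_id d])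
  have si: "smooth (\<lambda>x::'a. x \<bullet> b)" for b by (rule coisometry.smooth_inner[OF coisometry_id])
  have sf: "smooth (\<lambda>x. (x \<bullet> c) * ?r s x)" for c :: 'a and s by (intro smooth_mult si sr)
  have pi: "partial_deriv c (\<lambda>x::'a. x \<bullet> b) x = c \<bullet> b" for c b x by (rule coisometry.pd_inner[OF coisometry_id])
  have pr: "partial_deriv c (?r s) x = 2 * s * ?r (s - 1) x * (x \<bullet> c)" for c x :: 'a and s by (rule coisometry.pd_reg_powr[OF coisometry_id d])
  have p1: "partial_deriv c (newton_grad d b) = (\<lambda>x. (2 - real DIM('a)) * ((c \<bullet> b) * ?r (- real DIM('a) / 2) x + (- real DIM('a)) * ((x \<bullet> b) * ((x \<bullet> c) * ?r (- real DIM('a) / 2 - 1) x))))" for c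
  proof
    fix x
    have "partial_deriv c (newton_grad d b) x = (2 - real DIM('a)) * partial_deriv c (\<lambda>x. (x \<bullet> b) * ?r (- real DIM('a) / 2) x) x"
      unfolding newton_grad_def[abs_def] by (rule partial_deriv_cmult[OF smooth_differentiable[OF sf]])
    also have "partial_deriv c (\<lambda>x. (x \<bullet> b) * ?r (- real DIM('a) / 2) x) x = (c \<bullet> b) * ?r (- real DIM('a) / 2) x + (x \<bullet> b) * (2 * (- real DIM('a) / 2) * ?r (- real DIM('a) / 2 - 1) x * (x \<bullet> c))"
      by (subst partial_deriv_mult[OF smooth_differentiable[OF si] smooth_differentiable[OF sr]]) (simp only: pi pr)
    finally show "partial_deriv c (newton_grad d b) x = (2 - real DIM('a)) * ((c \<bullet> b) * ?r (- real DIM('a) / 2) x + (- real DIM('a)) * ((x \<bullet> b) * ((x \<bullet> c) * ?r (- real DIM('a) / 2 - 1) x)))"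
      by (simp add: algebra_simps)
  qed
  have p2: "partial_deriv c (partial_deriv c (newton_grad d b)) x =
    (2 - real DIM('a)) * (- real DIM('a)) * (2 * ((c \<bullet> b) * (x \<bullet> c)) * ?r (- real DIM('a) / 2 - 1) x + (x \<bullet> b) * partial_deriv c (\<lambda>x. (x \<bullet> c) * ?r (- real DIM('a) / 2 - 1) x) x)" for c
  proof -
    have "partial_deriv c (partial_deriv c (newton_grad d b)) x =
      (2 - real DIM('a)) * (partial_deriv c (\<lambda>x. (c \<bullet> b) * ?r (- real DIM('a) / 2) x) x + partial_deriv c (\<lambda>x. (- real DIM('a)) * ((x \<bullet> b) * ((x \<bullet> c) * ?r (- real DIM('a) / 2 - 1) x))) x)"
      unfolding p1
      by (subst partial_deriv_cmult[OF smooth_differentiable], intro smooth_add smooth_mult smooth_const si sr,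
          subst partial_deriv_add[OF smooth_differentiable smooth_differentiable]) (intro smooth_mult smooth_const si sr refl)+
    also have "partial_deriv c (\<lambda>x. (c \<bullet> b) * ?r (- real DIM('a) / 2) x) x = (c \<bullet> b) * (2 * (- real DIM('a) / 2) * ?r (- real DIM('a) / 2 - 1) x * (x \<bullet> c))"
      by (subst partial_deriv_cmult[OF smooth_differentiable[OF sr]]) (simp only: pr)
    also have "partial_deriv c (\<lambda>x. (- real DIM('a)) * ((x \<bullet> b) * ((x \<bullet> c) * ?r (- real DIM('a) / 2 - 1) x))) x =
       (- real DIM('a)) * ((c \<bullet> b) * ((x \<bullet> c) * ?r (- real DIM('a) / 2 - 1) x) + (x \<bullet> b) * partial_deriv c (\<lambda>x. (x \<bullet> c) * ?r (- real DIM('a) / 2 - 1) x) x)"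
      by (subst partial_deriv_cmult[OF smooth_differentiable[OF smooth_mult[OF si sf]]], subst partial_deriv_mult[OF smooth_differentiable[OF si] smooth_differentiable[OF sf]]) (simp only: pi)
    finally show ?thesis by (simp add: algebra_simps)
  qed
  have e: "(\<Sum>c\<in>Basis. (c \<bullet> b) * (x \<bullet> c)) = x \<bullet> b"
    unfolding euclidean_inner[of x b] by (simp add: inner_commute mult.commute)
  have "(\<Sum>c\<in>Basis. partial_deriv c (partial_deriv c (newton_grad d b)) x) =
    (2 - real DIM('a)) * (- real DIM('a)) * (2 * (\<Sum>c\<in>Basis. (c \<bullet> b) * (x \<bullet> c)) * ?r (- real DIM('a) / 2 - 1) x +
       (x \<bullet> b) * (\<Sum>c\<in>Basis. partial_deriv c (\<lambda>x. (x \<bullet> c) * ?r (- real DIM('a) / 2 - 1) x) x))"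
    unfolding p2 by (simp only: sum_distrib_left sum_distrib_right sum.distrib distrib_left)
  also have "\<dots> = (2 - real DIM('a)) * (- real DIM('a)) * (x \<bullet> b) * ((real DIM('a) + 2) * ?r (- real DIM('a) / 2 - 1) x - (real DIM('a) + 2) * ?r (- real DIM('a) / 2 - 1 - 1) x * (norm x)\<^sup>2)"
    unfolding e by (subst coisometry.div_field[OF coisometry_id d]) (simp add: algebra_simps)
  also have "?r (- real DIM('a) / 2 - 1) x = ?r (- real DIM('a) / 2 - 1 - 1) x * ((norm x)\<^sup>2 + d\<^sup>2)"
    by (rule rg_powr_step[OF d, symmetric])
  also have "(2 - real DIM('a)) * (- real DIM('a)) * (x \<bullet> b) * ((real DIM('a) + 2) * (?r (- real DIM('a) / 2 - 1 - 1) x * ((norm x)\<^sup>2 + d\<^sup>2)) - (real DIM('a) + 2) * ?r (- real DIM('a) / 2 - 1 - 1) x * (norm x)\<^sup>2)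
     = (2 - real DIM('a)) * real DIM('a) * d\<^sup>2 * (2 * (- real DIM('a) / 2 - 1) * ?r (- real DIM('a) / 2 - 1 - 1) x * (x \<bullet> b))"
    by (simp add: algebra_simps)
  also have "\<dots> = partial_deriv b (newton_lap d) x"
    unfolding newton_lap_def[abs_def] by (subst partial_deriv_cmult[OF smooth_differentiable[OF sr]]) (simp only: pr)
  finally show ?thesis .
qed

lemma newton_reflect:
  fixes x :: "'a::euclidean_space"
  assumes d: "d > 0"
  shows "smooth (\<lambda>y. newton d (x - y))"
    "partial_deriv b (\<lambda>y. newton d (x - y)) = (\<lambda>y. - newton_grad d b (x - y))"
    "(\<Sum>c\<in>Basis. partial_deriv c (partial_deriv c (\<lambda>y. newton d (x - y))) y) = newton_lap d (x - y)"
    "(\<Sum>c\<in>Basis. partial_deriv c (partial_deriv c (partial_deriv b (\<lambda>y. newton d (x - y)))) y) =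
      partial_deriv b (\<lambda>y. \<Sum>c\<in>Basis. partial_deriv c (partial_deriv c (\<lambda>y. newton d (x - y))) y) y"
proof -
  show "smooth (\<lambda>y. newton d (x - y))" by (rule smooth_reflect[OF smooth_newton(1)[OF d]])
  have r: "partial_deriv b (\<lambda>y. u (x - y)) = (\<lambda>y. - partial_deriv b u (x - y))"
    "partial_deriv b (\<lambda>y. - u (x - y)) = (\<lambda>y. partial_deriv b u (x - y))" if "smooth u" for u b
  proof -
    show *: "partial_deriv b (\<lambda>y. u (x - y)) = (\<lambda>y. - partial_deriv b u (x - y))"
      by (rule ext) (rule pd_reflect(1)[OF smooth_differentiable[OF that]])
    have "partial_deriv b (\<lambda>y. (- 1) * u (x - y)) y = (- 1) * partial_deriv b (\<lambda>y. u (x - y)) y" for y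
      by (rule partial_deriv_cmult[OF smooth_differentiable[OF smooth_reflect[OF that]]])
    then show "partial_deriv b (\<lambda>y. - u (x - y)) = (\<lambda>y. partial_deriv b u (x - y))"
      by (intro ext) (simp add: *)
  qed
  show 1: "partial_deriv b (\<lambda>y. newton d (x - y)) = (\<lambda>y. - newton_grad d b (x - y))" for b
    by (simp add: r(1)[OF smooth_newton(1)[OF d]] pd_newton[OF d])
  show 2: "(\<Sum>c\<in>Basis. partial_deriv c (partial_deriv c (\<lambda>y. newton d (x - y))) y) = newton_lap d (x - y)" for y
    by (simp add: 1 r(2)[OF smooth_newton(2)[OF d]] lap_newton[OF d])
  show "(\<Sum>c\<in>Basis. partial_deriv c (partial_deriv c (partial_deriv b (\<lambda>y. newton d (x - y)))) y) =
      partial_deriv b (\<lambda>y. \<Sum>c\<in>Basis. partial_deriv c (partial_deriv c (\<lambda>y. newton d (x - y))) y) y"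
  proof -
    have "partial_deriv c (partial_deriv c (\<lambda>y. - newton_grad d b (x - y))) y = - partial_deriv c (partial_deriv c (newton_grad d b)) (x - y)"
      if "c \<in> Basis" for c
      by (simp add: r(2)[OF smooth_newton(2)[OF d]] r(1)[OF smooth_pd[OF smooth_newton(2)[OF d] that]])
    then show ?thesis
      unfolding 2 unfolding 1 by (simp add: r(1)[OF smooth_newton(3)[OF d]] sum_negf lap_newton_grad[OF d])
  qed
qed

text \<open>Take \<zeta> to be the kernel centred at x. Two integrations by parts move the Laplacian
  between the kernel and u, which yields a mollification of u on one side and a regularised
  potential of h on the other.\<close>

lemma mollified_representation:
  fixes u h :: "'a::euclidean_space \<Rightarrow> real"
  assumes "compact_poisson u h ub R" and d: "d > 0"
  shows "(LINT y|lborel. newton_lap d (x - y) * u y) = (LINT y|lborel. newton d (x - y) * h y)"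
    "b \<in> Basis \<Longrightarrow> (LINT y|lborel. newton_lap d (x - y) * ub b y) = (LINT y|lborel. newton_grad d b (x - y) * h y)"
proof -
  interpret compact_poisson u h ub R by fact
  show "(LINT y|lborel. newton_lap d (x - y) * u y) = (LINT y|lborel. newton d (x - y) * h y)"
    using lap_u[OF newton_reflect(1)[OF d]] by (simp add: newton_reflect(3)[OF d])
  assume b: "b \<in> Basis"
  show "(LINT y|lborel. newton_lap d (x - y) * ub b y) = (LINT y|lborel. newton_grad d b (x - y) * h y)"
  proof -
    have "(LINT y|lborel. newton_lap d (x - y) * ub b y) = - (LINT y|lborel. partial_deriv b (\<lambda>y. newton d (x - y)) y * h y)"
      using lap_ub[OF newton_reflect(1)[OF d] b newton_reflect(4)[OF d], of x]
      by (simp only: newton_reflect(3)[OF d])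
    then show ?thesis by (simp add: newton_reflect(2)[OF d])
  qed
qed

section \<open>Potentials of integrable densities\<close>

text \<open>Dyadic shells at infinity: where 2^k \<le> |z| < 2^(k+1) the integrand is at most 2^(-2
  s k), and the volume is at most a constant times 2^(n k). The ratio q = 2^(n - 2 s) is below
  1.\<close>

lemma reg_integrable:
  fixes s :: real
  assumes s: "s > real DIM('a::euclidean_space) / 2"
  shows "integrable lborel (\<lambda>z::'a. rg 1 z powr (- s))"
proof -
  let ?n = "real DIM('a)"
  define v where "v = unit_ball_vol ?n"
  define q where "q = 2 powr (?n - 2 * s)"
  have v: "v \<ge> 0" by (simp add: v_def)
  have q: "0 < q" "q < 1" using s unfolding q_def powr_def by (auto simp: mult_less_0_iff)
  have s0: "s > 0" using s DIM_positive[where 'a='a] by (smt (verit) divide_nonneg_nonneg of_nat_0_le_iff)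
  define f where "f k z = ennreal (2 powr (- (2 * s * real k)) * indicator (ball 0 (2 ^ Suc k)) z)" for k and z :: 'a
  have [measurable]: "f k \<in> borel_measurable borel" for k unfolding f_def[abs_def] by measurable
  have [measurable]: "(\<lambda>z::'a. rg 1 z powr (- s)) \<in> borel_measurable borel"
    unfolding reg_def by measurable
  have "(\<integral>\<^sup>+z. ennreal (rg 1 z powr (- s)) \<partial>(lborel :: 'a measure)) \<le> (\<integral>\<^sup>+z. (\<Sum>k. f k z) \<partial>lborel)"
  proof (rule nn_integral_mono)
    fix z :: 'a
    have "\<exists>k. ennreal (rg 1 z powr (- s)) \<le> f k z"
    proof (cases "norm z < 2")
      case True
      have "rg 1 z powr (- s) \<le> 1"
        using powr_mono2'[of "-s" 1 "rg 1 z"] s0 by (simp add: reg_def)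
      then show ?thesis using True by (intro exI[of _ 0]) (simp add: f_def)
    next
      case False
      obtain m where m: "norm z < 2 ^ m" using real_arch_pow[of 2 "norm z"] by auto
      define l where "l = (LEAST m. norm z < 2 ^ m)"
      have l: "norm z < 2 ^ l" unfolding l_def by (rule LeastI[where P="\<lambda>m. norm z < 2 ^ m", OF m])
      have "l \<noteq> 0"
      proof
        assume "l = 0" with l False show False by simp
      qed
      then obtain k where k: "l = Suc k" by (cases l) auto
      have k2: "2 ^ k \<le> norm z" using not_less_Least[of k "\<lambda>m. norm z < 2 ^ m"] k by (auto simp: l_def)
      have "(2 ^ k)\<^sup>2 \<le> (norm z)\<^sup>2" by (rule power_mono[OF k2]) simp
      then have "(2 ^ k)\<^sup>2 \<le> rg 1 z" unfolding reg_def power_one by linarith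
      then have "rg 1 z powr (- s) \<le> ((2 ^ k)\<^sup>2) powr (- s)" using s0 by (intro powr_mono2') auto
      also have "((2 ^ k)\<^sup>2) powr (- s) = (2 powr (2 * real k)) powr (- s)"
      proof -
        have "(2 ^ k)\<^sup>2 = (2::real) ^ (k * 2)" by (simp only: power_mult[symmetric])
        also have "\<dots> = 2 powr (real (k * 2))" by (rule powr_realpow[symmetric]) simp
        finally show ?thesis by (simp add: mult.commute)
      qed
      also have "\<dots> = 2 powr (- (2 * s * real k))" by (simp add: powr_powr mult_ac)
      finally show ?thesis using l unfolding k by (intro exI[of _ k]) (simp add: f_def)
    qed
    then obtain k where "ennreal (rg 1 z powr (- s)) \<le> f k z" by blast
    also have "\<dots> \<le> (\<Sum>k. f k z)" using sum_le_suminf[of "\<lambda>k. f k z" "{k}"] by auto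
    finally show "ennreal (rg 1 z powr (- s)) \<le> (\<Sum>k. f k z)" .
  qed
  also have "\<dots> = (\<Sum>k. \<integral>\<^sup>+z. f k z \<partial>lborel)" by (rule nn_integral_suminf) simp
  also have "\<dots> = (\<Sum>k. ennreal (2 powr ?n * v * q ^ k))"
  proof (rule arg_cong[where f=suminf], rule ext)
    fix k
    have "(\<integral>\<^sup>+z. f k z \<partial>lborel) = ennreal (2 powr (- (2 * s * real k))) * emeasure lborel (ball (0::'a) (2 ^ Suc k))"
      unfolding f_def by (subst ennreal_mult') (auto simp: nn_integral_cmult ennreal_indicator)
    also have "\<dots> = ennreal (2 powr (- (2 * s * real k)) * (v * (2 ^ Suc k) ^ DIM('a)))"
      using v by (subst emeasure_ball) (auto simp: v_def ennreal_mult'' simp del: power_Suc)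
    also have "2 powr (- (2 * s * real k)) * (v * (2 ^ Suc k) ^ DIM('a)) = 2 powr ?n * v * q ^ k"
    proof -
      have "(2 ^ Suc k) ^ DIM('a) = (2::real) powr ?n * 2 powr (real k * ?n)"
      proof -
        have "(2 ^ Suc k) ^ DIM('a) = (2::real) ^ (DIM('a) + k * DIM('a))" by (simp only: power_mult[symmetric] mult_Suc)
        also have "\<dots> = 2 powr (real (DIM('a) + k * DIM('a)))" by (rule powr_realpow[symmetric]) simp
        finally show ?thesis by (simp add: powr_add)
      qed
      moreover have "q ^ k = 2 powr (real k * (?n - 2 * s))"
        using q(1) unfolding q_def by (simp add: powr_powr mult.commute flip: powr_realpow)
      moreover have "2 powr (- (2 * s * real k)) * (2::real) powr (real k * ?n) = 2 powr (real k * (?n - 2 * s))"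
        by (simp add: algebra_simps flip: powr_add)
      ultimately show ?thesis by (simp add: mult_ac)
    qed
    finally show "(\<integral>\<^sup>+z. f k z \<partial>lborel) = ennreal (2 powr ?n * v * q ^ k)" .
  qed
  also have "\<dots> < \<infinity>"
  proof -
    have "summable (\<lambda>k. 2 powr ?n * v * q ^ k)" using q by (intro summable_mult summable_geometric) auto
    then have "(\<Sum>k. ennreal (2 powr ?n * v * q ^ k)) \<noteq> top"
      using v q by (intro ennreal_suminf_neq_top) auto
    then show ?thesis by (simp add: less_top)
  qed
  finally show ?thesis by (intro integrableI_nonneg) auto
qed

lemma lborel_integral_affine:
  fixes f :: "'a::euclidean_space \<Rightarrow> real"
  assumes [measurable]: "f \<in> borel_measurable borel" and d: "d > 0"
  shows "(LINT x|lborel. f x) = d ^ DIM('a) * (LINT z|lborel. f (y + d *\<^sub>R z))"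
proof -
  have "(LINT x|lborel. f x) = (LINT x|density (distr lborel borel (\<lambda>z. y + d *\<^sub>R z)) (\<lambda>_. ennreal (\<bar>d\<bar> ^ DIM('a))). f x)"
    using lborel_affine[of d y] d by simp
  also have "\<dots> = (LINT x|distr lborel borel (\<lambda>z. y + d *\<^sub>R z). d ^ DIM('a) *\<^sub>R f x)"
    using d by (subst integral_density) auto
  also have "\<dots> = d ^ DIM('a) * (LINT z|lborel. f (y + d *\<^sub>R z))"
    by (subst integral_distr) auto
  finally show ?thesis .
qed

text \<open>By Tonelli: for fixed y the kernel integrated over a ball in x is bounded independently
  of y, so the potential of an integrable density is finite almost everywhere and locally
  integrable.\<close>

lemma potential_majorant:
  fixes h :: "'a::euclidean_space \<Rightarrow> real"
  assumes h: "integrable lborel h" and t: "0 \<le> t" "t < real DIM('a)"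
  shows "AE x in lborel. integrable lborel (\<lambda>y. norm (x - y) powr (-t) * \<bar>h y\<bar>)"
    "loc_int (\<lambda>x. LINT y|lborel. norm (x - y) powr (-t) * \<bar>h y\<bar>)"
proof -
  have [measurable]: "h \<in> borel_measurable borel" using borel_measurable_integrable[OF h] by simp
  let ?I = "\<lambda>x. \<integral>\<^sup>+y. ennreal (norm (x - y) powr (-t) * \<bar>h y\<bar>) \<partial>lborel"
  have fin: "(\<integral>\<^sup>+x. ennreal (indicator (ball 0 R) x) * ?I x \<partial>lborel) < \<infinity>" for R
  proof -
    obtain C where C: "C \<ge> 0" "\<And>y :: 'a. (\<integral>\<^sup>+x. ennreal (indicator (ball 0 R) x * norm (y - x) powr (-t)) \<partial>lborel) \<le> ennreal C"
      by (rule powr_kernel_bound[OF t(2,1), of R], rule that, assumption, assumption)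
    have "(\<integral>\<^sup>+x. ennreal (indicator (ball 0 R) x) * ?I x \<partial>lborel) =
       (\<integral>\<^sup>+x. \<integral>\<^sup>+y. ennreal (indicator (ball 0 R) x) * ennreal (norm (x - y) powr (-t) * \<bar>h y\<bar>) \<partial>lborel \<partial>lborel)"
      by (intro nn_integral_cong nn_integral_cmult[symmetric]) measurable
    also have "\<dots> = (\<integral>\<^sup>+y. \<integral>\<^sup>+x. ennreal (indicator (ball 0 R) x) * ennreal (norm (x - y) powr (-t) * \<bar>h y\<bar>) \<partial>lborel \<partial>lborel)"
      by (rule lborel_pair.Fubini') measurable
    also have "\<dots> = (\<integral>\<^sup>+y. ennreal \<bar>h y\<bar> * (\<integral>\<^sup>+x. ennreal (indicator (ball 0 R) x * norm (y - x) powr (-t)) \<partial>lborel) \<partial>lborel)"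
      by (intro nn_integral_cong, subst nn_integral_cmult[symmetric])
        (measurable, auto intro!: nn_integral_cong simp: norm_minus_commute mult_ac simp flip: ennreal_mult')
    also have "\<dots> \<le> (\<integral>\<^sup>+y. ennreal \<bar>h y\<bar> * ennreal C \<partial>lborel)"
      by (intro nn_integral_mono mult_left_mono C) auto
    also have "\<dots> = (\<integral>\<^sup>+y. ennreal (norm (h y)) \<partial>lborel) * ennreal C" by (subst nn_integral_multc) auto
    also have "\<dots> < \<infinity>" using h by (auto simp: integrable_iff_bounded ennreal_mult_less_top)
    finally show ?thesis .
  qed
  \<comment> \<open>Finiteness is known ball by ball; countably many balls exhaust the
    space.\<close>
  have "AE x in lborel. \<forall>k::nat. ennreal (indicator (ball 0 (real k)) x) * ?I x \<noteq> \<infinity>"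
    unfolding AE_all_countable
  proof
    fix k :: nat
    show "AE x in lborel. ennreal (indicator (ball 0 (real k)) x) * ?I x \<noteq> \<infinity>"
      by (rule nn_integral_PInf_AE) (use fin[of "real k"] in auto)
  qed
  then show "AE x in lborel. integrable lborel (\<lambda>y. norm (x - y) powr (-t) * \<bar>h y\<bar>)"
  proof eventually_elim
    case (elim x)
    obtain k :: nat where "norm x < real k" using reals_Archimedean2 by blast
    then have "?I x \<noteq> \<infinity>" using elim[THEN spec, of k] by simp
    then show ?case by (intro integrableI_nonneg) (auto simp: less_top)
  qed
  show "loc_int (\<lambda>x. LINT y|lborel. norm (x - y) powr (-t) * \<bar>h y\<bar>)"
    unfolding loc_int_def
  proof (intro conjI allI)
    show m: "(\<lambda>x. LINT y|lborel. norm (x - y) powr (-t) * \<bar>h y\<bar>) \<in> borel_measurable borel"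
      using lborel.borel_measurable_lebesgue_integral[of "\<lambda>x y. norm (x - y) powr (-t) * \<bar>h y\<bar>" borel] by simp
    fix R
    \<comment> \<open>Where the integrand is not integrable the Bochner integral is 0 by convention,
      so the inequality holds for every x.\<close>
    have le: "ennreal (LINT y|lborel. norm (x - y) powr (-t) * \<bar>h y\<bar>) \<le> ?I x" for x
    proof (cases "integrable lborel (\<lambda>y. norm (x - y) powr (-t) * \<bar>h y\<bar>)")
      case True
      then show ?thesis by (subst nn_integral_eq_integral) auto
    qed (simp add: not_integrable_integral_eq)
    have "(\<integral>\<^sup>+x. ennreal (indicator (ball 0 R) x * (LINT y|lborel. norm (x - y) powr (-t) * \<bar>h y\<bar>)) \<partial>lborel) \<le>
      (\<integral>\<^sup>+x. ennreal (indicator (ball 0 R) x) * ?I x \<partial>lborel)"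
      using le by (intro nn_integral_mono) (simp add: indicator_def)
    also have "\<dots> < \<infinity>" by (rule fin)
    finally show "integrable lborel (\<lambda>x. indicator (ball 0 R) x * (LINT y|lborel. norm (x - y) powr (-t) * \<bar>h y\<bar>))"
      by (intro integrableI_nonneg) (use m in auto)
  qed
qed

text \<open>Dominated convergence twice: in y for almost every x, with the singular kernel as
  majorant, and then in x against \<eta>, with the potential of |h| as majorant. The diagonal is a
  null set, so nothing is required of the kernels at 0.\<close>

lemma potential_limit:
  fixes h :: "'a::euclidean_space \<Rightarrow> real"
  assumes h: "integrable lborel h" and t: "0 \<le> t" "t < real DIM('a)"
    and [measurable]: "\<And>k. K k \<in> borel_measurable borel" "K' \<in> borel_measurable borel"
    and b: "\<And>k z. z \<noteq> 0 \<Longrightarrow> \<bar>K k z\<bar> \<le> C * norm z powr (-t)"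
    and lim: "\<And>z. z \<noteq> 0 \<Longrightarrow> (\<lambda>k::nat. K k z) \<longlonglongrightarrow> K' z"
    and \<eta>: "test_function \<eta>"
  shows "(\<lambda>k. LINT x|lborel. \<eta> x * (LINT y|lborel. K k (x - y) * h y)) \<longlonglongrightarrow>
      (LINT x|lborel. \<eta> x * (LINT y|lborel. K' (x - y) * h y))"
    "loc_int (\<lambda>x. LINT y|lborel. K' (x - y) * h y)"
proof -
  have [measurable]: "h \<in> borel_measurable borel" using borel_measurable_integrable[OF h] by simp
  define N where "N x = (LINT y|lborel. norm (x - y) powr (-t) * \<bar>h y\<bar>)" for x
  note maj = potential_majorant[OF h t, folded N_def]
  have pw: "(\<lambda>k. LINT y|lborel. K k (x - y) * h y) \<longlonglongrightarrow> (LINT y|lborel. K' (x - y) * h y)"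
    "\<bar>LINT y|lborel. K k (x - y) * h y\<bar> \<le> C * N x" 
    if i: "integrable lborel (\<lambda>y. norm (x - y) powr (-t) * \<bar>h y\<bar>)" for x k
  proof -
    have iC: "integrable lborel (\<lambda>y. C * (norm (x - y) powr (-t) * \<bar>h y\<bar>))" using i by simp
    have bb: "AE y in lborel. norm (K k (x - y) * h y) \<le> C * (norm (x - y) powr (-t) * \<bar>h y\<bar>)" for k
      using AE_lborel_singleton[of x]
    proof eventually_elim
      case (elim y)
      then show ?case using mult_right_mono[OF b[of "x - y" k], of "\<bar>h y\<bar>"] by (simp add: abs_mult mult.assoc)
    qed
    have ll: "AE y in lborel. (\<lambda>k. K k (x - y) * h y) \<longlonglongrightarrow> K' (x - y) * h y"
      using AE_lborel_singleton[of x] by eventually_elim (intro tendsto_mult tendsto_const lim, simp)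
    show "(\<lambda>k. LINT y|lborel. K k (x - y) * h y) \<longlonglongrightarrow> (LINT y|lborel. K' (x - y) * h y)"
      by (rule integral_dominated_convergence[OF _ _ iC ll bb]) measurable
    have ik: "integrable lborel (\<lambda>y. K k (x - y) * h y)"
      by (rule Bochner_Integration.integrable_bound[OF iC]) (use bb[of k] in \<open>auto intro: order_trans\<close>)
    have "\<bar>LINT y|lborel. K k (x - y) * h y\<bar> \<le> (LINT y|lborel. norm (K k (x - y) * h y))"
      using integral_norm_bound[of lborel "\<lambda>y. K k (x - y) * h y"] by simp
    also have "\<dots> \<le> (LINT y|lborel. C * (norm (x - y) powr (-t) * \<bar>h y\<bar>))"
      by (rule integral_mono_AE[OF integrable_norm[OF ik] iC bb])
    finally show "\<bar>LINT y|lborel. K k (x - y) * h y\<bar> \<le> C * N x" by (simp add: N_def)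
  qed
  have mK: "(\<lambda>x. LINT y|lborel. K k (x - y) * h y) \<in> borel_measurable borel" "(\<lambda>x. LINT y|lborel. K' (x - y) * h y) \<in> borel_measurable borel" for k
    using lborel.borel_measurable_lebesgue_integral[of "\<lambda>x y. K k (x - y) * h y" borel]
      lborel.borel_measurable_lebesgue_integral[of "\<lambda>x y. K' (x - y) * h y" borel] by simp_all
  obtain R where R: "R > 0" "\<And>x. norm x \<ge> R \<Longrightarrow> \<eta> x = 0" "smooth \<eta>" using \<eta> test_functionE by metis
  obtain D where D: "\<And>x. \<bar>\<eta> x\<bar> \<le> D" "D > 0" using test_bounded[OF \<eta>] by metis
  have [measurable]: "\<eta> \<in> borel_measurable borel" using smooth_cont[OF R(3)] by (rule borel_measurable_continuous_onI)
  note [measurable] = mK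
  show "(\<lambda>k. LINT x|lborel. \<eta> x * (LINT y|lborel. K k (x - y) * h y)) \<longlonglongrightarrow>
      (LINT x|lborel. \<eta> x * (LINT y|lborel. K' (x - y) * h y))"
  proof (rule loc_integral_tendsto(1)[where w="\<lambda>x. C * N x" and C=D and R=R])
    show "loc_int (\<lambda>x. C * N x)" using maj(2) by (intro loc_int_cmult)
    show "AE x in lborel. \<bar>\<eta> x * (LINT y|lborel. K k (x - y) * h y)\<bar> \<le> D * indicator (ball 0 R) x * \<bar>C * N x\<bar>" for k
      using maj(1)
    proof eventually_elim
      case (elim x)
      have "\<bar>\<eta> x\<bar> * \<bar>LINT y|lborel. K k (x - y) * h y\<bar> \<le> D * \<bar>C * N x\<bar>"
        using pw(2)[OF elim, of k] D by (intro mult_mono) auto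
      then show ?case using R(2)[of x] by (cases "norm x < R") (auto simp: abs_mult)
    qed
    show "AE x in lborel. (\<lambda>k. \<eta> x * (LINT y|lborel. K k (x - y) * h y)) \<longlonglongrightarrow> \<eta> x * (LINT y|lborel. K' (x - y) * h y)"
      using maj(1) by eventually_elim (intro tendsto_mult tendsto_const pw)
  qed measurable
  have bd: "AE x in lborel. \<bar>LINT y|lborel. K' (x - y) * h y\<bar> \<le> C * N x"
    using maj(1)
  proof eventually_elim
    case (elim x)
    show ?case
      by (rule tendsto_upperbound[OF tendsto_rabs[OF pw(1)[OF elim]] always_eventually]) (use pw(2)[OF elim] in auto)
  qed
  show "loc_int (\<lambda>x. LINT y|lborel. K' (x - y) * h y)"
    unfolding loc_int_def
  proof (intro conjI allI)
    show "(\<lambda>x. LINT y|lborel. K' (x - y) * h y) \<in> borel_measurable borel" by (rule mK)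
    fix R
    show "integrable lborel (\<lambda>x. indicator (ball 0 R) x * (LINT y|lborel. K' (x - y) * h y))"
    proof (rule Bochner_Integration.integrable_bound[OF loc_intD[OF loc_int_cmult[OF maj(2)], of R C]])
      show "AE x in lborel. norm (indicator (ball 0 R) x * (LINT y|lborel. K' (x - y) * h y)) \<le> norm (indicator (ball 0 R) x * (C * N x))"
        using bd by eventually_elim (auto simp: indicator_def)
    qed measurable
  qed
qed

section \<open>Representation by the Newton potential\<close>

text \<open>The normalising constant of the fundamental solution: for n \<ge> 3 it is 2 - n times
  the area of the unit sphere. It enters below only as a nonzero factor.\<close>

definition newton_mass :: "'a::euclidean_space itself \<Rightarrow> real" where
  "newton_mass _ = (LINT z|lborel. newton_lap 1 (z::'a))"

definition newton0 :: "'a::euclidean_space \<Rightarrow> real" where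
  "newton0 z = norm z powr (2 - real DIM('a))"

definition newton0_grad :: "'a::euclidean_space \<Rightarrow> 'a \<Rightarrow> real" where
  "newton0_grad b z = (2 - real DIM('a)) * ((z \<bullet> b) * norm z powr (- real DIM('a)))"

lemma measurable_newton [measurable]:
  "newton0 \<in> borel_measurable borel" "newton0_grad b \<in> borel_measurable borel"
  "newton d \<in> borel_measurable borel" "newton_grad d b \<in> borel_measurable borel" "newton_lap d \<in> borel_measurable borel"
  unfolding newton0_def[abs_def] newton0_grad_def[abs_def] newton_def[abs_def] newton_grad_def[abs_def] newton_lap_def[abs_def] reg_def
  by measurable

lemma integrable_newton_lap: "integrable lborel (newton_lap 1 :: 'a::euclidean_space \<Rightarrow> real)"
proof -
  have "integrable lborel (\<lambda>z::'a. rg 1 z powr (- (real DIM('a) / 2 + 1)))" by (rule reg_integrable) simp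
  then have "integrable lborel (\<lambda>z::'a. (2 - real DIM('a)) * real DIM('a) * 1\<^sup>2 * rg 1 z powr (- (real DIM('a) / 2 + 1)))"
    by (rule integrable_mult_right)
  then show ?thesis by (simp add: newton_lap_def[abs_def])
qed

text \<open>In dimension at least 3 the integrand is strictly negative everywhere, so its integral
  cannot vanish.\<close>

lemma newton_mass_nonzero:
  assumes n3: "DIM('a::euclidean_space) \<ge> 3"
  shows "newton_mass TYPE('a) \<noteq> 0"
proof
  assume 0: "newton_mass TYPE('a) = 0"
  have pos: "- newton_lap 1 z > 0" for z :: 'a
    using n3 reg_pos[of 1 "\<lambda>x. x" z] by (simp add: newton_lap_def mult_neg_pos mult_less_0_iff)
  have "(LINT z|lborel. - newton_lap 1 (z::'a)) = 0" using 0 by (simp add: newton_mass_def)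
  moreover have "integrable lborel (\<lambda>z::'a. - newton_lap 1 z)" using integrable_newton_lap by simp
  ultimately have "AE z in lborel. - newton_lap 1 (z::'a) = 0"
    using pos by (subst (asm) integral_nonneg_eq_0_iff_AE) (auto intro: less_imp_le)
  then have "AE z in (lborel :: 'a measure). False" by eventually_elim (use pos in \<open>metis less_irrefl\<close>)
  then show False by (simp add: eventually_False ae_filter_eq_bot_iff)
qed

lemma sq_powr:
  fixes r :: real
  shows "r > 0 \<Longrightarrow> (r\<^sup>2) powr (s / 2) = r powr s"
  by (simp add: powr_powr flip: powr_numeral)

lemma newton_lap_scale:
  fixes z :: "'a::euclidean_space"
  assumes d: "d > 0"
  shows "d ^ DIM('a) * newton_lap d (d *\<^sub>R z) = newton_lap 1 z"
proof -
  have "rg d (d *\<^sub>R z) = d\<^sup>2 * rg 1 z" by (simp add: reg_def power_mult_distrib distrib_left)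
  then have "rg d (d *\<^sub>R z) powr (- real DIM('a) / 2 - 1) = (d\<^sup>2) powr (- real DIM('a) / 2 - 1) * rg 1 z powr (- real DIM('a) / 2 - 1)"
    using reg_pos[of 1 "\<lambda>x. x" z] by (simp add: powr_mult)
  moreover have "(d\<^sup>2) powr (- real DIM('a) / 2 - 1) = d powr (- real DIM('a) - 2)"
  proof -
    have "- real DIM('a) / 2 - 1 = (- real DIM('a) - 2) / 2" by (simp add: field_simps)
    then show ?thesis using sq_powr[OF d] by metis
  qed
  moreover have "d ^ DIM('a) * (d\<^sup>2 * d powr (- real DIM('a) - 2)) = 1"
  proof -
    have "d ^ DIM('a) * (d\<^sup>2 * d powr (- real DIM('a) - 2)) = d powr (real DIM('a)) * (d powr 2 * d powr (- real DIM('a) - 2))"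
      using d by (simp add: powr_realpow powr_numeral)
    also have "\<dots> = 1" unfolding powr_add[symmetric] using d by simp
    finally show ?thesis .
  qed
  ultimately show ?thesis
    by (simp add: newton_lap_def mult_ac)
qed

text \<open>Substituting x = y + d z turns the kernel into the fixed integrable function
  \<open>newton_lap 1\<close> and puts d into the argument of \<eta>. Continuity of \<eta> gives the
  limit, and boundedness of \<eta> gives a bound uniform in d and y.\<close>

lemma newton_lap_test:
  fixes \<eta> :: "'a::euclidean_space \<Rightarrow> real"
  assumes \<eta>: "test_function \<eta>"
  shows "(\<lambda>k. LINT x|lborel. newton_lap (dseq k) (x - y) * \<eta> x) \<longlonglongrightarrow> newton_mass TYPE('a) * \<eta> y"
    "\<exists>M. \<forall>k y. \<bar>LINT x|lborel. newton_lap (dseq k) (x - y) * \<eta> x\<bar> \<le> M"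
proof -
  have cont: "continuous_on UNIV \<eta>" using smooth_cont[OF test_smooth[OF \<eta>]] .
  have [measurable]: "\<eta> \<in> borel_measurable borel" using cont by (rule borel_measurable_continuous_onI)
  obtain D where D: "\<And>x. \<bar>\<eta> x\<bar> \<le> D" "D > 0" using test_bounded[OF \<eta>] by metis
  have eq: "(LINT x|lborel. newton_lap (dseq k) (x - y) * \<eta> x) = (LINT z|lborel. newton_lap 1 z * \<eta> (y + dseq k *\<^sub>R z))" for k y
  proof -
    have "(LINT x|lborel. newton_lap (dseq k) (x - y) * \<eta> x) =
      dseq k ^ DIM('a) * (LINT z|lborel. newton_lap (dseq k) ((y + dseq k *\<^sub>R z) - y) * \<eta> (y + dseq k *\<^sub>R z))"
      by (rule lborel_integral_affine[OF _ dseq(1)]) measurable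
    also have "\<dots> = (LINT z|lborel. dseq k ^ DIM('a) * newton_lap (dseq k) (dseq k *\<^sub>R z) * \<eta> (y + dseq k *\<^sub>R z))"
      by (subst integral_mult_right_zero[symmetric]) (simp add: mult.assoc)
    also have "\<dots> = (LINT z|lborel. newton_lap 1 z * \<eta> (y + dseq k *\<^sub>R z))"
      by (simp only: newton_lap_scale[OF dseq(1)])
    finally show ?thesis .
  qed
  have iD: "integrable lborel (\<lambda>z::'a. \<bar>newton_lap 1 z\<bar> * D)"
    by (intro integrable_mult_left integrable_abs integrable_newton_lap)
  have bb: "norm (newton_lap 1 z * \<eta> (y + dseq k *\<^sub>R z)) \<le> \<bar>newton_lap 1 z\<bar> * D" for k y z
    using D by (simp add: abs_mult mult_left_mono)
  have "(\<lambda>k. LINT z|lborel. newton_lap 1 z * \<eta> (y + dseq k *\<^sub>R z)) \<longlonglongrightarrow> (LINT z|lborel. newton_lap 1 (z::'a) * \<eta> y)"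
  proof (rule integral_dominated_convergence[where w="\<lambda>z. \<bar>newton_lap 1 z\<bar> * D"])
    show "integrable lborel (\<lambda>z::'a. \<bar>newton_lap 1 z\<bar> * D)" by (rule iD)
    show "AE z in lborel. (\<lambda>k. newton_lap 1 z * \<eta> (y + dseq k *\<^sub>R z)) \<longlonglongrightarrow> newton_lap 1 z * \<eta> y"
    proof (intro AE_I2 tendsto_mult tendsto_const)
      fix z
      have "(\<lambda>k. y + dseq k *\<^sub>R z) \<longlonglongrightarrow> y + 0 *\<^sub>R z" by (intro tendsto_intros dseq)
      then have "(\<lambda>k. \<eta> (y + dseq k *\<^sub>R z)) \<longlonglongrightarrow> \<eta> (y + 0 *\<^sub>R z)"
        by (intro continuous_on_tendsto_compose[OF cont]) auto
      then show "(\<lambda>k. \<eta> (y + dseq k *\<^sub>R z)) \<longlonglongrightarrow> \<eta> y" by simp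
    qed
  qed (measurable, use bb in auto)
  then show "(\<lambda>k. LINT x|lborel. newton_lap (dseq k) (x - y) * \<eta> x) \<longlonglongrightarrow> newton_mass TYPE('a) * \<eta> y"
    unfolding eq by (simp add: newton_mass_def)
  show "\<exists>M. \<forall>k y. \<bar>LINT x|lborel. newton_lap (dseq k) (x - y) * \<eta> x\<bar> \<le> M"
  proof (intro exI allI)
    fix k y
    have i: "integrable lborel (\<lambda>z. newton_lap 1 z * \<eta> (y + dseq k *\<^sub>R z))"
      by (rule Bochner_Integration.integrable_bound[OF iD]) (use bb D in \<open>auto intro: order_trans\<close>)
    have "\<bar>LINT z|lborel. newton_lap 1 z * \<eta> (y + dseq k *\<^sub>R z)\<bar> \<le> (LINT z|lborel. norm (newton_lap 1 z * \<eta> (y + dseq k *\<^sub>R z)))"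
      using integral_norm_bound[of lborel "\<lambda>z. newton_lap 1 z * \<eta> (y + dseq k *\<^sub>R z)"] by simp
    also have "\<dots> \<le> (LINT z|lborel. \<bar>newton_lap 1 (z::'a)\<bar> * D)"
      by (rule integral_mono[OF integrable_norm[OF i] iD]) (rule bb)
    finally show "\<bar>LINT x|lborel. newton_lap (dseq k) (x - y) * \<eta> x\<bar> \<le> (LINT z|lborel. \<bar>newton_lap 1 (z::'a)\<bar> * D)"
      unfolding eq .
  qed
qed

text \<open>For fixed d > 0 the kernel is bounded, by B, so the product of two integrable functions
  dominates the integrand on the product space.\<close>

lemma newton_lap_fubini:
  fixes \<eta> v :: "'a::euclidean_space \<Rightarrow> real"
  assumes \<eta>: "integrable lborel \<eta>" and v: "integrable lborel v" and d: "d > 0"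
  shows "(LINT x|lborel. \<eta> x * (LINT y|lborel. newton_lap d (x - y) * v y)) =
    (LINT y|lborel. v y * (LINT x|lborel. newton_lap d (x - y) * \<eta> x))"
proof -
  have [measurable]: "\<eta> \<in> borel_measurable borel" "v \<in> borel_measurable borel"
    using borel_measurable_integrable[OF \<eta>] borel_measurable_integrable[OF v] by auto
  define B where "B = \<bar>(2 - real DIM('a)) * real DIM('a)\<bar> * d\<^sup>2 * (d\<^sup>2) powr (- real DIM('a) / 2 - 1)"
  have B: "\<bar>newton_lap d z\<bar> \<le> B" for z :: 'a
    unfolding newton_lap_def B_def abs_mult
    using d by (intro mult_mono) (auto simp: reg_def intro!: powr_mono2')
  have "integrable (lborel \<Otimes>\<^sub>M lborel) (\<lambda>p. \<eta> (fst p) * v (snd p))"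
  proof (rule lborel_pair.Fubini_integrable)
    show "integrable lborel (\<lambda>x. LINT y|lborel. norm (\<eta> (fst (x, y)) * v (snd (x, y))))"
      using \<eta> by (simp add: abs_mult)
    show "AE x in lborel. integrable lborel (\<lambda>y. \<eta> (fst (x, y)) * v (snd (x, y)))"
      using v by simp
  qed measurable
  then have iB: "integrable (lborel \<Otimes>\<^sub>M lborel) (\<lambda>p. B * (\<eta> (fst p) * v (snd p)))" by simp
  have I: "integrable (lborel \<Otimes>\<^sub>M lborel) (\<lambda>(x, y). \<eta> x * (newton_lap d (x - y) * v y))"
  proof (rule Bochner_Integration.integrable_bound[OF iB])
    show "AE p in lborel \<Otimes>\<^sub>M lborel. norm (case p of (x, y) \<Rightarrow> \<eta> x * (newton_lap d (x - y) * v y)) \<le> norm (B * (\<eta> (fst p) * v (snd p)))"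
    proof (rule AE_I2, clarify)
      fix x y :: 'a
      have "\<bar>newton_lap d (x - y)\<bar> * (\<bar>\<eta> x\<bar> * \<bar>v y\<bar>) \<le> \<bar>B\<bar> * (\<bar>\<eta> x\<bar> * \<bar>v y\<bar>)"
        using B[of "x - y"] by (intro mult_right_mono) auto
      then show "norm (\<eta> x * (newton_lap d (x - y) * v y)) \<le> norm (B * (\<eta> (fst (x, y)) * v (snd (x, y))))"
        by (simp add: abs_mult mult_ac)
    qed
  qed measurable
  have "(LINT x|lborel. \<eta> x * (LINT y|lborel. newton_lap d (x - y) * v y)) =
    (LINT x|lborel. LINT y|lborel. \<eta> x * (newton_lap d (x - y) * v y))" by simp
  also have "\<dots> = (LINT y|lborel. LINT x|lborel. \<eta> x * (newton_lap d (x - y) * v y))"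
    by (rule lborel_pair.Fubini_integral[OF I, symmetric])
  also have "\<dots> = (LINT y|lborel. v y * (LINT x|lborel. newton_lap d (x - y) * \<eta> x))"
    by (subst integral_mult_right_zero[symmetric]) (simp add: mult_ac)
  finally show ?thesis .
qed

text \<open>The mollified identity is tested with \<eta>. Fubini moves the mollification onto the
  smooth \<eta>, where it converges pointwise and boundedly; the other side converges by
  \<open>potential_limit\<close>. The fundamental lemma then removes \<eta>. The kernel is left
  abstract so that the result serves both u and its gradient.\<close>

lemma representation_AE:
  fixes v h :: "'a::euclidean_space \<Rightarrow> real"
  assumes v: "integrable lborel v" and h: "integrable lborel h" and t: "0 \<le> t" "t < real DIM('a)"
    and K: "\<And>k. K k \<in> borel_measurable borel" "K' \<in> borel_measurable borel"
    and b: "\<And>k z. z \<noteq> 0 \<Longrightarrow> \<bar>K k z\<bar> \<le> C * norm z powr (-t)"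
    and lim: "\<And>z. z \<noteq> 0 \<Longrightarrow> (\<lambda>k::nat. K k z) \<longlonglongrightarrow> K' z"
    and eq: "\<And>k x. (LINT y|lborel. newton_lap (dseq k) (x - y) * v y) = (LINT y|lborel. K k (x - y) * h y)"
  shows "AE x in lborel. newton_mass TYPE('a) * v x = (LINT y|lborel. K' (x - y) * h y)"
proof -
  let ?U = "\<lambda>x. LINT y|lborel. K' (x - y) * h y"
  have [measurable]: "v \<in> borel_measurable borel" using borel_measurable_integrable[OF v] by simp
  \<comment> \<open>Local integrability of the potential is obtained together with a limit against a
    test function; the zero function instantiates it.\<close>
  have zero: "test_function (\<lambda>x::'a. 0)" by (rule test_functionI[OF smooth_const]) simp
  have U: "loc_int ?U" by (rule potential_limit(2)[OF h t K b lim zero])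
  have w: "loc_int (\<lambda>x. newton_mass TYPE('a) * v x)" by (intro loc_int_cmult loc_int_of_integrable v)
  have "AE x in lborel. newton_mass TYPE('a) * v x - ?U x = 0"
  proof (rule fundamental_lemma[OF loc_int_diff[OF w U]])
    fix \<eta> :: "'a \<Rightarrow> real" assume \<eta>: "test_function \<eta>"
    have [measurable]: "\<eta> \<in> borel_measurable borel"
      using smooth_cont[OF test_smooth[OF \<eta>]] by (rule borel_measurable_continuous_onI)
    have A: "(\<lambda>k. LINT x|lborel. \<eta> x * (LINT y|lborel. K k (x - y) * h y)) \<longlonglongrightarrow> (LINT x|lborel. \<eta> x * ?U x)"
      by (rule potential_limit(1)[OF h t K b lim \<eta>])
    obtain M where M: "\<And>k y. \<bar>LINT x|lborel. newton_lap (dseq k) (x - y) * \<eta> x\<bar> \<le> M"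
      using newton_lap_test(2)[OF \<eta>] by blast
    have "(\<lambda>k. LINT y|lborel. v y * (LINT x|lborel. newton_lap (dseq k) (x - y) * \<eta> x)) \<longlonglongrightarrow> (LINT y|lborel. v y * (newton_mass TYPE('a) * \<eta> y))"
    proof (rule integral_dominated_convergence[where w="\<lambda>y. \<bar>v y\<bar> * M"])
      show "integrable lborel (\<lambda>y. \<bar>v y\<bar> * M)" using v by simp
      show "AE y in lborel. (\<lambda>k. v y * (LINT x|lborel. newton_lap (dseq k) (x - y) * \<eta> x)) \<longlonglongrightarrow> v y * (newton_mass TYPE('a) * \<eta> y)"
        by (intro AE_I2 tendsto_mult tendsto_const newton_lap_test(1) \<eta>)
      show "AE y in lborel. norm (v y * (LINT x|lborel. newton_lap (dseq k) (x - y) * \<eta> x)) \<le> \<bar>v y\<bar> * M" for k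
        using M by (intro AE_I2) (simp add: abs_mult mult_left_mono)
      have "(\<lambda>y. LINT x|lborel. newton_lap (dseq k) (x - y) * \<eta> x) \<in> borel_measurable borel" for k
        using lborel.borel_measurable_lebesgue_integral[of "\<lambda>y x. newton_lap (dseq k) (x - y) * \<eta> x" borel] by simp
      then show "(\<lambda>y. v y * (LINT x|lborel. newton_lap (dseq k) (x - y) * \<eta> x)) \<in> borel_measurable lborel" for k by simp
    qed measurable
    moreover have "(LINT x|lborel. \<eta> x * (LINT y|lborel. K k (x - y) * h y)) =
        (LINT y|lborel. v y * (LINT x|lborel. newton_lap (dseq k) (x - y) * \<eta> x))" for k
      using newton_lap_fubini[OF integrable_test[OF \<eta>] v dseq(1)[of k]] by (simp only: eq)
    ultimately have "(LINT x|lborel. \<eta> x * ?U x) = (LINT y|lborel. v y * (newton_mass TYPE('a) * \<eta> y))"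
      using A LIMSEQ_unique by (simp only:) blast
    then show "(LINT x|lborel. \<eta> x * (newton_mass TYPE('a) * v x - ?U x)) = 0"
      using integrable_test_mult[OF \<eta> w] integrable_test_mult[OF \<eta> U] by (simp add: right_diff_distrib mult_ac)
  qed
  then show ?thesis by eventually_elim simp
qed

lemma rg_tendsto: "(\<lambda>k. rg (dseq k) x) \<longlonglongrightarrow> (norm x)\<^sup>2"
  using tendsto_add[OF tendsto_const tendsto_power[OF dseq(3), of 2], of "(norm x)\<^sup>2"] by (simp add: reg_def)

lemma norm_sq_powr: "x \<noteq> 0 \<Longrightarrow> ((norm x)\<^sup>2) powr (s / 2) = norm x powr s"
  by (rule sq_powr) simp

lemma newton_tendsto: "z \<noteq> 0 \<Longrightarrow> (\<lambda>k. newton (dseq k) z) \<longlonglongrightarrow> newton0 z"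
  unfolding newton_def newton0_def norm_sq_powr[symmetric]
  by (intro tendsto_powr rg_tendsto tendsto_const) simp

lemma newton_grad_tendsto: "z \<noteq> 0 \<Longrightarrow> (\<lambda>k. newton_grad (dseq k) b z) \<longlonglongrightarrow> newton0_grad b z"
  unfolding newton_grad_def newton0_grad_def norm_sq_powr[symmetric]
  by (intro tendsto_mult tendsto_powr rg_tendsto tendsto_const) simp

lemma rg_powr_le: "z \<noteq> 0 \<Longrightarrow> s \<le> 0 \<Longrightarrow> rg d z powr (s / 2) \<le> norm z powr s"
  unfolding norm_sq_powr[symmetric] by (intro powr_mono2') (auto simp: reg_def)

lemma newton_bounds:
  fixes z :: "'a::euclidean_space"
  assumes z: "z \<noteq> 0" and n2: "DIM('a) \<ge> 2"
  shows "\<bar>newton d z\<bar> \<le> 1 * norm z powr (- (real DIM('a) - 2))"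
    "\<bar>newton_grad d b z\<bar> \<le> ((real DIM('a) - 2) * norm b) * norm z powr (- (real DIM('a) - 1))"
proof -
  show "\<bar>newton d z\<bar> \<le> 1 * norm z powr (- (real DIM('a) - 2))"
    using rg_powr_le[OF z, of "2 - real DIM('a)" d] n2 by (simp add: newton_def)
  have "\<bar>z \<bullet> b\<bar> * rg d z powr (- real DIM('a) / 2) \<le> (norm z * norm b) * norm z powr (- real DIM('a))"
    by (intro mult_mono Cauchy_Schwarz_ineq2 rg_powr_le z) auto
  also have "\<dots> = norm b * (norm z powr 1 * norm z powr (- real DIM('a)))" using z by simp
  also have "norm z powr 1 * norm z powr (- real DIM('a)) = norm z powr (- (real DIM('a) - 1))"
    by (subst powr_add[symmetric]) (simp add: algebra_simps)
  finally have "\<bar>2 - real DIM('a)\<bar> * (\<bar>z \<bullet> b\<bar> * rg d z powr (- real DIM('a) / 2)) \<le> \<bar>2 - real DIM('a)\<bar> * (norm b * norm z powr (- (real DIM('a) - 1)))"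
    by (intro mult_left_mono) auto
  then show "\<bar>newton_grad d b z\<bar> \<le> ((real DIM('a) - 2) * norm b) * norm z powr (- (real DIM('a) - 1))"
    using n2 by (simp add: newton_grad_def abs_mult mult.assoc)
qed

theorem newton_representation:
  fixes u h :: "'a::euclidean_space \<Rightarrow> real"
  assumes P: "compact_poisson u h ub R" and n2: "DIM('a) \<ge> 2"
  shows "AE x in lborel. newton_mass TYPE('a) * u x = (LINT y|lborel. newton0 (x - y) * h y)"
    "b \<in> Basis \<Longrightarrow> AE x in lborel. newton_mass TYPE('a) * ub b x = (LINT y|lborel. newton0_grad b (x - y) * h y)"
proof -
  interpret compact_poisson u h ub R by fact
  have h: "integrable lborel h" by (rule loc_int_integrable[OF li(2) out(2)])
  have u: "integrable lborel u" by (rule loc_int_integrable[OF li(1) out(1)])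
  show "AE x in lborel. newton_mass TYPE('a) * u x = (LINT y|lborel. newton0 (x - y) * h y)"
    by (rule representation_AE[OF u h _ _ _ _ newton_bounds(1)[OF _ n2] newton_tendsto mollified_representation(1)[OF P dseq(1)]])
      (use n2 in auto)
  assume b: "b \<in> Basis"
  have ub: "integrable lborel (ub b)" by (rule loc_int_integrable[OF li(3)[OF b] out(3)[OF b]])
  show "AE x in lborel. newton_mass TYPE('a) * ub b x = (LINT y|lborel. newton0_grad b (x - y) * h y)"
    by (rule representation_AE[OF ub h _ _ _ _ newton_bounds(2)[OF _ n2] newton_grad_tendsto mollified_representation(2)[OF P dseq(1) b]])
      (use n2 in auto)
qed

section \<open>Hoelder and Taylor estimates for the Newton kernel\<close>

lemma powr_neg_diff:
  fixes A B n :: real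
  assumes "0 < A" "A \<le> B" "0 \<le> n"
  shows "\<bar>A powr (-n) - B powr (-n)\<bar> \<le> n * (B - A) * A powr (-n - 1)"
proof (cases "A = B")
  case False
  then have "A < B" using assms by simp
  moreover have "((\<lambda>t. t powr (-n)) has_real_derivative (-n) * x powr (-n - 1)) (at x)" if "A \<le> x" for x
    by (rule has_real_derivative_powr) (use that assms in simp)
  ultimately obtain \<xi> where \<xi>: "A < \<xi>" "\<xi> < B" "B powr (-n) - A powr (-n) = (B - A) * ((-n) * \<xi> powr (-n - 1))"
    using MVT2[of A B "\<lambda>t. t powr (-n)" "\<lambda>x. (-n) * x powr (-n - 1)"] by blast
  have "\<xi> powr (-n - 1) \<le> A powr (-n - 1)" using \<xi> assms by (intro powr_mono2') auto
  then have "(B - A) * (n * \<xi> powr (-n - 1)) \<le> (B - A) * (n * A powr (-n - 1))"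
    using assms by (intro mult_left_mono) auto
  moreover have "0 \<le> (B - A) * (n * \<xi> powr (-n - 1))" using assms by simp
  ultimately show ?thesis using \<xi>(3) by (simp add: mult_ac abs_if)
qed simp

text \<open>Two regimes. If |z - z'| \<le> |z|, the mean value estimate bounds the difference by (n
  + 1) |w| |z - z'| |z|^(-n), and 1 - \<alpha> powers of |z - z'| are traded for powers of |z|.
  Otherwise both terms are estimated separately, with factor 2. The constant n + 2 covers
  both.\<close>

lemma kernel_hoelder_ordered:
  fixes z z' w :: "'a::euclidean_space"
  assumes z: "z \<noteq> 0" "norm z \<le> norm z'" and a: "0 < \<alpha>" "\<alpha> \<le> 1" and n: "n \<ge> 1"
  shows "\<bar>(z \<bullet> w) * norm z powr (-n) - (z' \<bullet> w) * norm z' powr (-n)\<bar> \<le>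
    (n + 2) * norm w * (norm (z - z') powr \<alpha> * norm z powr (1 - n - \<alpha>))"
proof -
  define A B d where "A = norm z" and "B = norm z'" and "d = norm (z - z')"
  have pos: "A > 0" "A \<le> B" "B > 0" "d \<ge> 0" using z by (auto simp: A_def B_def d_def)
  have dBA: "B - A \<le> d" unfolding A_def B_def d_def by (metis norm_minus_commute norm_triangle_ineq2)
  have "\<bar>(z \<bullet> w) * A powr (-n) - (z' \<bullet> w) * B powr (-n)\<bar> \<le> (n + 2) * norm w * (d powr \<alpha> * A powr (1 - n - \<alpha>))"
  proof (cases "d \<le> A")
    case True
    have e: "(z \<bullet> w) * A powr (-n) - (z' \<bullet> w) * B powr (-n) =
      ((z - z') \<bullet> w) * B powr (-n) + (z \<bullet> w) * (A powr (-n) - B powr (-n))"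
      by (simp add: algebra_simps inner_diff_left)
    have "\<bar>((z - z') \<bullet> w) * B powr (-n)\<bar> \<le> (d * norm w) * A powr (-n)"
      unfolding abs_mult d_def using pos n
      by (intro mult_mono Cauchy_Schwarz_ineq2) (auto intro!: powr_mono2')
    moreover have "\<bar>(z \<bullet> w) * (A powr (-n) - B powr (-n))\<bar> \<le> (A * norm w) * (n * d * A powr (-n - 1))"
    proof -
      have "\<bar>A powr (-n) - B powr (-n)\<bar> \<le> n * (B - A) * A powr (-n - 1)"
        by (rule powr_neg_diff) (use pos n in auto)
      also have "\<dots> \<le> n * d * A powr (-n - 1)" using dBA n by (intro mult_right_mono mult_left_mono) auto
      finally have D: "\<bar>A powr (-n) - B powr (-n)\<bar> \<le> n * d * A powr (-n - 1)" .
      have "\<bar>z \<bullet> w\<bar> \<le> A * norm w" unfolding A_def by (rule Cauchy_Schwarz_ineq2)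
      then show ?thesis unfolding abs_mult[of "z \<bullet> w"] by (rule mult_mono[OF _ D]) (use pos in auto)
    qed
    ultimately have "\<bar>(z \<bullet> w) * A powr (-n) - (z' \<bullet> w) * B powr (-n)\<bar> \<le>
      (d * norm w) * A powr (-n) + (A * norm w) * (n * d * A powr (-n - 1))"
      unfolding e by linarith
    also have "A powr (-n - 1) = A powr (-n) / A" using pos by (simp add: powr_diff)
    also have "(d * norm w) * A powr (-n) + (A * norm w) * (n * d * (A powr (-n) / A)) = (n + 1) * norm w * (d * A powr (-n))"
      using pos by (simp add: field_simps)
    also have "\<dots> \<le> (n + 2) * norm w * (d powr \<alpha> * A powr (1 - n - \<alpha>))"
    proof (rule mult_mono)
      show "(n + 1) * norm w \<le> (n + 2) * norm w" by (intro mult_right_mono) auto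
      have "d = d powr \<alpha> * d powr (1 - \<alpha>)" using pos by (cases "d = 0") (auto simp flip: powr_add)
      also have "\<dots> \<le> d powr \<alpha> * A powr (1 - \<alpha>)" using pos True a by (intro mult_left_mono powr_mono2) auto
      finally have "d * A powr (-n) \<le> d powr \<alpha> * A powr (1 - \<alpha>) * A powr (-n)" by (intro mult_right_mono) auto
      then show "d * A powr (-n) \<le> d powr \<alpha> * A powr (1 - n - \<alpha>)"
        by (simp add: mult.assoc algebra_simps flip: powr_add)
    qed (use n pos in auto)
    finally show ?thesis .
  next
    case False
    have k: "\<bar>(v \<bullet> w) * norm v powr (-n)\<bar> \<le> norm w * A powr (1 - n)" if "A \<le> norm v" for v
    proof -
      have "\<bar>(v \<bullet> w) * norm v powr (-n)\<bar> \<le> (norm v * norm w) * norm v powr (-n)"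
        unfolding abs_mult by (intro mult_mono Cauchy_Schwarz_ineq2) auto
      also have "\<dots> = norm w * norm v powr (1 - n)" using that pos by (simp add: powr_diff powr_minus divide_simps)
      also have "\<dots> \<le> norm w * A powr (1 - n)" using that pos n by (intro mult_left_mono powr_mono2') auto
      finally show ?thesis .
    qed
    have "\<bar>(z \<bullet> w) * A powr (-n) - (z' \<bullet> w) * B powr (-n)\<bar> \<le> 2 * norm w * A powr (1 - n)"
      using k[of z] k[of z'] pos unfolding A_def B_def by (simp add: abs_le_iff)
    also have "A powr (1 - n) = A powr \<alpha> * A powr (1 - n - \<alpha>)" by (simp flip: powr_add)
    also have "2 * norm w * (A powr \<alpha> * A powr (1 - n - \<alpha>)) \<le> (n + 2) * norm w * (d powr \<alpha> * A powr (1 - n - \<alpha>))"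
    proof -
      have "A powr \<alpha> \<le> d powr \<alpha>" using pos False a by (intro powr_mono2) auto
      then show ?thesis using n by (intro mult_mono) auto
    qed
    finally show ?thesis .
  qed
  then show ?thesis by (simp add: A_def B_def d_def)
qed

lemma kernel_hoelder:
  fixes z z' w :: "'a::euclidean_space"
  assumes z: "z \<noteq> 0" "z' \<noteq> 0" and a: "0 < \<alpha>" "\<alpha> \<le> 1" and n: "n \<ge> 1"
  shows "\<bar>(z \<bullet> w) * norm z powr (-n) - (z' \<bullet> w) * norm z' powr (-n)\<bar> \<le>
    (n + 2) * norm w * (norm (z - z') powr \<alpha> * (norm z powr (1 - n - \<alpha>) + norm z' powr (1 - n - \<alpha>)))"
proof -
  have m: "(n + 2) * norm w * (norm (z - z') powr \<alpha> * u) \<le> (n + 2) * norm w * (norm (z - z') powr \<alpha> * (norm z powr (1 - n - \<alpha>) + norm z' powr (1 - n - \<alpha>)))"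
    if "u \<le> norm z powr (1 - n - \<alpha>) + norm z' powr (1 - n - \<alpha>)" for u
    using n that by (intro mult_left_mono) auto
  show ?thesis
  proof (cases "norm z \<le> norm z'")
    case True
    from order_trans[OF kernel_hoelder_ordered[OF z(1) True a n] m] show ?thesis by simp
  next
    case False
    have "\<bar>(z' \<bullet> w) * norm z' powr (-n) - (z \<bullet> w) * norm z powr (-n)\<bar> \<le>
      (n + 2) * norm w * (norm (z - z') powr \<alpha> * norm z' powr (1 - n - \<alpha>))"
      using kernel_hoelder_ordered[OF z(2) _ a n, of z w] False by (simp add: norm_minus_commute)
    from order_trans[OF this m] show ?thesis by (simp add: abs_minus_commute)
  qed
qed

lemma newton0_line_derivative:
  fixes z w :: "'a::euclidean_space"
  assumes "z + t *\<^sub>R w \<noteq> 0"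
  shows "((\<lambda>t. newton0 (z + t *\<^sub>R w)) has_real_derivative newton0_grad w (z + t *\<^sub>R w)) (at t)"
proof -
  let ?n = "real DIM('a)"
  let ?q = "\<lambda>t. z \<bullet> z + 2 * t * (z \<bullet> w) + t * t * (w \<bullet> w)"
  have q: "?q t = (norm (z + t *\<^sub>R w))\<^sup>2" for t
    by (simp add: power2_norm_eq_inner inner_simps inner_commute algebra_simps)
  have q0: "?q t > 0" unfolding q using assms by simp
  \<comment> \<open>Along a line the squared norm is a quadratic polynomial in t, hence
    differentiable. At the origin both sides are 0 because 0 to any real power is 0, so the identity
    holds for all t, as differentiation requires.\<close>
  have g: "newton0 (z + t *\<^sub>R w) = ?q t powr ((2 - ?n) / 2)" for t
  proof (cases "z + t *\<^sub>R w = 0")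
    case True
    then show ?thesis unfolding q newton0_def by simp
  next
    case False
    then show ?thesis unfolding q newton0_def by (rule norm_sq_powr[symmetric])
  qed
  have "((\<lambda>t. ?q t) has_real_derivative (2 * (z \<bullet> w) + 2 * t * (w \<bullet> w))) (at t)"
    by (auto intro!: derivative_eq_intros)
  from DERIV_chain2[OF has_real_derivative_powr[OF q0] this]
  have "((\<lambda>t. ?q t powr ((2 - ?n) / 2)) has_real_derivative
      (2 - ?n) / 2 * ?q t powr ((2 - ?n) / 2 - 1) * (2 * (z \<bullet> w) + 2 * t * (w \<bullet> w))) (at t)" .
  moreover have "(2 - ?n) / 2 - 1 = (- ?n) / 2" by (simp add: field_simps)
  ultimately have "((\<lambda>t. newton0 (z + t *\<^sub>R w)) has_real_derivative
      (2 - ?n) / 2 * ?q t powr ((- ?n) / 2) * (2 * (z \<bullet> w) + 2 * t * (w \<bullet> w))) (at t)"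
    unfolding g by (simp only:)
  moreover have "(2 - ?n) / 2 * ?q t powr ((- ?n) / 2) * (2 * (z \<bullet> w) + 2 * t * (w \<bullet> w)) = newton0_grad w (z + t *\<^sub>R w)"
  proof -
    have "2 * (z \<bullet> w) + 2 * t * (w \<bullet> w) = 2 * ((z + t *\<^sub>R w) \<bullet> w)" by (simp add: inner_simps algebra_simps)
    then show ?thesis unfolding q norm_sq_powr[OF assms] newton0_grad_def by (simp only:) (simp add: mult_ac)
  qed
  ultimately show ?thesis by simp
qed

text \<open>If 2 |w| \<le> |z|, the segment from z to z + w keeps distance |z| / 2 from the origin,
  so the mean value theorem and the Hoelder bound of the gradient apply. Otherwise |z| and |z + w|
  are at most 3 |w| and the three terms are estimated one by one.\<close>

lemma newton0_taylor:
  fixes z w :: "'a::euclidean_space"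
  assumes z: "z \<noteq> 0" "z + w \<noteq> 0" and a: "0 < \<alpha>" "\<alpha> \<le> 1" and n2: "DIM('a) \<ge> 2"
  defines "n \<equiv> real DIM('a)"
  shows "\<bar>newton0 (z + w) - newton0 z - newton0_grad w z\<bar> \<le>
    (n * 3 powr (1 + \<alpha>) + (n - 2) * (n + 2) * (2 powr (n + \<alpha> - 1) + 1)) *
    (norm w powr (1 + \<alpha>) * (norm z powr (1 - n - \<alpha>) + norm (z + w) powr (1 - n - \<alpha>)))"
proof -
  have n: "n \<ge> 2" using n2 by (simp add: n_def)
  define e where "e = 1 - n - \<alpha>"
  define X where "X = norm w powr (1 + \<alpha>) * (norm z powr e + norm (z + w) powr e)"
  have X0: "X \<ge> 0" by (simp add: X_def)
  have c0: "n * 3 powr (1 + \<alpha>) \<ge> 0" "(n - 2) * (n + 2) * (2 powr (n + \<alpha> - 1) + 1) \<ge> 0" using n by auto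
  \<comment> \<open>Each case uses one of the two summands, the other being nonnegative: the powers
    of 3 come from the singular regime, the powers of 2 from halving the distance in the regular
    one.\<close>
  have "\<bar>newton0 (z + w) - newton0 z - newton0_grad w z\<bar> \<le> (n * 3 powr (1 + \<alpha>)) * X + ((n - 2) * (n + 2) * (2 powr (n + \<alpha> - 1) + 1)) * X"
  proof (cases "2 * norm w \<le> norm z")
    case True
    have far: "norm (z + t *\<^sub>R w) \<ge> norm z / 2" if "0 \<le> t" "t \<le> 1" for t
    proof -
      have "norm (t *\<^sub>R w) \<le> norm w" using that by (simp add: mult_left_le_one_le)
      moreover have "norm (z + t *\<^sub>R w) \<ge> norm z - norm (t *\<^sub>R w)" by (rule norm_diff_ineq)
      ultimately show ?thesis using True by linarith
    qed
    have nz: "z + t *\<^sub>R w \<noteq> 0" if "0 \<le> t" "t \<le> 1" for t using far[OF that] z(1) by auto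
    have "\<exists>\<xi>. 0 < \<xi> \<and> \<xi> < 1 \<and> newton0 (z + 1 *\<^sub>R w) - newton0 (z + 0 *\<^sub>R w) = (1 - 0) * newton0_grad w (z + \<xi> *\<^sub>R w)"
      by (rule MVT2[of 0 1 "\<lambda>t. newton0 (z + t *\<^sub>R w)" "\<lambda>t. newton0_grad w (z + t *\<^sub>R w)"])
        (use nz in \<open>auto intro!: newton0_line_derivative\<close>)
    then obtain \<xi> where \<xi>: "0 < \<xi>" "\<xi> < 1" "newton0 (z + w) - newton0 z = newton0_grad w (z + \<xi> *\<^sub>R w)" by auto
    have "\<bar>newton0_grad w (z + \<xi> *\<^sub>R w) - newton0_grad w z\<bar> = (n - 2) * \<bar>((z + \<xi> *\<^sub>R w) \<bullet> w) * norm (z + \<xi> *\<^sub>R w) powr (-n) - (z \<bullet> w) * norm z powr (-n)\<bar>"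
    proof -
      have "newton0_grad w (z + \<xi> *\<^sub>R w) - newton0_grad w z = (2 - n) * (((z + \<xi> *\<^sub>R w) \<bullet> w) * norm (z + \<xi> *\<^sub>R w) powr (-n) - (z \<bullet> w) * norm z powr (-n))"
        by (simp add: newton0_grad_def n_def right_diff_distrib)
      then show ?thesis using n by (simp add: abs_mult)
    qed
    also have "\<dots> \<le> (n - 2) * ((n + 2) * norm w * (norm ((z + \<xi> *\<^sub>R w) - z) powr \<alpha> * (norm (z + \<xi> *\<^sub>R w) powr e + norm z powr e)))"
      unfolding e_def using n \<xi> by (intro mult_left_mono kernel_hoelder nz z a) auto
    also have "\<dots> \<le> (n - 2) * ((n + 2) * norm w * (norm w powr \<alpha> * (2 powr (n + \<alpha> - 1) * norm z powr e + norm z powr e)))"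
    proof (intro mult_left_mono mult_mono add_mono order_refl)
      show "norm ((z + \<xi> *\<^sub>R w) - z) powr \<alpha> \<le> norm w powr \<alpha>"
        using \<xi> a by (intro powr_mono2) (auto simp: mult_left_le_one_le)
      have "norm (z + \<xi> *\<^sub>R w) powr e \<le> (norm z / 2) powr e"
        using far[of \<xi>] \<xi> z n a by (intro powr_mono2') (auto simp: e_def)
      also have "\<dots> = 2 powr (- e) * norm z powr e" by (simp add: powr_divide powr_minus divide_simps)
      finally show "norm (z + \<xi> *\<^sub>R w) powr e \<le> 2 powr (n + \<alpha> - 1) * norm z powr e" by (simp add: e_def algebra_simps)
    qed (use n in auto)
    also have "\<dots> = ((n - 2) * (n + 2) * (2 powr (n + \<alpha> - 1) + 1)) * (norm w * norm w powr \<alpha> * norm z powr e)"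
      by (simp add: algebra_simps)
    also have "norm w * norm w powr \<alpha> = norm w powr (1 + \<alpha>)" by (cases "w = 0") (auto simp: powr_add)
    also have "((n - 2) * (n + 2) * (2 powr (n + \<alpha> - 1) + 1)) * (norm w powr (1 + \<alpha>) * norm z powr e) \<le> ((n - 2) * (n + 2) * (2 powr (n + \<alpha> - 1) + 1)) * X"
      unfolding X_def by (intro mult_left_mono c0) auto
    finally have "\<bar>newton0 (z + w) - newton0 z - newton0_grad w z\<bar> \<le> ((n - 2) * (n + 2) * (2 powr (n + \<alpha> - 1) + 1)) * X"
      unfolding \<xi>(3) .
    moreover have "0 \<le> (n * 3 powr (1 + \<alpha>)) * X" by (rule mult_nonneg_nonneg[OF c0(1) X0])
    ultimately show ?thesis by linarith
  next
    case False
    have le: "norm z \<le> 3 * norm w" "norm (z + w) \<le> 3 * norm w"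
      using False norm_triangle_ineq[of z w] norm_ge_zero[of w] by linarith+
    have N: "newton0 v \<le> 3 powr (1 + \<alpha>) * (norm w powr (1 + \<alpha>) * norm v powr e)" if "norm v \<le> 3 * norm w" for v :: 'a
    proof -
      have "newton0 v = norm v powr (1 + \<alpha>) * norm v powr e"
        by (simp add: newton0_def e_def n_def flip: powr_add)
      also have "\<dots> \<le> (3 * norm w) powr (1 + \<alpha>) * norm v powr e"
        using that a by (intro mult_right_mono powr_mono2) auto
      finally show ?thesis by (simp add: powr_mult mult.assoc)
    qed
    have G: "\<bar>newton0_grad w z\<bar> \<le> (n - 2) * (3 powr (1 + \<alpha>) * (norm w powr (1 + \<alpha>) * norm z powr e))"
    proof -
      have "\<bar>newton0_grad w z\<bar> = (n - 2) * (\<bar>z \<bullet> w\<bar> * norm z powr (-n))"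
        using n by (simp add: newton0_grad_def abs_mult n_def)
      also have "\<dots> \<le> (n - 2) * ((norm z * norm w) * norm z powr (-n))"
        using n by (intro mult_left_mono mult_right_mono Cauchy_Schwarz_ineq2) auto
      also have "(norm z * norm w) * norm z powr (-n) = norm w * (norm z powr \<alpha> * norm z powr e)"
      proof -
        have "norm z powr \<alpha> * norm z powr e = norm z powr (1 + (-n))"
          unfolding powr_add[symmetric] e_def by simp
        also have "\<dots> = norm z powr 1 * norm z powr (-n)" by (rule powr_add)
        finally show ?thesis using z(1) by simp
      qed
      also have "\<dots> \<le> norm w * ((3 * norm w) powr \<alpha> * norm z powr e)"
        using le a by (intro mult_left_mono mult_right_mono powr_mono2) auto
      also have "\<dots> = 3 powr \<alpha> * ((norm w powr 1 * norm w powr \<alpha>) * norm z powr e)" by (simp add: powr_mult mult_ac)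
      also have "norm w powr 1 * norm w powr \<alpha> = norm w powr (1 + \<alpha>)" by (rule powr_add[symmetric])
      also have "3 powr \<alpha> * (norm w powr (1 + \<alpha>) * norm z powr e) \<le> 3 powr (1 + \<alpha>) * (norm w powr (1 + \<alpha>) * norm z powr e)"
        by (intro mult_right_mono powr_mono) auto
      finally show ?thesis using n by (simp add: mult_left_mono)
    qed
    define Y where "Y = 3 powr (1 + \<alpha>) * (norm w powr (1 + \<alpha>) * norm z powr e)"
    define Y' where "Y' = 3 powr (1 + \<alpha>) * (norm w powr (1 + \<alpha>) * norm (z + w) powr e)"
    have Y: "Y \<ge> 0" "Y' \<ge> 0" "3 powr (1 + \<alpha>) * X = Y + Y'" by (simp_all add: Y_def Y'_def X_def algebra_simps)
    have "0 \<le> newton0 z" "0 \<le> newton0 (z + w)" by (simp_all add: newton0_def)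
    then have "\<bar>newton0 (z + w) - newton0 z - newton0_grad w z\<bar> \<le> Y' + Y + (n - 2) * Y"
      using N[OF le(1)] N[OF le(2)] G unfolding Y_def[symmetric] Y'_def[symmetric] by linarith
    also have "\<dots> \<le> n * (Y + Y')"
    proof -
      have "0 \<le> (n - 1) * Y'" using n Y by simp
      then show ?thesis using Y by (simp add: algebra_simps)
    qed
    also have "\<dots> = (n * 3 powr (1 + \<alpha>)) * X" unfolding Y(3)[symmetric] by simp
    finally have "\<bar>newton0 (z + w) - newton0 z - newton0_grad w z\<bar> \<le> (n * 3 powr (1 + \<alpha>)) * X" .
    moreover have "0 \<le> ((n - 2) * (n + 2) * (2 powr (n + \<alpha> - 1) + 1)) * X" by (rule mult_nonneg_nonneg[OF c0(2) X0])
    ultimately show ?thesis by linarith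
  qed
  then show ?thesis unfolding X_def e_def by (simp only: distrib_right)
qed

section \<open>Potentials of bounded densities\<close>

lemma powr_kernel_integrable:
  assumes s: "s < real DIM('a::euclidean_space)" "0 \<le> s"
  obtains C where "C \<ge> 0" "\<And>x :: 'a. integrable lborel (\<lambda>y. indicator (ball 0 R) y * norm (x - y) powr (-s))"
    "\<And>x :: 'a. (LINT y|lborel. indicator (ball 0 R) y * norm (x - y) powr (-s)) \<le> C"
proof -
  obtain C where C: "C \<ge> 0" "\<And>x :: 'a. (\<integral>\<^sup>+y. ennreal (indicator (ball 0 R) y * norm (x - y) powr (-s)) \<partial>lborel) \<le> ennreal C"
    by (rule powr_kernel_bound[OF s, of R], rule that, assumption, assumption)
  have i: "integrable lborel (\<lambda>y. indicator (ball 0 R) y * norm (x - y) powr (-s))" for x :: 'a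
  proof (rule integrableI_nonneg)
    show "(\<integral>\<^sup>+y. ennreal (indicator (ball 0 R) y * norm (x - y) powr (-s)) \<partial>lborel) < \<infinity>"
      using order_le_less_trans[OF C(2)[of x] ennreal_less_top] by simp
  qed auto
  have "(LINT y|lborel. indicator (ball 0 R) y * norm (x - y) powr (-s)) \<le> C" for x :: 'a
  proof -
    have "ennreal (LINT y|lborel. indicator (ball 0 R) y * norm (x - y) powr (-s)) \<le> ennreal C"
      using C(2)[of x] by (subst (asm) nn_integral_eq_integral[OF i]) auto
    then show ?thesis using C(1) by simp
  qed
  with i C(1) show ?thesis by (intro that)
qed

locale bounded_density =
  fixes h :: "'a::euclidean_space \<Rightarrow> real" and M R :: real
  assumes n2: "DIM('a) \<ge> 3"
    and h_measurable: "h \<in> borel_measurable borel"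
    and h_bounded: "\<And>x. \<bar>h x\<bar> \<le> M"
    and h_outside: "\<And>x. norm x \<ge> R \<Longrightarrow> h x = 0"
begin

declare h_measurable [measurable]

lemma h_le: "\<bar>h y\<bar> \<le> M * indicator (ball 0 R) y"
  using h_bounded[of y] h_outside[of y] by (cases "norm y < R") auto

lemma M0: "M \<ge> 0" using h_bounded[of 0] by linarith

text \<open>A difference of kernels is singular at two points, hence the two base points and the
  factor 2. Almost everywhere suffices in the bound, since kernel estimates may fail at the
  singularities.\<close>

lemma kernel_integral_bound:
  assumes K[measurable]: "K \<in> borel_measurable borel" and s: "0 \<le> s" "s < real DIM('a)"
    and b: "AE y in lborel. \<bar>K y\<bar> \<le> c * (norm (x - y) powr (-s) + norm (x' - y) powr (-s))"
    and c: "c \<ge> 0"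
    and C: "\<And>x :: 'a. (LINT y|lborel. indicator (ball 0 R) y * norm (x - y) powr (-s)) \<le> C"
  shows "integrable lborel (\<lambda>y. K y * h y)" "\<bar>LINT y|lborel. K y * h y\<bar> \<le> 2 * c * M * C"
proof -
  obtain D where "\<And>x :: 'a. integrable lborel (\<lambda>y. indicator (ball 0 R) y * norm (x - y) powr (-s))"
    by (rule powr_kernel_integrable[OF s(2,1), of R]) metis
  note i = this
  have ii: "integrable lborel (\<lambda>y. c * M * (indicator (ball 0 R) y * norm (x - y) powr (-s) + indicator (ball 0 R) y * norm (x' - y) powr (-s)))"
    by (intro integrable_mult_right Bochner_Integration.integrable_add i)
  have bb: "AE y in lborel. norm (K y * h y) \<le> c * M * (indicator (ball 0 R) y * norm (x - y) powr (-s) + indicator (ball 0 R) y * norm (x' - y) powr (-s))"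
    using b
  proof eventually_elim
    case (elim y)
    have "\<bar>K y\<bar> * \<bar>h y\<bar> \<le> (c * (norm (x - y) powr (-s) + norm (x' - y) powr (-s))) * (M * indicator (ball 0 R) y)"
      using elim h_le[of y] c by (intro mult_mono) auto
    then show ?case by (simp add: abs_mult algebra_simps)
  qed
  show I: "integrable lborel (\<lambda>y. K y * h y)"
    by (rule Bochner_Integration.integrable_bound[OF ii]) (use bb in \<open>auto intro: order_trans\<close>)
  have "\<bar>LINT y|lborel. K y * h y\<bar> \<le> (LINT y|lborel. norm (K y * h y))"
    using integral_norm_bound[of lborel "\<lambda>y. K y * h y"] by simp
  also have "\<dots> \<le> (LINT y|lborel. c * M * (indicator (ball 0 R) y * norm (x - y) powr (-s) + indicator (ball 0 R) y * norm (x' - y) powr (-s)))"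
    by (rule integral_mono_AE[OF integrable_norm[OF I] ii bb])
  also have "\<dots> = c * M * ((LINT y|lborel. indicator (ball 0 R) y * norm (x - y) powr (-s)) + (LINT y|lborel. indicator (ball 0 R) y * norm (x' - y) powr (-s)))"
    by (simp add: Bochner_Integration.integral_add[OF i i])
  also have "\<dots> \<le> c * M * (C + C)" using c M0 by (intro mult_left_mono add_mono C) auto
  finally show "\<bar>LINT y|lborel. K y * h y\<bar> \<le> 2 * c * M * C" by simp
qed

definition pot :: "'a \<Rightarrow> real" where
  "pot x = (LINT y|lborel. newton0 (x - y) * h y)"

definition pot_grad :: "'a \<Rightarrow> 'a \<Rightarrow> real" where
  "pot_grad b x = (LINT y|lborel. newton0_grad b (x - y) * h y)"

lemma newton0_abs: "\<bar>newton0 z\<bar> = norm z powr (- (real DIM('a) - 2))" for z :: 'a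
  by (simp add: newton0_def)

lemma newton0_grad_abs: "\<bar>newton0_grad b z\<bar> \<le> (real DIM('a) - 2) * norm b * norm z powr (- (real DIM('a) - 1))" for z :: 'a
proof (cases "z = 0")
  case False
  have "(\<lambda>k. \<bar>newton_grad (dseq k) b z\<bar>) \<longlonglongrightarrow> \<bar>newton0_grad b z\<bar>"
    by (intro tendsto_rabs newton_grad_tendsto False)
  then show ?thesis
    by (rule tendsto_upperbound[OF _ always_eventually]) (use newton_bounds(2)[OF False] n2 in auto)
qed (simp add: newton0_grad_def)

lemma integrable_pot: "integrable lborel (\<lambda>y. newton0 (x - y) * h y)"
proof -
  have s: "0 \<le> real DIM('a) - 2" "real DIM('a) - 2 < real DIM('a)" using n2 by auto
  obtain C where C: "\<And>x :: 'a. (LINT y|lborel. indicator (ball 0 R) y * norm (x - y) powr (-(real DIM('a) - 2))) \<le> C"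
    by (rule powr_kernel_integrable[OF s(2,1), of R]) metis
  show ?thesis
    by (rule kernel_integral_bound(1)[OF _ s _ _ C, where c=1 and x=x and x'=x]) (auto simp: newton0_abs)
qed

lemma integrable_pot_grad: "integrable lborel (\<lambda>y. newton0_grad b (x - y) * h y)"
proof -
  have s: "0 \<le> real DIM('a) - 1" "real DIM('a) - 1 < real DIM('a)" using n2 by auto
  obtain C where C: "\<And>x :: 'a. (LINT y|lborel. indicator (ball 0 R) y * norm (x - y) powr (-(real DIM('a) - 1))) \<le> C"
    by (rule powr_kernel_integrable[OF s(2,1), of R]) metis
  show ?thesis
  proof (rule kernel_integral_bound(1)[OF _ s _ _ C, where c="(real DIM('a) - 2) * norm b" and x=x and x'=x])
    show "AE y in lborel. \<bar>newton0_grad b (x - y)\<bar> \<le> (real DIM('a) - 2) * norm b *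
       (norm (x - y) powr (- (real DIM('a) - 1)) + norm (x - y) powr (- (real DIM('a) - 1)))"
    proof (rule AE_I2)
      fix y
      have "0 \<le> (real DIM('a) - 2) * norm b * norm (x - y) powr (- (real DIM('a) - 1))" using n2 by simp
      then show "\<bar>newton0_grad b (x - y)\<bar> \<le> (real DIM('a) - 2) * norm b *
       (norm (x - y) powr (- (real DIM('a) - 1)) + norm (x - y) powr (- (real DIM('a) - 1)))"
        unfolding distrib_left using newton0_grad_abs[of b "x - y"] by linarith
    qed
  qed (use n2 in auto)
qed

text \<open>The Hoelder estimate of the kernel raises its order from n - 1 to n - 1 + \<alpha>,
  which remains integrable precisely for \<alpha> < 1.\<close>

lemma pot_grad_hoelder:
  assumes a: "0 < \<alpha>" "\<alpha> < 1"
  shows "\<exists>C. \<forall>x x'. \<bar>pot_grad b x - pot_grad b x'\<bar> \<le> C * norm (x - x') powr \<alpha>"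
proof -
  let ?n = "real DIM('a)"
  have s: "0 \<le> ?n - 1 + \<alpha>" "?n - 1 + \<alpha> < ?n" using n2 a by auto
  obtain C where C: "\<And>x :: 'a. (LINT y|lborel. indicator (ball 0 R) y * norm (x - y) powr (-(?n - 1 + \<alpha>))) \<le> C"
    by (rule powr_kernel_integrable[OF s(2,1), of R]) metis
  define B where "B = (?n - 2) * (?n + 2) * norm b"
  have "\<bar>pot_grad b x - pot_grad b x'\<bar> \<le> (2 * B * M * C) * norm (x - x') powr \<alpha>" for x x'
  proof -
    have e: "pot_grad b x - pot_grad b x' = (LINT y|lborel. (newton0_grad b (x - y) - newton0_grad b (x' - y)) * h y)"
      unfolding pot_grad_def left_diff_distrib
      by (rule Bochner_Integration.integral_diff[symmetric]) (rule integrable_pot_grad)+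
    have "\<bar>LINT y|lborel. (newton0_grad b (x - y) - newton0_grad b (x' - y)) * h y\<bar> \<le> 2 * (B * norm (x - x') powr \<alpha>) * M * C"
    proof (rule kernel_integral_bound(2)[OF _ s _ _ C])
      show "AE y in lborel. \<bar>newton0_grad b (x - y) - newton0_grad b (x' - y)\<bar> \<le>
          B * norm (x - x') powr \<alpha> * (norm (x - y) powr (- (?n - 1 + \<alpha>)) + norm (x' - y) powr (- (?n - 1 + \<alpha>)))"
        using AE_lborel_singleton[of x] AE_lborel_singleton[of x']
      proof eventually_elim
        case (elim y)
        have "\<bar>newton0_grad b (x - y) - newton0_grad b (x' - y)\<bar> =
            (?n - 2) * \<bar>((x - y) \<bullet> b) * norm (x - y) powr (-?n) - ((x' - y) \<bullet> b) * norm (x' - y) powr (-?n)\<bar>"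
          using n2 by (simp add: newton0_grad_def abs_mult flip: right_diff_distrib)
        also have "\<dots> \<le> (?n - 2) * ((?n + 2) * norm b * (norm ((x - y) - (x' - y)) powr \<alpha> *
            (norm (x - y) powr (1 - ?n - \<alpha>) + norm (x' - y) powr (1 - ?n - \<alpha>))))"
          using elim n2 a by (intro mult_left_mono kernel_hoelder) auto
        also have "\<dots> = B * norm (x - x') powr \<alpha> * (norm (x - y) powr (- (?n - 1 + \<alpha>)) + norm (x' - y) powr (- (?n - 1 + \<alpha>)))"
          by (simp add: B_def diff_diff_eq mult.assoc)
        finally show ?case .
      qed
    qed (use n2 in \<open>auto simp: B_def\<close>)
    then show ?thesis unfolding e by (simp add: mult_ac)
  qed
  then show ?thesis by blast
qed

lemma newton0_grad_linear: "newton0_grad (r *\<^sub>R v + w) z = r * newton0_grad v z + newton0_grad w z"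
  by (simp add: newton0_grad_def inner_simps algebra_simps)

text \<open>The singularity moves with the argument, so instead of differentiating under the
  integral by domination, the Taylor remainder of the kernel is integrated. With exponent 1/2, one
  choice within (0, 1), the remainder of the potential is O(|w|^(3/2)), which is o(|w|).\<close>

lemma pot_has_derivative: "(pot has_derivative (\<lambda>w. pot_grad w x)) (at x)"
proof -
  let ?n = "real DIM('a)"
  have lin: "linear (\<lambda>w. pot_grad w x)"
  proof (rule linearI)
    fix v w :: 'a and r :: real
    have "pot_grad (r *\<^sub>R v + w) x = r * pot_grad v x + pot_grad w x" for r v w
    proof -
      have "pot_grad (r *\<^sub>R v + w) x = (LINT y|lborel. r * (newton0_grad v (x - y) * h y) + newton0_grad w (x - y) * h y)"
        unfolding pot_grad_def newton0_grad_linear by (simp add: algebra_simps)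
      also have "\<dots> = r * pot_grad v x + pot_grad w x"
        unfolding pot_grad_def by (subst Bochner_Integration.integral_add) (auto intro: integrable_pot_grad)
      finally show ?thesis .
    qed
    from this[of 1 v w] this[of r v 0]
    show "pot_grad (v + w) x = pot_grad v x + pot_grad w x" "pot_grad (r *\<^sub>R v) x = r *\<^sub>R pot_grad v x"
      by (simp_all add: pot_grad_def newton0_grad_def)
  qed
  have s: "0 \<le> ?n - 1 + 1/2" "?n - 1 + 1/2 < ?n" using n2 by auto
  obtain C where C: "\<And>x :: 'a. (LINT y|lborel. indicator (ball 0 R) y * norm (x - y) powr (-(?n - 1 + 1/2))) \<le> C"
    by (rule powr_kernel_integrable[OF s(2,1), of R]) metis
  define B where "B = ?n * 3 powr (1 + 1/2) + (?n - 2) * (?n + 2) * (2 powr (?n + 1/2 - 1) + 1)"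
  have B0: "B \<ge> 0" unfolding B_def using n2 by (intro add_nonneg_nonneg mult_nonneg_nonneg) auto
  define D where "D = 2 * B * M * C"
  have est: "\<bar>pot (x + w) - pot x - pot_grad w x\<bar> \<le> D * norm w powr (1 + 1/2)" for w
  proof -
    have e: "pot (x + w) - pot x - pot_grad w x = (LINT y|lborel. (newton0 (x + w - y) - newton0 (x - y) - newton0_grad w (x - y)) * h y)"
      unfolding pot_def pot_grad_def left_diff_distrib
      by (simp add: Bochner_Integration.integral_diff integrable_pot integrable_pot_grad Bochner_Integration.integrable_diff)
    have "\<bar>LINT y|lborel. (newton0 (x + w - y) - newton0 (x - y) - newton0_grad w (x - y)) * h y\<bar> \<le> 2 * (B * norm w powr (1 + 1/2)) * M * C"
    proof (rule kernel_integral_bound(2)[OF _ s _ _ C])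
      show "AE y in lborel. \<bar>newton0 (x + w - y) - newton0 (x - y) - newton0_grad w (x - y)\<bar> \<le>
          B * norm w powr (1 + 1/2) * (norm (x - y) powr (- (?n - 1 + 1/2)) + norm (x + w - y) powr (- (?n - 1 + 1/2)))"
        using AE_lborel_singleton[of x] AE_lborel_singleton[of "x + w"]
      proof eventually_elim
        case (elim y)
        have z: "x - y \<noteq> 0" "(x - y) + w \<noteq> 0" using elim by (auto simp: algebra_simps)
        have "(x - y) + w = x + w - y" by simp
        moreover have "1 - ?n - 1/2 = - (?n - 1 + 1/2)" by simp
        ultimately show ?case
          using newton0_taylor[OF z, of "1/2"] n2 unfolding B_def mult.assoc[of _ "norm w powr (1 + 1/2)"] by (simp only:)
      qed
    qed (use B0 in auto)
    then show ?thesis unfolding e D_def by (simp add: mult_ac)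
  qed
  show ?thesis
    unfolding has_derivative_at
  proof
    show "bounded_linear (\<lambda>w. pot_grad w x)" using lin by (simp add: linear_conv_bounded_linear)
    have "((\<lambda>w::'a. norm w) \<longlongrightarrow> 0) (at 0)" using tendsto_norm[OF tendsto_ident_at, of 0 UNIV] by simp
    then have "((\<lambda>w::'a. norm w powr (1/2)) \<longlongrightarrow> 0 powr (1/2)) (at 0)"
      by (rule tendsto_powr'[OF _ tendsto_const]) auto
    from tendsto_mult[OF tendsto_const this, of D]
    have lim: "((\<lambda>w::'a. D * norm w powr (1/2)) \<longlongrightarrow> 0) (at 0)" by simp
    show "(\<lambda>w. norm (pot (x + w) - pot x - pot_grad w x) / norm w) \<midarrow>0\<rightarrow> 0"
    proof (rule Lim_null_comparison[OF _ lim])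
      show "\<forall>\<^sub>F w in at 0. norm (norm (pot (x + w) - pot x - pot_grad w x) / norm w) \<le> D * norm w powr (1/2)"
        unfolding eventually_at_filter
      proof (rule always_eventually, intro allI impI)
        fix w :: 'a assume w: "w \<noteq> 0"
        have "norm w powr (1 + 1/2) = norm w * norm w powr (1/2)" using w by (subst powr_add) simp
        then show "norm (norm (pot (x + w) - pot x - pot_grad w x) / norm w) \<le> D * norm w powr (1/2)"
          using est[of w] w by (simp add: divide_simps mult_ac)
      qed
    qed
  qed
qed

end

section \<open>Regularity of weak solutions\<close>

lemma ennreal_abs_integral_le:
  fixes f :: "'a \<Rightarrow> real"
  shows "ennreal \<bar>integral\<^sup>L M f\<bar> \<le> (\<integral>\<^sup>+x. ennreal \<bar>f x\<bar> \<partial>M)"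
proof (cases "integrable M f")
  case True
  then show ?thesis using integral_norm_bound_ennreal[OF True] by simp
qed (simp add: not_integrable_integral_eq)

lemma continuous_AE_eq:
  fixes f g :: "'a::euclidean_space \<Rightarrow> real"
  assumes "continuous_on UNIV f" "continuous_on UNIV g" "open S"
    and ae: "AE x in lborel. x \<in> S \<longrightarrow> f x = g x" and x: "x \<in> S"
  shows "f x = g x"
proof (rule ccontr)
  assume ne: "f x \<noteq> g x"
  define N where "N = S \<inter> {x. f x \<noteq> g x}"
  have o: "open N" unfolding N_def by (intro open_Int assms open_Collect_neq)
  have "N \<in> null_sets lborel"
  proof -
    have "N \<in> sets lborel" using o by simp
    moreover have "AE x in lborel. x \<notin> N" using ae by eventually_elim (auto simp: N_def)
    ultimately show ?thesis by (simp add: AE_iff_null_sets)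
  qed
  then have "negligible N" by (auto simp: negligible_iff_null_sets intro: null_sets_completionI)
  moreover have "N \<noteq> {}" using x ne by (auto simp: N_def)
  ultimately show False using o open_not_negligible by blast
qed

text \<open>Weak solutions of Laplacian \<phi> = g with weak gradient q, where g is bounded by a
  multiple of |\<phi>| + |grad \<phi>|. This growth bound is all that is retained of the
  coefficients.\<close>

locale elliptic =
  fixes \<phi> g :: "'a::euclidean_space \<Rightarrow> real" and q :: "'a \<Rightarrow> 'a \<Rightarrow> real" and A :: real
  assumes n3: "DIM('a) \<ge> 3"
    and l\<phi>: "loc_int \<phi>" and lq: "\<And>b. b \<in> Basis \<Longrightarrow> loc_int (q b)" and lg: "loc_int g"
    and weak: "\<And>b \<zeta>. b \<in> Basis \<Longrightarrow> test_function \<zeta> \<Longrightarrow>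
      (LINT x|lborel. partial_deriv b \<zeta> x * \<phi> x) = - (LINT x|lborel. \<zeta> x * q b x)"
    and eqn: "\<And>\<zeta>. test_function \<zeta> \<Longrightarrow>
      (\<Sum>b\<in>Basis. LINT x|lborel. partial_deriv b \<zeta> x * q b x) = - (LINT x|lborel. \<zeta> x * g x)"
    and g_le: "\<And>x. \<bar>g x\<bar> \<le> A * (\<bar>\<phi> x\<bar> + (\<Sum>b\<in>Basis. \<bar>q b x\<bar>))" and A0: "A \<ge> 0"
begin

definition W :: "'a \<Rightarrow> real" where "W x = \<bar>\<phi> x\<bar> + (\<Sum>b\<in>Basis. \<bar>q b x\<bar>)"

lemma W_nonneg: "W x \<ge> 0" unfolding W_def by (intro add_nonneg_nonneg sum_nonneg) auto

lemma W_ge: "\<bar>\<phi> x\<bar> \<le> W x" "b \<in> Basis \<Longrightarrow> \<bar>q b x\<bar> \<le> W x"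
proof -
  have s: "0 \<le> (\<Sum>b\<in>Basis. \<bar>q b x\<bar>)" by (rule sum_nonneg) auto
  then show "\<bar>\<phi> x\<bar> \<le> W x" by (simp add: W_def)
  assume "b \<in> Basis"
  then have "\<bar>q b x\<bar> \<le> (\<Sum>b\<in>Basis. \<bar>q b x\<bar>)" by (intro member_le_sum) auto
  then show "\<bar>q b x\<bar> \<le> W x" by (simp add: W_def)
qed

lemma loc_int_W: "loc_int W"
  unfolding W_def[abs_def] by (intro loc_int_add loc_int_sum loc_int_abs l\<phi> lq)

definition cut_grad :: "('a \<Rightarrow> real) \<Rightarrow> 'a \<Rightarrow> 'a \<Rightarrow> real" where
  "cut_grad \<eta> b x = \<eta> x * q b x + partial_deriv b \<eta> x * \<phi> x"

text \<open>The Leibniz rule for the Laplacian of \<eta> \<phi>, namely \<eta> g + 2 grad \<eta> . q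
  + (Laplacian \<eta>) \<phi>.\<close>

definition cut_lap :: "('a \<Rightarrow> real) \<Rightarrow> 'a \<Rightarrow> real" where
  "cut_lap \<eta> x = \<eta> x * g x + (\<Sum>b\<in>Basis. 2 * (partial_deriv b \<eta> x * q b x) + partial_deriv b (partial_deriv b \<eta>) x * \<phi> x)"

lemma loc_int_cut:
  assumes "smooth \<eta>"
  shows "loc_int (\<lambda>x. \<eta> x * \<phi> x)" "b \<in> Basis \<Longrightarrow> loc_int (cut_grad \<eta> b)" "loc_int (cut_lap \<eta>)"
  unfolding cut_grad_def[abs_def] cut_lap_def[abs_def]
  by (intro loc_int_add loc_int_sum loc_int_cmult loc_int_mult_cont l\<phi> lq lg smooth_cont smooth_pd assms; assumption)+

lemma cutoff_weak:
  assumes \<eta>: "test_function \<eta>" and z: "smooth \<zeta>" and b: "b \<in> Basis"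
  shows "(LINT x|lborel. partial_deriv b \<zeta> x * (\<eta> x * \<phi> x)) = - (LINT x|lborel. \<zeta> x * cut_grad \<eta> b x)"
proof -
  have s\<eta>: "smooth \<eta>" by (rule test_smooth[OF \<eta>])
  have pd: "partial_deriv b (\<lambda>x. \<eta> x * \<zeta> x) x = partial_deriv b \<eta> x * \<zeta> x + \<eta> x * partial_deriv b \<zeta> x" for x
    by (intro partial_deriv_mult smooth_differentiable s\<eta> z)
  have i1: "integrable lborel (\<lambda>x. partial_deriv b \<eta> x * (\<zeta> x * \<phi> x))"
    by (intro integrable_test_mult test_pd \<eta> b loc_int_mult_cont l\<phi> smooth_cont z)
  have i2: "integrable lborel (\<lambda>x. \<eta> x * (partial_deriv b \<zeta> x * \<phi> x))"
    by (intro integrable_test_mult \<eta> b loc_int_mult_cont l\<phi> smooth_cont smooth_pd z)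
  have i3: "integrable lborel (\<lambda>x. \<eta> x * (\<zeta> x * q b x))"
    by (intro integrable_test_mult \<eta> b loc_int_mult_cont lq smooth_cont z)
  have "(LINT x|lborel. partial_deriv b \<eta> x * (\<zeta> x * \<phi> x)) + (LINT x|lborel. \<eta> x * (partial_deriv b \<zeta> x * \<phi> x))
    = - (LINT x|lborel. \<eta> x * (\<zeta> x * q b x))"
    using weak[OF b test_mult[OF \<eta> z]] unfolding pd Bochner_Integration.integral_add[OF i1 i2, symmetric]
    by (simp add: algebra_simps)
  moreover have "(LINT x|lborel. \<zeta> x * cut_grad \<eta> b x) =
      (LINT x|lborel. \<eta> x * (\<zeta> x * q b x)) + (LINT x|lborel. partial_deriv b \<eta> x * (\<zeta> x * \<phi> x))"
    unfolding Bochner_Integration.integral_add[OF i3 i1, symmetric] by (simp add: cut_grad_def algebra_simps)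
  ultimately show ?thesis by (simp add: mult_ac)
qed

text \<open>\<open>E1\<close> is the equation tested with \<eta> \<zeta>; \<open>E2\<close> is the
  weak gradient of \<phi> tested with (d_b \<eta>) \<zeta>. The second removes the integrals in
  which both \<eta> and \<zeta> are differentiated.\<close>

lemma cutoff_eqn:
  assumes \<eta>: "test_function \<eta>" and z: "smooth \<zeta>"
  shows "(\<Sum>b\<in>Basis. LINT x|lborel. partial_deriv b \<zeta> x * cut_grad \<eta> b x) = - (LINT x|lborel. \<zeta> x * cut_lap \<eta> x)"
proof -
  have s\<eta>: "smooth \<eta>" by (rule test_smooth[OF \<eta>])
  define a where "a b = (LINT x|lborel. \<eta> x * (partial_deriv b \<zeta> x * q b x))" for b
  define cc where "cc b = (LINT x|lborel. partial_deriv b \<eta> x * (partial_deriv b \<zeta> x * \<phi> x))" for b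
  define e where "e b = (LINT x|lborel. partial_deriv b \<eta> x * (\<zeta> x * q b x))" for b
  define f where "f b = (LINT x|lborel. partial_deriv b (partial_deriv b \<eta>) x * (\<zeta> x * \<phi> x))" for b
  define GG where "GG = (LINT x|lborel. \<eta> x * (\<zeta> x * g x))"
  have ia: "integrable lborel (\<lambda>x. \<eta> x * (partial_deriv b \<zeta> x * q b x))"
    and ic: "integrable lborel (\<lambda>x. partial_deriv b \<eta> x * (partial_deriv b \<zeta> x * \<phi> x))"
    and ie: "integrable lborel (\<lambda>x. partial_deriv b \<eta> x * (\<zeta> x * q b x))"
    and if': "integrable lborel (\<lambda>x. partial_deriv b (partial_deriv b \<eta>) x * (\<zeta> x * \<phi> x))" if b: "b \<in> Basis" for b
    by (intro integrable_test_mult test_pd \<eta> b loc_int_mult_cont lq l\<phi> smooth_cont smooth_pd z)+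
  have iG: "integrable lborel (\<lambda>x. \<eta> x * (\<zeta> x * g x))"
    by (intro integrable_test_mult \<eta> loc_int_mult_cont lg smooth_cont z)
  have E1: "(\<Sum>b\<in>Basis. e b + a b) = - GG"
  proof -
    have "(\<Sum>b\<in>Basis. e b + a b) = (\<Sum>b\<in>Basis. LINT x|lborel. partial_deriv b (\<lambda>x. \<eta> x * \<zeta> x) x * q b x)"
    proof (rule sum.cong[OF refl])
      fix b :: 'a assume b: "b \<in> Basis"
      have pd: "partial_deriv b (\<lambda>x. \<eta> x * \<zeta> x) x = partial_deriv b \<eta> x * \<zeta> x + \<eta> x * partial_deriv b \<zeta> x" for x
        by (intro partial_deriv_mult smooth_differentiable s\<eta> z)
      show "e b + a b = (LINT x|lborel. partial_deriv b (\<lambda>x. \<eta> x * \<zeta> x) x * q b x)"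
        unfolding e_def a_def pd Bochner_Integration.integral_add[OF ie[OF b] ia[OF b], symmetric] by (simp add: algebra_simps)
    qed
    then show ?thesis using eqn[OF test_mult[OF \<eta> z]] by (simp add: GG_def mult.assoc)
  qed
  have E2: "f b + cc b = - e b" if b: "b \<in> Basis" for b
  proof -
    have pd: "partial_deriv b (\<lambda>x. partial_deriv b \<eta> x * \<zeta> x) x = partial_deriv b (partial_deriv b \<eta>) x * \<zeta> x + partial_deriv b \<eta> x * partial_deriv b \<zeta> x" for x
      by (intro partial_deriv_mult smooth_differentiable smooth_pd s\<eta> b z)
    show ?thesis
      using weak[OF b test_mult[OF test_pd[OF \<eta> b] z]]
      unfolding f_def cc_def e_def pd Bochner_Integration.integral_add[OF if'[OF b] ic[OF b], symmetric] by (simp add: algebra_simps)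
  qed
  have "(\<Sum>b\<in>Basis. LINT x|lborel. partial_deriv b \<zeta> x * cut_grad \<eta> b x) = (\<Sum>b\<in>Basis. a b + cc b)"
  proof (rule sum.cong[OF refl])
    fix b :: 'a assume b: "b \<in> Basis"
    show "(LINT x|lborel. partial_deriv b \<zeta> x * cut_grad \<eta> b x) = a b + cc b"
      unfolding a_def cc_def Bochner_Integration.integral_add[OF ia[OF b] ic[OF b], symmetric] by (simp add: cut_grad_def algebra_simps)
  qed
  also have "\<dots> = (\<Sum>b\<in>Basis. (e b + a b) - (2 * e b + f b))"
  proof (rule sum.cong[OF refl])
    fix b :: 'a assume b: "b \<in> Basis"
    show "a b + cc b = (e b + a b) - (2 * e b + f b)" using E2[OF b] by linarith
  qed
  also have "\<dots> = - (GG + (\<Sum>b\<in>Basis. 2 * e b + f b))" unfolding sum_subtractf E1 by simp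
  also have "GG + (\<Sum>b\<in>Basis. 2 * e b + f b) = (LINT x|lborel. \<zeta> x * cut_lap \<eta> x)"
  proof -
    have i2: "integrable lborel (\<lambda>x. 2 * (partial_deriv b \<eta> x * (\<zeta> x * q b x)) + partial_deriv b (partial_deriv b \<eta>) x * (\<zeta> x * \<phi> x))" if b: "b \<in> Basis" for b
      using ie[OF b] if'[OF b] by simp
    have "(\<Sum>b\<in>Basis. 2 * e b + f b) = (\<Sum>b\<in>Basis. LINT x|lborel. 2 * (partial_deriv b \<eta> x * (\<zeta> x * q b x)) + partial_deriv b (partial_deriv b \<eta>) x * (\<zeta> x * \<phi> x))"
      by (rule sum.cong) (simp_all add: e_def f_def ie if')
    also have "\<dots> = (LINT x|lborel. (\<Sum>b\<in>Basis. 2 * (partial_deriv b \<eta> x * (\<zeta> x * q b x)) + partial_deriv b (partial_deriv b \<eta>) x * (\<zeta> x * \<phi> x)))"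
      by (intro Bochner_Integration.integral_sum[symmetric] i2)
    finally have "GG + (\<Sum>b\<in>Basis. 2 * e b + f b) = (LINT x|lborel. \<eta> x * (\<zeta> x * g x) + (\<Sum>b\<in>Basis. 2 * (partial_deriv b \<eta> x * (\<zeta> x * q b x)) + partial_deriv b (partial_deriv b \<eta>) x * (\<zeta> x * \<phi> x)))"
      unfolding GG_def using iG i2 by (simp add: Bochner_Integration.integrable_sum)
    then show ?thesis by (simp add: cut_lap_def algebra_simps sum_distrib_left)
  qed
  finally show ?thesis .
qed

lemma cutoff_exists:
  assumes R: "R \<ge> 0"
  obtains \<eta> C where "smooth \<eta>" "\<And>x. norm x < R \<Longrightarrow> \<eta> x = 1" "\<And>b x. norm x < R \<Longrightarrow> partial_deriv b \<eta> x = 0"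
    "compact_poisson (\<lambda>x. \<eta> x * \<phi> x) (cut_lap \<eta>) (cut_grad \<eta>) (R + 2)"
    "C \<ge> 0" "\<And>x. \<bar>cut_lap \<eta> x\<bar> \<le> C * (indicator (ball 0 (R + 2)) x * W x)"
proof -
  obtain \<eta> :: "'a \<Rightarrow> real" where \<eta>: "test_function \<eta>" "smooth \<eta>" "\<And>x. norm x \<le> R \<Longrightarrow> \<eta> x = 1"
    "\<And>x. norm x \<ge> R + 1 \<Longrightarrow> \<eta> x = 0" "\<And>x. 0 \<le> \<eta> x" "\<And>x. \<eta> x \<le> 1"
    using smooth_cutoff_exists[OF R] by metis
  have p0: "partial_deriv b \<eta> x = 0" if "norm x > R + 1" for b x by (rule partial_deriv_outside[OF \<eta>(4) that])
  \<comment> \<open>First derivatives vanish only strictly beyond R + 1, so an intermediate radius R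
    + 3/2 is needed before the same argument applies to them.\<close>
  have p1: "partial_deriv b (partial_deriv b \<eta>) x = 0" if "norm x \<ge> R + 2" for b x
    by (rule partial_deriv_outside[where R="R + 3/2"]) (use p0 that in auto)
  have inner: "partial_deriv b \<eta> x = 0" if "norm x < R" for b x
  proof -
    have "((\<lambda>x. 1) has_derivative (\<lambda>h. 0)) (at x)" by simp
    then have "(\<eta> has_derivative (\<lambda>h. 0)) (at x)"
      by (rule has_derivative_transform_within_open[where s="ball 0 R"]) (use \<eta>(3) that in auto)
    then show ?thesis by (rule partial_deriv_eq)
  qed
  have out: "\<eta> x = 0" "partial_deriv b \<eta> x = 0" "partial_deriv b (partial_deriv b \<eta>) x = 0" if "norm x \<ge> R + 2" for b x
    using that \<eta>(4)[of x] p0[of x b] p1[of x b] by auto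
  have P: "compact_poisson (\<lambda>x. \<eta> x * \<phi> x) (cut_lap \<eta>) (cut_grad \<eta>) (R + 2)"
    by unfold_locales (simp_all add: loc_int_cut[OF \<eta>(2)] cutoff_weak[OF \<eta>(1)] cutoff_eqn[OF \<eta>(1)],
      simp_all add: cut_lap_def cut_grad_def out)
  have "\<exists>C. \<forall>x. \<bar>partial_deriv b \<eta> x\<bar> \<le> C \<and> \<bar>partial_deriv b (partial_deriv b \<eta>) x\<bar> \<le> C" if b: "b \<in> Basis" for b
  proof -
    obtain C1 where "\<And>x. \<bar>partial_deriv b \<eta> x\<bar> \<le> C1" by (rule test_bounded[OF test_pd[OF \<eta>(1) b]]) metis
    moreover obtain C2 where "\<And>x. \<bar>partial_deriv b (partial_deriv b \<eta>) x\<bar> \<le> C2" by (rule test_bounded[OF test_pd[OF test_pd[OF \<eta>(1) b] b]]) metis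
    ultimately show ?thesis by (intro exI[of _ "max C1 C2"]) (simp add: le_max_iff_disj)
  qed
  then obtain B where B: "\<And>b x. b \<in> Basis \<Longrightarrow> \<bar>partial_deriv b \<eta> x\<bar> \<le> B b \<and> \<bar>partial_deriv b (partial_deriv b \<eta>) x\<bar> \<le> B b"
    by metis
  have B0: "b \<in> Basis \<Longrightarrow> 0 \<le> B b" for b using B[of b 0] by linarith
  define C where "C = A + (\<Sum>b\<in>Basis. 3 * B b)"
  have C0: "C \<ge> 0" unfolding C_def using A0 B0 by (intro add_nonneg_nonneg sum_nonneg) auto
  have bound: "\<bar>cut_lap \<eta> x\<bar> \<le> C * (indicator (ball 0 (R + 2)) x * W x)" for x
  proof (cases "norm x < R + 2")
    case True
    have "\<bar>\<eta> x * g x\<bar> \<le> 1 * (A * W x)"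
      unfolding abs_mult using \<eta>(5,6)[of x] g_le[of x] by (intro mult_mono) (auto simp: W_def)
    moreover have "\<bar>\<Sum>b\<in>Basis. 2 * (partial_deriv b \<eta> x * q b x) + partial_deriv b (partial_deriv b \<eta>) x * \<phi> x\<bar> \<le> (\<Sum>b\<in>Basis. 3 * B b * W x)"
    proof (rule order_trans[OF sum_abs sum_mono])
      fix b :: 'a assume b: "b \<in> Basis"
      have "\<bar>partial_deriv b \<eta> x * q b x\<bar> \<le> B b * W x" "\<bar>partial_deriv b (partial_deriv b \<eta>) x * \<phi> x\<bar> \<le> B b * W x"
        unfolding abs_mult using B[OF b, of x] W_ge W_nonneg b B0 by (auto intro!: mult_mono)
      then show "\<bar>2 * (partial_deriv b \<eta> x * q b x) + partial_deriv b (partial_deriv b \<eta>) x * \<phi> x\<bar> \<le> 3 * B b * W x"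
        by linarith
    qed
    ultimately have "\<bar>cut_lap \<eta> x\<bar> \<le> A * W x + (\<Sum>b\<in>Basis. 3 * B b * W x)"
      unfolding cut_lap_def by linarith
    also have "\<dots> = C * W x" by (simp add: C_def distrib_right sum_distrib_right)
    finally show ?thesis using True by simp
  next
    case False
    then have "cut_lap \<eta> x = 0" using out[of x] by (simp add: cut_lap_def)
    then show ?thesis using False by simp
  qed
  show ?thesis by (rule that[OF \<eta>(2) _ inner P C0 bound]) (simp add: \<eta>(3))
qed

text \<open>On the ball where \<eta> = 1, \<phi> and q are potentials of \<open>cut_lap\<close>,
  which is at most C W and supported in the larger ball. Over bounded distances the milder kernel |x
  - y|^(2-n) is also dominated by |x - y|^(1-n), so one kernel serves all 1 + n components of
  W.\<close>

lemma W_integral_inequality: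
  "\<exists>C\<ge>0. AE x in lborel. x \<in> ball 0 R \<longrightarrow> ennreal (W x) \<le> ennreal C *
    (\<integral>\<^sup>+y. ennreal (indicator (ball 0 (R+2)) y * (norm (x - y) powr (-(real DIM('a) - 1)) * W y)) \<partial>lborel)"
proof (cases "R \<ge> 0")
  case False
  then have "x \<notin> ball 0 R" for x :: 'a using False norm_ge_zero[of x] unfolding mem_ball_0 by linarith
  then show ?thesis by (intro exI[of _ 0]) simp
next
  case True
  let ?n = "real DIM('a)"
  obtain \<eta> C where \<eta>: "smooth \<eta>" "\<And>x. norm x < R \<Longrightarrow> \<eta> x = 1" "\<And>b x. norm x < R \<Longrightarrow> partial_deriv b \<eta> x = 0"
    and P: "compact_poisson (\<lambda>x. \<eta> x * \<phi> x) (cut_lap \<eta>) (cut_grad \<eta>) (R + 2)"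
    and C: "C \<ge> 0" "\<And>x. \<bar>cut_lap \<eta> x\<bar> \<le> C * (indicator (ball 0 (R + 2)) x * W x)"
    by (rule cutoff_exists[OF True]) (rule that, assumption+)
  note [measurable] = loc_int_borel[OF loc_int_W]
  let ?I = "\<lambda>x. \<integral>\<^sup>+y. ennreal (indicator (ball 0 (R+2)) y * (norm (x - y) powr (-(?n - 1)) * W y)) \<partial>lborel"
  define m where "m = \<bar>newton_mass TYPE('a)\<bar>"
  have m: "m > 0" unfolding m_def using newton_mass_nonzero[OF n3] by simp
  \<comment> \<open>2 R + 2 bounds |x - y| for |x| < R and |y| < R + 2 and converts the kernel of
    \<phi>; n - 2 is the factor of the gradient kernel.\<close>
  define c where "c = max (2 * R + 2) (?n - 2)"
  have c0: "c \<ge> 0" using n3 by (simp add: c_def)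
  have K: "ennreal \<bar>v\<bar> \<le> ennreal (c * C / m) * ?I x"
    if eq: "newton_mass TYPE('a) * v = (LINT y|lborel. k y * cut_lap \<eta> y)"
      and k: "\<And>y. y \<in> ball 0 (R + 2) \<Longrightarrow> \<bar>k y\<bar> \<le> c * norm (x - y) powr (-(?n - 1))" for v k and x :: 'a
  proof -
    have "ennreal (m * \<bar>v\<bar>) = ennreal \<bar>LINT y|lborel. k y * cut_lap \<eta> y\<bar>"
      unfolding eq[symmetric] m_def by (simp add: abs_mult)
    also have "\<dots> \<le> (\<integral>\<^sup>+y. ennreal \<bar>k y * cut_lap \<eta> y\<bar> \<partial>lborel)" by (rule ennreal_abs_integral_le)
    also have "\<dots> \<le> (\<integral>\<^sup>+y. ennreal (c * C) * ennreal (indicator (ball 0 (R+2)) y * (norm (x - y) powr (-(?n - 1)) * W y)) \<partial>lborel)"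
    proof (rule nn_integral_mono)
      fix y
      have "\<bar>k y * cut_lap \<eta> y\<bar> \<le> (c * C) * (indicator (ball 0 (R+2)) y * (norm (x - y) powr (-(?n - 1)) * W y))"
      proof (cases "y \<in> ball 0 (R + 2)")
        case True
        have "\<bar>k y\<bar> * \<bar>cut_lap \<eta> y\<bar> \<le> (c * norm (x - y) powr (-(?n - 1))) * (C * (indicator (ball 0 (R + 2)) y * W y))"
          using c0 by (intro mult_mono k True C) auto
        then show ?thesis by (simp add: abs_mult mult_ac)
      next
        case False
        then show ?thesis using C(2)[of y] by (auto simp: indicator_def)
      qed
      then show "ennreal \<bar>k y * cut_lap \<eta> y\<bar> \<le> ennreal (c * C) * ennreal (indicator (ball 0 (R+2)) y * (norm (x - y) powr (-(?n - 1)) * W y))"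
        using c0 C(1) by (subst ennreal_mult'[symmetric]) (auto intro!: ennreal_leI)
    qed
    also have "\<dots> = ennreal (c * C) * ?I x" by (rule nn_integral_cmult) measurable
    finally have "ennreal (1 / m) * ennreal (m * \<bar>v\<bar>) \<le> ennreal (1 / m) * (ennreal (c * C) * ?I x)"
      by (rule mult_left_mono) simp
    moreover have "ennreal (1 / m) * ennreal (m * \<bar>v\<bar>) = ennreal \<bar>v\<bar>"
      using m by (subst ennreal_mult'[symmetric]) auto
    moreover have "ennreal (1 / m) * (ennreal (c * C) * ?I x) = ennreal (c * C / m) * ?I x"
      using m c0 C(1) by (subst mult.assoc[symmetric], subst ennreal_mult'[symmetric]) auto
    ultimately show ?thesis by (simp only:)
  qed
  have n2: "DIM('a) \<ge> 2" using n3 by simp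
  have AEb: "AE x in lborel. \<forall>b\<in>Basis. newton_mass TYPE('a) * cut_grad \<eta> b x = (LINT y|lborel. newton0_grad b (x - y) * cut_lap \<eta> y)"
    using newton_representation(2)[OF P n2] by (intro AE_finite_allI) auto
  have "AE x in lborel. x \<in> ball 0 R \<longrightarrow> ennreal (W x) \<le> ennreal ((1 + ?n) * (c * C / m)) * ?I x"
    using newton_representation(1)[OF P n2] AEb
  proof eventually_elim
    case (elim x)
    show ?case
    proof
      assume "x \<in> ball 0 R"
      then have x: "norm x < R" by simp
      have k0: "\<bar>newton0 (x - y)\<bar> \<le> c * norm (x - y) powr (-(?n - 1))" if "y \<in> ball 0 (R + 2)" for y
      proof (cases "x = y")
        case False
        have "norm (x - y) \<le> c" using that x norm_triangle_ineq4[of x y] by (simp add: c_def)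
        moreover have "newton0 (x - y) = norm (x - y) powr 1 * norm (x - y) powr (-(?n - 1))"
          unfolding newton0_def powr_add[symmetric] by simp
        ultimately show ?thesis by (simp add: abs_mult mult_right_mono)
      qed (simp add: newton0_def)
      have k1: "\<bar>newton0_grad b (x - y)\<bar> \<le> c * norm (x - y) powr (-(?n - 1))" if "b \<in> Basis" for b y
      proof -
        have "\<bar>newton0_grad b (x - y)\<bar> = (?n - 2) * (\<bar>(x - y) \<bullet> b\<bar> * norm (x - y) powr (-?n))"
          using n3 by (simp add: newton0_grad_def abs_mult)
        also have "\<dots> \<le> (?n - 2) * (norm (x - y) * norm (x - y) powr (-?n))"
          using n3 that Basis_le_norm[OF that, of "x - y"] by (intro mult_left_mono mult_right_mono) auto
        also have "norm (x - y) * norm (x - y) powr (-?n) = norm (x - y) powr (-(?n - 1))"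
          by (cases "x = y") (simp_all add: powr_diff powr_minus divide_simps)
        also have "(?n - 2) * norm (x - y) powr (-(?n - 1)) \<le> c * norm (x - y) powr (-(?n - 1))"
          by (intro mult_right_mono) (auto simp: c_def)
        finally show ?thesis .
      qed
      have "ennreal \<bar>\<phi> x\<bar> \<le> ennreal (c * C / m) * ?I x"
        by (rule K[OF _ k0]) (use elim(1) \<eta>(2)[OF x] in simp)
      moreover have "ennreal \<bar>q b x\<bar> \<le> ennreal (c * C / m) * ?I x" if b: "b \<in> Basis" for b
        by (rule K[OF _ k1[OF b]]) (use elim(2)[rule_format, OF b] \<eta>(2)[OF x] \<eta>(3)[OF x, of b] in \<open>simp add: cut_grad_def\<close>)
      ultimately have "ennreal \<bar>\<phi> x\<bar> + (\<Sum>b\<in>Basis. ennreal \<bar>q b x\<bar>) \<le> ennreal (c * C / m) * ?I x + (\<Sum>b\<in>(Basis::'a set). ennreal (c * C / m) * ?I x)"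
        by (intro add_mono sum_mono)
      also have "\<dots> = (1 + of_nat DIM('a)) * (ennreal (c * C / m) * ?I x)" by (simp add: distrib_right)
      also have "(1 + of_nat DIM('a)) = ennreal (1 + ?n)" by (simp add: ennreal_of_nat_eq_real_of_nat)
      also have "ennreal (1 + ?n) * (ennreal (c * C / m) * ?I x) = ennreal ((1 + ?n) * (c * C / m)) * ?I x"
        by (subst ennreal_mult') (simp_all add: mult.assoc)
      also have "ennreal \<bar>\<phi> x\<bar> + (\<Sum>b\<in>Basis. ennreal \<bar>q b x\<bar>) = ennreal (W x)"
        unfolding W_def by (subst sum_ennreal) (auto simp: sum_nonneg)
      finally show "ennreal (W x) \<le> ennreal ((1 + ?n) * (c * C / m)) * ?I x" .
    qed
  qed
  moreover have "(1 + ?n) * (c * C / m) \<ge> 0" using m c0 C(1) by simp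
  ultimately show ?thesis by (intro exI[of _ "(1 + ?n) * (c * C / m)"] conjI)
qed

lemma W_bounded: "\<exists>C. AE x in lborel. x \<in> ball 0 R \<longrightarrow> W x \<le> C"
  by (rule bootstrap[OF refl loc_int_W W_nonneg W_integral_inequality])

lemma local_C1:
  assumes R: "R \<ge> 0"
  shows "\<exists>U D. (\<forall>x. (U has_derivative (\<lambda>w. D w x)) (at x)) \<and>
    (\<forall>b \<alpha>. 0 < \<alpha> \<and> \<alpha> < 1 \<longrightarrow> (\<exists>C. \<forall>x x'. \<bar>D b x - D b x'\<bar> \<le> C * norm (x - x') powr \<alpha>)) \<and>
    (AE x in lborel. x \<in> ball 0 R \<longrightarrow> \<phi> x = U x)"
proof -
  obtain \<eta> C where \<eta>: "smooth \<eta>" "\<And>x. norm x < R \<Longrightarrow> \<eta> x = 1"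
    and P: "compact_poisson (\<lambda>x. \<eta> x * \<phi> x) (cut_lap \<eta>) (cut_grad \<eta>) (R + 2)"
    and C: "C \<ge> 0" "\<And>x. \<bar>cut_lap \<eta> x\<bar> \<le> C * (indicator (ball 0 (R + 2)) x * W x)"
    by (rule cutoff_exists[OF R]) (rule that, assumption+)
  obtain B where B: "AE x in lborel. x \<in> ball 0 (R + 2) \<longrightarrow> W x \<le> B" using W_bounded[of "R + 2"] by (elim exE) (rule that)
  define M where "M = C * max B 0"
  have M0: "M \<ge> 0" using C(1) by (simp add: M_def)
  \<comment> \<open>The density is bounded only almost everywhere, whereas
    \<open>bounded_density\<close> asks for a bound at every point; truncation changes it on a null
    set, which the potential does not see.\<close>
  define h where "h x = (if \<bar>cut_lap \<eta> x\<bar> \<le> M then cut_lap \<eta> x else 0)" for x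
  have [measurable]: "cut_lap \<eta> \<in> borel_measurable borel" by (rule loc_int_borel[OF loc_int_cut(3)[OF \<eta>(1)]])
  have hm[measurable]: "h \<in> borel_measurable borel" unfolding h_def[abs_def] by measurable
  have h_eq: "AE x in lborel. h x = cut_lap \<eta> x"
    using B
  proof eventually_elim
    case (elim x)
    have "\<bar>cut_lap \<eta> x\<bar> \<le> M"
    proof (cases "x \<in> ball 0 (R + 2)")
      case True
      have "C * W x \<le> C * max B 0" using elim True C(1) by (intro mult_left_mono) auto
      then show ?thesis using C(2)[of x] True by (simp add: M_def)
    next
      case False
      then show ?thesis using C(2)[of x] M0 by simp
    qed
    then show ?case by (simp add: h_def)
  qed
  interpret bounded_density h M "R + 2"
  proof
    show "norm x \<ge> R + 2 \<Longrightarrow> h x = 0" for x using C(2)[of x] by (auto simp: h_def)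
  qed (use n3 hm M0 in \<open>auto simp: h_def\<close>)
  define m where "m = newton_mass TYPE('a)"
  have m: "m \<noteq> 0" unfolding m_def by (rule newton_mass_nonzero[OF n3])
  have n2': "DIM('a) \<ge> 2" using n3 by simp
  show ?thesis
  proof (intro exI[of _ "\<lambda>x. (1 / m) * pot x"] exI[of _ "\<lambda>w x. (1 / m) * pot_grad w x"] conjI allI impI)
    show "((\<lambda>x. (1 / m) * pot x) has_derivative (\<lambda>w. (1 / m) * pot_grad w x)) (at x)" for x
      by (intro has_derivative_mult_right pot_has_derivative)
    fix b \<alpha> assume a: "0 < \<alpha> \<and> \<alpha> < (1::real)"
    from a have "\<exists>C. \<forall>x x'. \<bar>pot_grad b x - pot_grad b x'\<bar> \<le> C * norm (x - x') powr \<alpha>"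
      by (intro pot_grad_hoelder) auto
    then obtain C' where C': "\<And>x x'. \<bar>pot_grad b x - pot_grad b x'\<bar> \<le> C' * norm (x - x') powr \<alpha>"
      by (elim exE) (rule that, elim allE, assumption)
    show "\<exists>C. \<forall>x x'. \<bar>(1 / m) * pot_grad b x - (1 / m) * pot_grad b x'\<bar> \<le> C * norm (x - x') powr \<alpha>"
    proof (intro exI allI)
      fix x x'
      have "\<bar>(1 / m) * pot_grad b x - (1 / m) * pot_grad b x'\<bar> = \<bar>1 / m\<bar> * \<bar>pot_grad b x - pot_grad b x'\<bar>"
        by (simp only: abs_mult right_diff_distrib[symmetric])
      also have "\<dots> \<le> \<bar>1 / m\<bar> * (C' * norm (x - x') powr \<alpha>)" by (intro mult_left_mono C') auto
      finally show "\<bar>(1 / m) * pot_grad b x - (1 / m) * pot_grad b x'\<bar> \<le> (\<bar>1 / m\<bar> * C') * norm (x - x') powr \<alpha>"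
        by (simp add: mult.assoc)
    qed
  next
    show "AE x in lborel. x \<in> ball 0 R \<longrightarrow> \<phi> x = (1 / m) * pot x"
      using newton_representation(1)[OF P n2']
    proof eventually_elim
      case (elim x)
      have "(LINT y|lborel. newton0 (x - y) * cut_lap \<eta> y) = pot x"
        unfolding pot_def by (rule integral_cong_AE) (measurable, use h_eq in eventually_elim, simp)
      then show ?case using elim m \<eta>(2)[of x] by (auto simp: m_def[symmetric] field_simps)
    qed
  qed
qed

text \<open>The local representatives on balls of integer radius agree almost everywhere on common
  balls, hence everywhere by continuity, and glue to one function. Every ball lies in one of integer
  radius, so derivatives and Hoelder bounds are inherited.\<close>

theorem C1_representative:
  "\<exists>\<Phi>. (AE x in lborel. \<phi> x = \<Phi> x) \<and> continuous_on UNIV \<Phi> \<and> (\<forall>\<alpha>. 0 < \<alpha> \<and> \<alpha> < 1 \<longrightarrow> Ck_Hoelder_loc 1 \<alpha> \<Phi>)"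
proof -
  have "\<forall>k::nat. \<exists>U D. (\<forall>x. (U has_derivative (\<lambda>w. D w x)) (at x)) \<and>
    (\<forall>b \<alpha>. 0 < \<alpha> \<and> \<alpha> < 1 \<longrightarrow> (\<exists>C. \<forall>x x'. \<bar>D b x - D b x'\<bar> \<le> C * norm (x - x') powr \<alpha>)) \<and>
    (AE x in lborel. x \<in> ball 0 (real k) \<longrightarrow> \<phi> x = U x)"
    by (intro allI local_C1) simp
  from choice[OF this] obtain U where "\<forall>k. \<exists>D. (\<forall>x. (U k has_derivative (\<lambda>w. D w x)) (at x)) \<and>
    (\<forall>b \<alpha>. 0 < \<alpha> \<and> \<alpha> < 1 \<longrightarrow> (\<exists>C. \<forall>x x'. \<bar>D b x - D b x'\<bar> \<le> C * norm (x - x') powr \<alpha>)) \<and>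
    (AE x in lborel. x \<in> ball 0 (real k) \<longrightarrow> \<phi> x = U k x)" ..
  from choice[OF this] obtain D where UD: "\<forall>k. (\<forall>x. (U k has_derivative (\<lambda>w. D k w x)) (at x)) \<and>
    (\<forall>b \<alpha>. 0 < \<alpha> \<and> \<alpha> < 1 \<longrightarrow> (\<exists>C. \<forall>x x'. \<bar>D k b x - D k b x'\<bar> \<le> C * norm (x - x') powr \<alpha>)) \<and>
    (AE x in lborel. x \<in> ball 0 (real k) \<longrightarrow> \<phi> x = U k x)" ..
  have der: "(U k has_derivative (\<lambda>w. D k w x)) (at x)" for k x using UD by simp
  have hoe: "\<exists>C. \<forall>x x'. \<bar>D k b x - D k b x'\<bar> \<le> C * norm (x - x') powr \<alpha>" if "0 < \<alpha>" "\<alpha> < 1" for k b \<alpha> using UD that by simp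
  have aeq: "AE x in lborel. x \<in> ball 0 (real k) \<longrightarrow> \<phi> x = U k x" for k using UD by simp
  have Uc: "continuous_on UNIV (U k)" for k
    using has_derivative_continuous[OF der] by (auto intro: continuous_at_imp_continuous_on)
  have agree: "U i x = U j x" if "norm x < real i" "norm x < real j" for i j x
  proof (rule continuous_AE_eq[OF Uc Uc, where S="ball 0 (min (real i) (real j))"])
    show "AE x in lborel. x \<in> ball 0 (min (real i) (real j)) \<longrightarrow> U i x = U j x"
      using aeq[of i] aeq[of j] by eventually_elim auto
  qed (use that in auto)
  \<comment> \<open>The ceiling is increased by 1 so that x lies in the open ball also when its norm
    is an integer.\<close>
  define \<Phi> where "\<Phi> x = U (nat \<lceil>norm x\<rceil> + 1) x" for x
  have \<Phi>: "\<Phi> x = U k x" if "norm x < real k" for k x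
    unfolding \<Phi>_def by (rule agree[OF _ that]) linarith
  have d\<Phi>: "(\<Phi> has_derivative (\<lambda>w. D k w x)) (at x)" if "norm x < real k" for k x
    by (rule has_derivative_transform_within_open[OF der, where s="ball 0 (real k)"]) (use that \<Phi> in auto)
  have pd\<Phi>: "partial_deriv b \<Phi> x = D k b x" if "norm x < real k" for b k x
    by (rule partial_deriv_eq[OF d\<Phi>[OF that]])
  have ex: "\<exists>k::nat. norm x < real k" for x :: 'a by (rule reals_Archimedean2)
  have diff: "\<Phi> differentiable (at x)" for x using ex[of x] d\<Phi> by (auto simp: differentiable_def)
  have ball_Hoelder: "\<exists>C. \<forall>x\<in>ball x0 r. \<forall>y\<in>ball x0 r. \<bar>partial_deriv b \<Phi> x - partial_deriv b \<Phi> y\<bar> \<le> C * norm (x - y) powr \<alpha>"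
    if a: "0 < \<alpha>" "\<alpha> < 1" for x0 r b \<alpha>
  proof -
    obtain k :: nat where k: "norm x0 + r < real k" using reals_Archimedean2 by blast
    obtain C where C: "\<And>x x'. \<bar>D k b x - D k b x'\<bar> \<le> C * norm (x - x') powr \<alpha>" using hoe[OF a] by metis
    have "norm x < real k" if "x \<in> ball x0 r" for x
      using that k norm_triangle_ineq4[of x0 "x0 - x"] by (simp add: dist_norm)
    then have "partial_deriv b \<Phi> x = D k b x" if "x \<in> ball x0 r" for x using that by (intro pd\<Phi>) auto
    then show ?thesis using C by (intro exI[of _ C] ballI) (simp only:)
  qed
  have pd_cont: "continuous_on UNIV (partial_deriv b \<Phi>)" for b
  proof (rule continuous_at_imp_continuous_on, rule ballI)
    fix x :: 'a
    obtain C where C: "\<forall>y\<in>ball x 1. \<forall>z\<in>ball x 1. \<bar>partial_deriv b \<Phi> y - partial_deriv b \<Phi> z\<bar> \<le> C * norm (y - z) powr (1/2)"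
      using ball_Hoelder[of "1/2" x 1 b] by auto
    have "((\<lambda>y. norm (y - x)) \<longlongrightarrow> norm (x - x)) (at x)" by (intro tendsto_intros tendsto_ident_at)
    then have "((\<lambda>y. norm (y - x) powr (1/2)) \<longlongrightarrow> norm (x - x) powr (1/2)) (at x)"
      by (rule tendsto_powr'[OF _ tendsto_const]) auto
    from tendsto_mult[OF tendsto_const this, of C]
    have lim: "((\<lambda>y. C * norm (y - x) powr (1/2)) \<longlongrightarrow> 0) (at x)" by simp
    have "\<forall>\<^sub>F y in at x. y \<in> ball x 1" by (rule eventually_at_in_open') auto
    then have "\<forall>\<^sub>F y in at x. norm (partial_deriv b \<Phi> y - partial_deriv b \<Phi> x) \<le> C * norm (y - x) powr (1/2)"
      by eventually_elim (use C in simp)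
    from Lim_null_comparison[OF this lim] have "(partial_deriv b \<Phi> \<longlongrightarrow> partial_deriv b \<Phi> x) (at x)"
      by (simp add: Lim_null[symmetric])
    then show "isCont (partial_deriv b \<Phi>) x" by (simp add: isCont_def)
  qed
  have ck: "Ck 1 \<Phi>" using diff pd_cont by simp
  have "Ck_Hoelder_loc 1 \<alpha> \<Phi>" if a: "0 < \<alpha>" "\<alpha> < 1" for \<alpha>
    unfolding Ck_Hoelder_loc_def
  proof (intro conjI ck allI impI)
    fix bs :: "'a list" and x0 :: 'a and r :: real
    assume bs: "set bs \<subseteq> Basis \<and> length bs = 1" and r: "r > 0"
    then obtain b where b: "bs = [b]" by (cases bs) auto
    obtain C where C: "\<forall>x\<in>ball x0 r. \<forall>y\<in>ball x0 r. \<bar>partial_deriv b \<Phi> x - partial_deriv b \<Phi> y\<bar> \<le> C * norm (x - y) powr \<alpha>"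
      using ball_Hoelder[OF a] by metis
    show "\<exists>C. \<forall>x\<in>ball x0 r. \<forall>y\<in>ball x0 r. x \<noteq> y \<longrightarrow>
            norm (iter_partial_deriv bs \<Phi> x - iter_partial_deriv bs \<Phi> y) / dist x y powr \<alpha> \<le> C"
    proof (intro exI ballI impI)
      fix x y assume xy: "x \<in> ball x0 r" "y \<in> ball x0 r" "x \<noteq> y"
      then have "dist x y powr \<alpha> > 0" by simp
      then show "norm (iter_partial_deriv bs \<Phi> x - iter_partial_deriv bs \<Phi> y) / dist x y powr \<alpha> \<le> C"
        using C xy by (simp add: b iter_partial_deriv_def pos_divide_le_eq dist_norm)
    qed
  qed
  moreover have "AE x in lborel. \<phi> x = \<Phi> x"
  proof -
    have "AE x in lborel. \<forall>k. x \<in> ball 0 (real k) \<longrightarrow> \<phi> x = U k x" using aeq by (simp add: AE_all_countable)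
    then show ?thesis
    proof eventually_elim
      case (elim x)
      obtain k :: nat where "norm x < real k" using ex by blast
      then show ?case using elim \<Phi>[of x k] by simp
    qed
  qed
  moreover have "continuous_on UNIV \<Phi>"
    using diff differentiable_imp_continuous_within by (intro continuous_at_imp_continuous_on) blast
  ultimately show ?thesis by blast
qed

end

section \<open>The factorisation of atomic eigenfunctions\<close>

context coulomb_terms
begin

theorem factorisation:
  fixes \<psi> :: "'a \<Rightarrow> real"
  assumes op: "schroedinger_op V (\<lambda>x. complex_of_real (\<psi> x)) (\<lambda>x. complex_of_real E * complex_of_real (\<psi> x))"
    and \<psi>: "\<psi> \<in> L2" and n3: "DIM('a) \<ge> 3"
  shows "\<exists>\<Phi>. (AE x in lborel. exp (- F x) * \<psi> x = \<Phi> x) \<and> continuous_on UNIV \<Phi> \<and>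
    (\<forall>\<alpha>. 0 < \<alpha> \<and> \<alpha> < 1 \<longrightarrow> Ck_Hoelder_loc 1 \<alpha> \<Phi>)"
proof -
  obtain p where p: "\<And>b. b \<in> Basis \<Longrightarrow> p b \<in> borel_measurable borel"
    "\<And>b. b \<in> Basis \<Longrightarrow> loc_int (\<lambda>x. (p b x)\<^sup>2)"
    "\<And>b \<zeta>. b \<in> Basis \<Longrightarrow> test_function \<zeta> \<Longrightarrow>
      (LINT x|lborel. partial_deriv b \<zeta> x * \<psi> x) = - (LINT x|lborel. \<zeta> x * p b x)"
    "\<And>\<zeta>. test_function \<zeta> \<Longrightarrow>
      (\<Sum>b\<in>Basis. LINT x|lborel. partial_deriv b \<zeta> x * p b x) + (LINT x|lborel. \<zeta> x * (V x * \<psi> x)) =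
      E * (LINT x|lborel. \<zeta> x * \<psi> x)"
    by (rule eigenfunction_weak_equation[OF op \<psi>]) (rule that)
  note hyps = L2_real_loc_int(2)[OF \<psi>] L2_real_loc_int(1)[OF \<psi>] p
  define \<phi> where "\<phi> x = exp (- F x) * \<psi> x" for x
  define q where "q b x = exp (- F x) * (p b x - \<psi> x * DF b x)" for b x
  \<comment> \<open>Minus the integrand factor of \<zeta> in \<open>transformed_eqn\<close>, so that
    the Laplacian of \<phi> equals g in the weak sense.\<close>
  define g where "g x = - (2 * (\<Sum>b\<in>Basis. DF b x * q b x) + ((\<Sum>b\<in>Basis. (DF b x)\<^sup>2) + E) * \<phi> x)" for x
  define D where "D b = (\<Sum>t\<in>T. \<bar>c t\<bar> * norm (L t b))" for b
  have D: "\<bar>DF b x\<bar> \<le> D b" for b x unfolding D_def by (rule DF_bound)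
  have D0: "D b \<ge> 0" for b unfolding D_def by (intro sum_nonneg) auto
  have loc_int_psi: "loc_int \<psi>" by (rule loc_int_of_sq[OF hyps(2,1)])
  have loc_int_p: "loc_int (p b)" if "b \<in> Basis" for b by (rule loc_int_of_sq[OF p(2,1)]) (use that in auto)
  have F_mult: "loc_int (\<lambda>x. exp (- F x) * w x)" if "loc_int w" for w
    by (rule loc_int_mult_cont[OF that]) (auto intro!: continuous_intros F_cont)
  have DF_mult: "loc_int (\<lambda>x. DF b x * w x)" if "loc_int w" for w b
    by (rule loc_int_mult[OF that]) (use D in auto)
  have l\<phi>: "loc_int \<phi>" unfolding \<phi>_def[abs_def] by (intro F_mult loc_int_psi)
  have lq: "loc_int (q b)" if b: "b \<in> Basis" for b
    unfolding q_def[abs_def] using DF_mult[OF loc_int_psi, of b] by (intro F_mult loc_int_diff loc_int_p b) (simp add: mult.commute)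
  have lg: "loc_int g"
  proof -
    have "loc_int (\<lambda>x. - (2 * (\<Sum>b\<in>Basis. DF b x * q b x) + ((\<Sum>b\<in>Basis. DF b x * (DF b x * \<phi> x)) + E * \<phi> x)))"
      by (intro loc_int_minus loc_int_add loc_int_cmult loc_int_sum DF_mult lq l\<phi>)
    then show ?thesis by (simp add: g_def[abs_def] power2_eq_square distrib_right sum_distrib_right mult.assoc)
  qed
  define A where "A = 2 * (\<Sum>b\<in>Basis. D b) + ((\<Sum>b\<in>Basis. (D b)\<^sup>2) + \<bar>E\<bar>)"
  have A0: "A \<ge> 0" unfolding A_def using D0 by (intro add_nonneg_nonneg mult_nonneg_nonneg sum_nonneg) auto
  have gle: "\<bar>g x\<bar> \<le> A * (\<bar>\<phi> x\<bar> + (\<Sum>b\<in>Basis. \<bar>q b x\<bar>))" for x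
  proof -
    let ?W = "\<bar>\<phi> x\<bar> + (\<Sum>b\<in>Basis. \<bar>q b x\<bar>)"
    have qs: "0 \<le> (\<Sum>b\<in>Basis. \<bar>q b x\<bar>)" by (intro sum_nonneg) auto
    have qW: "\<bar>q b x\<bar> \<le> ?W" if "b \<in> Basis" for b
    proof -
      have "\<bar>q b x\<bar> \<le> (\<Sum>b\<in>Basis. \<bar>q b x\<bar>)" by (intro member_le_sum) (use that in auto)
      then show ?thesis by simp
    qed
    have "\<bar>\<Sum>b\<in>Basis. DF b x * q b x\<bar> \<le> (\<Sum>b\<in>Basis. D b * ?W)"
    proof (rule order_trans[OF sum_abs sum_mono])
      fix b :: 'a assume "b \<in> Basis"
      then show "\<bar>DF b x * q b x\<bar> \<le> D b * ?W" unfolding abs_mult by (intro mult_mono D qW D0) auto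
    qed
    moreover have "\<bar>((\<Sum>b\<in>Basis. (DF b x)\<^sup>2) + E) * \<phi> x\<bar> \<le> ((\<Sum>b\<in>Basis. (D b)\<^sup>2) + \<bar>E\<bar>) * ?W"
      unfolding abs_mult
    proof (rule mult_mono)
      have "(\<Sum>b\<in>Basis. (DF b x)\<^sup>2) \<le> (\<Sum>b\<in>Basis. (D b)\<^sup>2)"
        using D D0 by (intro sum_mono) (simp add: abs_le_square_iff[symmetric])
      moreover have "0 \<le> (\<Sum>b\<in>(Basis::'a set). (DF b x)\<^sup>2)" by (intro sum_nonneg) auto
      ultimately show "\<bar>(\<Sum>b\<in>Basis. (DF b x)\<^sup>2) + E\<bar> \<le> (\<Sum>b\<in>Basis. (D b)\<^sup>2) + \<bar>E\<bar>" by linarith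
      show "0 \<le> (\<Sum>b\<in>(Basis::'a set). (D b)\<^sup>2) + \<bar>E\<bar>" by (intro add_nonneg_nonneg sum_nonneg) auto
    qed (use qs in auto)
    ultimately have "\<bar>g x\<bar> \<le> 2 * (\<Sum>b\<in>Basis. D b * ?W) + ((\<Sum>b\<in>Basis. (D b)\<^sup>2) + \<bar>E\<bar>) * ?W"
      unfolding g_def by linarith
    also have "\<dots> = A * ?W" unfolding A_def by (simp add: distrib_right sum_distrib_right)
    finally show ?thesis .
  qed
  interpret elliptic \<phi> g q A
  proof
    fix b :: 'a and \<zeta> :: "'a \<Rightarrow> real" assume "b \<in> Basis" "test_function \<zeta>"
    then show "(LINT x|lborel. partial_deriv b \<zeta> x * \<phi> x) = - (LINT x|lborel. \<zeta> x * q b x)"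
      unfolding \<phi>_def q_def by (intro transformed_weak[OF hyps])
  next
    fix \<zeta> :: "'a \<Rightarrow> real" assume "test_function \<zeta>"
    from transformed_eqn[OF hyps this]
    show "(\<Sum>b\<in>Basis. LINT x|lborel. partial_deriv b \<zeta> x * q b x) = - (LINT x|lborel. \<zeta> x * g x)"
      unfolding g_def mult_minus_right Bochner_Integration.integral_minus minus_minus q_def \<phi>_def .
  qed (use n3 l\<phi> lq lg gle A0 in auto)
  show ?thesis using C1_representative unfolding \<phi>_def .
qed

end

text \<open>The diagonal pair \<open>(j, j)\<close> stands for the attraction of electron \<open>j\<close> by the nucleus.\<close>

definition pair_map :: "'n::finite \<times> 'n \<Rightarrow> (real^3)^'n \<Rightarrow> real^3" where
  "pair_map t x = (if fst t = snd t then x $ fst t else x $ fst t - x $ snd t)"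

text \<open>Chosen so that 2 * scale * coefficient is the charge of the term: -Z on the diagonal and
  1 for a pair, whose scale is 2 because the difference depends on two electrons.\<close>

definition pair_coeff :: "real \<Rightarrow> 'n \<times> 'n \<Rightarrow> real" where
  "pair_coeff Z t = (if fst t = snd t then - (Z / 2) else 1 / 4)"

definition pair_scale :: "'n \<times> 'n \<Rightarrow> real" where
  "pair_scale t = (if fst t = snd t then 1 else 2)"

lemma coisometry_pair_map: "coisometry (pair_map t :: (real^3)^'n::finite \<Rightarrow> real^3) (pair_scale t)"
proof (rule coisometry.intro)
  show "bounded_linear (pair_map t :: (real^3)^'n \<Rightarrow> real^3)"
    unfolding pair_map_def[abs_def]
    by (cases "fst t = snd t") (simp_all add: bounded_linear_vec_nth bounded_linear_sub)
  show "pair_scale t > 0" by (simp add: pair_scale_def)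
  fix y :: "real^3"
  \<comment> \<open>This is the adjoint of the pair map applied to y. Parseval then turns the sum
    over the basis into |a|^2, which is |y|^2 for one electron and 2 |y|^2 for two distinct
    ones.\<close>
  define a :: "(real^3)^'n" where "a = (if fst t = snd t then axis (fst t) y else axis (fst t) y - axis (snd t) y)"
  have a: "y \<bullet> pair_map t b = a \<bullet> b" for b
    by (simp add: a_def pair_map_def inner_diff_left inner_diff_right inner_axis inner_commute[of "axis _ _"] inner_commute[of y])
  have "(\<Sum>b\<in>Basis. (y \<bullet> pair_map t b)\<^sup>2) = a \<bullet> a"
    unfolding a by (simp add: euclidean_inner[of a a] power2_eq_square)
  also have "\<dots> = pair_scale t * (norm y)\<^sup>2"
    by (auto simp: a_def pair_scale_def inner_diff_left inner_diff_right inner_axis_axis power2_norm_eq_inner)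
  finally show "(\<Sum>b\<in>Basis. (y \<bullet> pair_map t b)\<^sup>2) = pair_scale t * (norm y)\<^sup>2" .
qed

lemma sum_pairs:
  fixes f :: "'n::{finite,linorder} \<times> 'n \<Rightarrow> real"
  shows "(\<Sum>t\<in>{(j, k). j \<le> k}. f t) = (\<Sum>j\<in>UNIV. f (j, j)) + (\<Sum>t\<in>{(j, k). j < k}. f t)"
proof -
  have "{(j, k). j \<le> k} = (\<lambda>j::'n. (j, j)) ` UNIV \<union> {(j, k). j < k}" by (auto simp: le_less)
  then have "(\<Sum>t\<in>{(j, k). j \<le> k}. f t) = (\<Sum>t\<in>(\<lambda>j. (j, j)) ` UNIV. f t) + (\<Sum>t\<in>{(j, k). j < k}. f t)"
    by (simp only:) (rule sum.union_disjoint, auto)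
  also have "(\<Sum>t\<in>(\<lambda>j. (j, j)) ` UNIV. f t) = (\<Sum>j\<in>UNIV. f (j, j))"
    by (subst sum.reindex) (auto simp: inj_on_def)
  finally show ?thesis .
qed

text \<open>An element of L2 is fixed only up to null sets, so the factorisation is asserted for its
  continuous representative \<open>\<psi>c\<close>. A single \<phi> serves all exponents
  \<alpha>.\<close>

theorem proposition1p5:
  fixes Z E :: real
    and \<psi> :: "(real^3)^'n::{finite,linorder} \<Rightarrow> real"
  assumes "Z > 0"
    and "\<psi> \<in> L2"
    and "atomic_hamiltonian Z (\<lambda>x. complex_of_real (\<psi> x))
           (\<lambda>x. complex_of_real E * complex_of_real (\<psi> x))"
    and "L2_norm \<psi> = 1"
  shows "\<exists>\<psi>c \<phi> :: (real^3)^'n::{finite,linorder} \<Rightarrow> real.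
           continuous_on UNIV \<psi>c \<and> (AE x in lborel. \<psi> x = \<psi>c x) \<and>
           (\<forall>x. \<psi>c x = exp (atomic_F Z x) * \<phi> x) \<and>
           (\<forall>\<alpha>. 0 < \<alpha> \<and> \<alpha> < 1 \<longrightarrow> Ck_Hoelder_loc 1 \<alpha> \<phi>)"
proof -
  let ?T = "{(j, k). j \<le> k} :: ('n \<times> 'n) set"
  interpret coulomb_terms ?T pair_map "pair_coeff Z" pair_scale
    by (rule coulomb_terms.intro) (auto intro: coisometry_pair_map)
  have F: "F x = atomic_F Z x" for x
    unfolding F_def atomic_F_def sum_pairs
    by (intro arg_cong2[where f="(+)"])
      (auto simp: pair_coeff_def pair_map_def sum_negf[symmetric] intro!: sum.cong)
  have V: "V = coulomb_potential Z"
    unfolding V_def[abs_def] coulomb_potential_def[abs_def] sum_pairs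
    by (intro ext arg_cong2[where f="(+)"])
      (auto simp: pair_coeff_def pair_map_def pair_scale_def sum_negf[symmetric] intro!: sum.cong)
  have dim: "DIM((real^3)^'n::{finite,linorder}) \<ge> 3" by (simp add: Suc_le_eq)
  obtain \<Phi> where \<Phi>: "AE x in lborel. exp (- F x) * \<psi> x = \<Phi> x" "continuous_on UNIV \<Phi>"
    "\<forall>\<alpha>. 0 < \<alpha> \<and> \<alpha> < 1 \<longrightarrow> Ck_Hoelder_loc 1 \<alpha> \<Phi>"
    using factorisation[OF assms(3)[folded V] assms(2) dim] by (elim exE conjE)
  show ?thesis
  proof (intro exI conjI)
    show "continuous_on UNIV (\<lambda>x. exp (atomic_F Z x) * \<Phi> x)"
      unfolding F[symmetric] by (intro continuous_intros F_cont \<Phi>(2))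
    show "AE x in lborel. \<psi> x = exp (atomic_F Z x) * \<Phi> x"
      using \<Phi>(1)
    proof eventually_elim
      case (elim x)
      show ?case unfolding F[symmetric] elim[symmetric] by (simp add: exp_minus)
    qed
  qed (use \<Phi>(3) in auto)
qed

end
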